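(* Let $\Delta\subset\mathbb C$ be the unit disc and let $\mathbb S=\{L_1,\dots,L_a\}$, $a\ge1$, be a finite system of holomorphic $m$-vector fields on $\Delta^n$, i.e. each $L_\alpha=(L_{\alpha1},\dots,L_{\alpha m})$ is an $m$-tuple of pairwise commuting holomorphic vector fields, such that the $am$ vector fields $L_{\alpha j}$ are linearly independent at every point; set $d:=n-am\ge0$. For $L\in\mathbb S$ and $s\in\mathbb C^m$ small write $L_s(z):=\exp(s_mL_m)\circ\cdots\circ\exp(s_1L_1)(z)$, and for $\mathbb L^k=(L^1,\dots,L^k)\in\mathbb S^k$ and $t_{(k)}=(t_1,\dots,t_k)\in(\mathbb C^m)^k$ small write $\mathbb L^k_{t_{(k)}}(z):=L^k_{t_k}\circ\cdots\circ L^1_{t_1}(z)$ and $\Gamma_{\mathbb L^k}(t_{(k)}):=\mathbb L^k_{t_{(k)}}(0)$. Define inductively $\mathbb L^{*a}:=(L_1,\dots,L_a)$ and, given $\mathbb L^{*k}$ with $\operatorname{gen\text{-}rk}\Gamma_{\mathbb L^{*k}}=am+e_1+\cdots+e_{k-a}$, let $e_{k-a+1}:=\max_{1\le\alpha\le a}\big(\operatorname{gen\text{-}rk}\Gamma_{(\mathbb L^{*k},L_\alpha)}\big)-\operatorname{gen\text{-}rk}\Gamma_{\mathbb L^{*k}}$; if $e_{k-a+1}>0$ set $\mathbb L^{*k+1}:=(\mathbb L^{*k},L_{\alpha})$ for some $\alpha$ realizing the maximum, otherwise stop. Let $\kappa_0$ be the number of positive $e_j$ obtained and $\mu_0:=a+\kappa_0$.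 Then $\kappa_0\le d$, and there exist $t^*_{(\mu_0)}=(t_1^*,\dots,t^*_{\mu_0-1},0)$ arbitrarily close to $0$ and a neighborhood $\mathcal W^*$ of $t^*_{(\mu_0)}$ such that, writing $\underline{\mathbb L}^{*\mu_0-1}:=(L^{*\mu_0-1},\dots,L^{*1})$ and $\underline t^*_{(\mu_0-1)}:=(-t^*_{\mu_0-1},\dots,-t^*_1)$: (1) $\Gamma_{\mathbb L^{*\mu_0}}$ has rank $e:=am+e_1+\cdots+e_{\kappa_0}$ at $t^*_{(\mu_0)}$; (2) $\underline{\mathbb L}^{*\mu_0-1}_{\underline t^*_{(\mu_0-1)}}\big(\mathbb L^{*\mu_0}_{t^*_{(\mu_0)}}(0)\big)=0$; (3) the map $\mathcal W^*\ni t_{(\mu_0)}\mapsto\underline{\mathbb L}^{*\mu_0-1}_{\underline t^*_{(\mu_0-1)}}\big(\Gamma_{\mathbb L^{*\mu_0}}(t_{(\mu_0)})\big)$ has constant rank $e$; (4) its image $\mathcal O_0$ is a complex submanifold through $0$ to which every element of $\mathbb S$ is tangent, every complex manifold through $0$ to which all elements of $\mathbb S$ are tangent contains the germ of $\mathcal O_0$ at $0$, and $\mathcal O_0$ represents the germ at $0$ of the $\mathbb S$-orbit of $0$ (the set of points $\mathbb L^k_{t_{(k)}}(0)$, $\mathbb L^k\in\mathbb S^k$, $t_{(k)}$ small); (5) $\dim_{\mathbb C}\mathcal O_0=e$; in particular $e$ does not depend on the choices made in the construction.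
   Context: The generic rank $\operatorname{gen\text{-}rk}$ of a holomorphic map on a connected domain is its maximal rank, attained outside a proper analytic subset. All maps $\Gamma_{\mathbb L^k}$ are considered on a small polydisc $(\delta\Delta^m)^k$ ($k\le 3n$) on which they are defined. *)

theory Defs
  imports "HOL-Analysis.Analysis"
begin

text \<open>Points of C^n are elements of complex^'n.  Complex scalar multiplication is (*s).\<close>

definition polydisc :: "real \<Rightarrow> (complex^'n) set" where
  "polydisc r = {z. \<forall>i. norm (z $ i) < r}"

text \<open>Holomorphic map on an open set U of C^n: Frechet differentiable with complex-linear derivative.\<close>
definition holo_on :: "(complex^'n) set \<Rightarrow> (complex^'n \<Rightarrow> complex^'n) \<Rightarrow> bool" where
  "holo_on U F \<longleftrightarrow> (\<forall>z\<in>U. \<exists>D. (F has_derivative D) (at z) \<and> (\<forall>c v. D (c *s v) = c *s D v))"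

text \<open>Lie bracket [X,Y] vanishes at z: DY(z) X(z) - DX(z) Y(z) = 0.\<close>
definition commute_at :: "(complex^'n \<Rightarrow> complex^'n) \<Rightarrow> (complex^'n \<Rightarrow> complex^'n) \<Rightarrow> complex^'n \<Rightarrow> bool" where
  "commute_at X Y z \<longleftrightarrow> frechet_derivative Y (at z) (X z) = frechet_derivative X (at z) (Y z)"

text \<open>Complex-time flow exp(s X)(z) of a holomorphic vector field X on the unit polydisc:
  value at s of the holomorphic solution curve through z, defined on a disc of radius > |s|.\<close>
definition cflow :: "(complex^'n \<Rightarrow> complex^'n) \<Rightarrow> complex \<Rightarrow> complex^'n \<Rightarrow> complex^'n" where
  "cflow X s z = (THE w. \<exists>r > norm s. \<exists>\<gamma>. \<gamma> 0 = z \<and> w = \<gamma> s \<and>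
      (\<forall>\<sigma>. norm \<sigma> < r \<longrightarrow> \<gamma> \<sigma> \<in> polydisc 1 \<and>
            (\<gamma> has_derivative (\<lambda>h. h *s X (\<gamma> \<sigma>))) (at \<sigma>)))"

text \<open>L_s(z) = exp(s_m L_m) o ... o exp(s_1 L_1)(z); components indexed 0..m-1.\<close>
fun mflow :: "(nat \<Rightarrow> complex^'n \<Rightarrow> complex^'n) \<Rightarrow> nat \<Rightarrow> (nat \<Rightarrow> complex) \<Rightarrow> complex^'n \<Rightarrow> complex^'n" where
  "mflow L 0 s z = z"
| "mflow L (Suc j) s z = cflow (L j) (s j) (mflow L j s z)"

text \<open>The system S: S \<alpha> j is the j-th field of L_\<alpha> (\<alpha> < a, j < m).
  A word L^k in S^k is given by seq :: nat \<Rightarrow> nat (seq i = index of L^{i+1}),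
  parameters t i j (i < k, j < m).  flowk computes L^k_{t_k} o ... o L^1_{t_1}(z).\<close>
fun flowk :: "(nat \<Rightarrow> nat \<Rightarrow> complex^'n \<Rightarrow> complex^'n) \<Rightarrow> nat \<Rightarrow> (nat \<Rightarrow> nat) \<Rightarrow> nat
     \<Rightarrow> (nat \<Rightarrow> nat \<Rightarrow> complex) \<Rightarrow> complex^'n \<Rightarrow> complex^'n" where
  "flowk S m seq 0 t z = z"
| "flowk S m seq (Suc i) t z = mflow (S (seq i)) m (t i) (flowk S m seq i t z)"

definition Gam :: "(nat \<Rightarrow> nat \<Rightarrow> complex^'n \<Rightarrow> complex^'n) \<Rightarrow> nat \<Rightarrow> (nat \<Rightarrow> nat) \<Rightarrow> nat
     \<Rightarrow> (nat \<Rightarrow> nat \<Rightarrow> complex) \<Rightarrow> complex^'n" where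
  "Gam S m seq k t = flowk S m seq k t 0"

text \<open>Parameter polydisc: t_{(k)} with |t i j - c i j| < r for i<k, j<m.\<close>
definition ppoly :: "nat \<Rightarrow> nat \<Rightarrow> real \<Rightarrow> (nat \<Rightarrow> nat \<Rightarrow> complex) \<Rightarrow> (nat \<Rightarrow> nat \<Rightarrow> complex) set" where
  "ppoly k m r c = {t. \<forall>i<k. \<forall>j<m. norm (t i j - c i j) < r}"

definition pupd :: "(nat \<Rightarrow> nat \<Rightarrow> complex) \<Rightarrow> nat \<Rightarrow> nat \<Rightarrow> complex \<Rightarrow> (nat \<Rightarrow> nat \<Rightarrow> complex)" where
  "pupd t i j w = t(i := (t i)(j := w))"

text \<open>Complex partial derivative of F with respect to the variable t i j at t.\<close>
definition cpartial :: "((nat \<Rightarrow> nat \<Rightarrow> complex) \<Rightarrow> complex^'n) \<Rightarrow> (nat \<Rightarrow> nat \<Rightarrow> complex)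
     \<Rightarrow> nat \<Rightarrow> nat \<Rightarrow> complex^'n" where
  "cpartial F t i j = (THE v. ((\<lambda>w. F (pupd t i j w)) has_derivative (\<lambda>h. h *s v)) (at (t i j)))"

text \<open>Rank at t of a holomorphic map of the variables t i j (i<k, j<m): rank of the complex
  Jacobian, i.e. the complex dimension of the span of the partial derivatives.\<close>
definition rank_at :: "nat \<Rightarrow> nat \<Rightarrow> ((nat \<Rightarrow> nat \<Rightarrow> complex) \<Rightarrow> complex^'n)
     \<Rightarrow> (nat \<Rightarrow> nat \<Rightarrow> complex) \<Rightarrow> nat" where
  "rank_at k m F t = vec.dim {cpartial F t i j | i j. i < k \<and> j < m}"

text \<open>Generic (= maximal) rank on the polydisc (\<delta>\<Delta>^m)^k.\<close>
definition gen_rk :: "nat \<Rightarrow> nat \<Rightarrow> real \<Rightarrow> ((nat \<Rightarrow> nat \<Rightarrow> complex) \<Rightarrow> complex^'n) \<Rightarrow> nat" where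
  "gen_rk k m \<delta> F = Max ((\<lambda>t. rank_at k m F t) ` ppoly k m \<delta> (\<lambda>_ _. 0))"

text \<open>A run of the inductive construction of L^{*k}: seq i = i for i < a; for k = a .. a+\<kappa>-1
  the next field realizes the maximal generic rank, with positive increment; at k = a+\<kappa>
  no positive increment is possible.\<close>
definition valid_run :: "(nat \<Rightarrow> nat \<Rightarrow> complex^'n \<Rightarrow> complex^'n) \<Rightarrow> nat \<Rightarrow> nat \<Rightarrow> real
     \<Rightarrow> (nat \<Rightarrow> nat) \<Rightarrow> nat \<Rightarrow> bool" where
  "valid_run S a m \<delta> seq \<kappa> \<longleftrightarrow>
     (\<forall>i<a. seq i = i) \<and>
     (\<forall>k. a \<le> k \<and> k < a + \<kappa> \<longrightarrow>
        seq k < a \<and>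
        gen_rk (Suc k) m \<delta> (Gam S m seq (Suc k)) =
          Max ((\<lambda>\<alpha>. gen_rk (Suc k) m \<delta> (Gam S m (seq(k := \<alpha>)) (Suc k))) ` {..<a}) \<and>
        gen_rk (Suc k) m \<delta> (Gam S m seq (Suc k)) > gen_rk k m \<delta> (Gam S m seq k)) \<and>
     \<not> (Max ((\<lambda>\<alpha>. gen_rk (Suc (a + \<kappa>)) m \<delta> (Gam S m (seq(a + \<kappa> := \<alpha>)) (Suc (a + \<kappa>)))) ` {..<a})
          > gen_rk (a + \<kappa>) m \<delta> (Gam S m seq (a + \<kappa>)))"

text \<open>e = am + e_1 + ... + e_\<kappa>, with e_j the successive increments of generic rank.\<close>
definition e_total :: "(nat \<Rightarrow> nat \<Rightarrow> complex^'n \<Rightarrow> complex^'n) \<Rightarrow> nat \<Rightarrow> nat \<Rightarrow> real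
     \<Rightarrow> (nat \<Rightarrow> nat) \<Rightarrow> nat \<Rightarrow> nat" where
  "e_total S a m \<delta> seq \<kappa> = a * m + (\<Sum>j<\<kappa>.
      gen_rk (a + j + 1) m \<delta> (Gam S m seq (a + j + 1)) - gen_rk (a + j) m \<delta> (Gam S m seq (a + j)))"

text \<open>Reversed word with negated times: (L^{*p},...,L^{*1}) with times (-t_p,...,-t_1), p = k-1.\<close>
definition rev_seq :: "(nat \<Rightarrow> nat) \<Rightarrow> nat \<Rightarrow> (nat \<Rightarrow> nat)" where
  "rev_seq seq p = (\<lambda>i. seq (p - 1 - i))"

definition rev_par :: "(nat \<Rightarrow> nat \<Rightarrow> complex) \<Rightarrow> nat \<Rightarrow> (nat \<Rightarrow> nat \<Rightarrow> complex)" where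
  "rev_par t p = (\<lambda>i j. - t (p - 1 - i) j)"

text \<open>Embedded complex submanifold of C^n of complex dimension e: locally straightened by a
  biholomorphism onto a coordinate e-plane.\<close>
definition csubmanifold :: "(complex^'n) set \<Rightarrow> nat \<Rightarrow> bool" where
  "csubmanifold M e \<longleftrightarrow> (\<forall>p\<in>M. \<exists>U \<phi> \<psi> J. open U \<and> p \<in> U \<and> open (\<phi> ` U) \<and>
      holo_on U \<phi> \<and> holo_on (\<phi> ` U) \<psi> \<and> (\<forall>z\<in>U. \<psi> (\<phi> z) = z) \<and>
      card J = e \<and> \<phi> ` (M \<inter> U) = \<phi> ` U \<inter> {w. \<forall>i. i \<notin> J \<longrightarrow> w $ i = 0})"

text \<open>Tangent space of M at p: velocities of holomorphic discs in M through p.\<close>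
definition ctangent :: "(complex^'n) set \<Rightarrow> complex^'n \<Rightarrow> (complex^'n) set" where
  "ctangent M p = {v. \<exists>r>0. \<exists>\<gamma>. \<gamma> 0 = p \<and> (\<forall>\<sigma>. norm \<sigma> < r \<longrightarrow> \<gamma> \<sigma> \<in> M) \<and>
      (\<forall>\<sigma>. norm \<sigma> < r \<longrightarrow> (\<exists>D. (\<gamma> has_derivative (\<lambda>h. h *s D)) (at \<sigma>))) \<and>
      (\<gamma> has_derivative (\<lambda>h. h *s v)) (at 0)}"

text \<open>All m-vector fields of the system (a of them) are tangent to M.\<close>
definition system_tangent :: "(nat \<Rightarrow> nat \<Rightarrow> complex^'n \<Rightarrow> complex^'n) \<Rightarrow> nat \<Rightarrow> nat
     \<Rightarrow> (complex^'n) set \<Rightarrow> bool" where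
  "system_tangent S a m M \<longleftrightarrow> (\<forall>\<alpha><a. \<forall>j<m. \<forall>p\<in>M. S \<alpha> j p \<in> ctangent M p)"

text \<open>Orbit of 0 with small times (k \<le> 3n, parameters in (\<delta>\<Delta>^m)^k).\<close>
definition orbit0 :: "(nat \<Rightarrow> nat \<Rightarrow> complex^'n \<Rightarrow> complex^'n) \<Rightarrow> nat \<Rightarrow> nat \<Rightarrow> real
     \<Rightarrow> (complex^'n) set" where
  "orbit0 S a m \<delta> = {Gam S m seq k t | seq k t. k \<le> 3 * CARD('n) \<and> (\<forall>i<k. seq i < a) \<and>
      t \<in> ppoly k m \<delta> (\<lambda>_ _. 0)}"

end

theory Submission
  imports Defs "HOL-Complex_Analysis.Conformal_Mappings"
begin

text \<open>Flows of holomorphic fields depend holomorphically on time and initial point (Picard iteration), so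
  the rank of \<open>\<Gamma>\<close> is governed by holomorphic minors and its maximum is attained arbitrarily close to
  \<open>0\<close>; because the fields of a multivector field commute, the last time block may be taken to be \<open>0\<close>.
  Near such a point the image of \<open>\<Gamma>\<close> is a manifold, and since no extension of the word increases the
  generic rank, this manifold is tangent to the whole system. Flows then stay inside it, hence every
  longer word has generic rank at most \<open>e\<close>. Applied to the word followed by its reversal, this shows
  that \<open>\<Psi>\<close> has constant rank \<open>e\<close> and that its image is tangent to the system. Flows from \<open>0\<close> for small
  times stay in any tangent manifold through \<open>0\<close>; conversely, running the same construction with much
  smaller times gives a submersion onto a neighbourhood of \<open>0\<close> in the image of \<open>\<Psi>\<close>, which is therefore
  the germ of the orbit.\<close>

section \<open>Holomorphic maps between complex Euclidean spaces\<close>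

text \<open>The generic rank is a maximum over the fixed polydisc of radius \<delta>, whereas the
  points wanted lie arbitrarily close to 0. The value e found at scale \<delta> is therefore reused
  at every smaller scale d: the whole construction can be repeated there with the same e, and a
  manifold of dimension e inside another one of dimension e is open in it. Comparing two scales in
  this way turns an invariant manifold into the germ of the orbit, and minimality among manifolds of
  any dimension is then read off from the orbit. The image of \<Gamma> near a point of maximal rank
  need not contain 0, hence the return along the reversed word. Moving a tangent manifold by a flow
  over a time that is not small gives no tangency by itself; this has to be shown afresh, and for
  that the rank bound is needed for words of up to 2\<mu> blocks with \<mu> = a + \<kappa>. If m
  \<ge> 1, then \<mu> \<le> am + \<kappa> \<le> n, so such words fit into the 3n blocks that are
  allowed; m = 0 is degenerate and treated apart. Time parameters are functions of two indices. To
  differentiate jointly they are transported to the coordinates of one space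
  \<open>complex ^ 'q\<close> with enough room for 2\<mu> blocks of m times.\<close>

class complex_vec = euclidean_space +
  fixes cscale :: "complex \<Rightarrow> 'a \<Rightarrow> 'a" (infixr "*\<^sub>C" 75)
  assumes cscale_add_right: "c *\<^sub>C (x + y) = c *\<^sub>C x + c *\<^sub>C y"
    and cscale_add_left: "(c + d) *\<^sub>C x = c *\<^sub>C x + d *\<^sub>C x"
    and cscale_cscale: "c *\<^sub>C d *\<^sub>C x = (c * d) *\<^sub>C x"
    and cscale_of_real: "complex_of_real r *\<^sub>C x = r *\<^sub>R x"
    and norm_cscale: "norm (c *\<^sub>C x) = norm c * norm x"

instantiation complex :: complex_vec
begin
definition cscale_complex :: "complex \<Rightarrow> complex \<Rightarrow> complex" where
  [simp]: "cscale_complex c z = c * z"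
instance
  by standard (auto simp: algebra_simps norm_mult scaleR_conv_of_real)
end

instantiation prod :: (complex_vec, complex_vec) complex_vec
begin
definition cscale_prod :: "complex \<Rightarrow> 'a \<times> 'b \<Rightarrow> 'a \<times> 'b" where
  "cscale_prod c z = (c *\<^sub>C fst z, c *\<^sub>C snd z)"
instance
proof
  fix c :: complex and x :: "'a \<times> 'b"
  show "norm (c *\<^sub>C x) = norm c * norm x"
    by (simp add: cscale_prod_def norm_prod_def norm_cscale power_mult_distrib
        distrib_left [symmetric] real_sqrt_mult)
qed (auto simp: cscale_prod_def cscale_add_right cscale_add_left cscale_cscale cscale_of_real)
end

instantiation vec :: (complex_vec, finite) complex_vec
begin
definition cscale_vec :: "complex \<Rightarrow> 'a ^ 'b \<Rightarrow> 'a ^ 'b" where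
  "cscale_vec c v = (\<chi> i. c *\<^sub>C (v $ i))"
instance
proof
  fix c :: complex and x :: "'a ^ 'b"
  show "norm (c *\<^sub>C x) = norm c * norm x"
    by (simp add: cscale_vec_def norm_vec_def L2_set_def norm_cscale power_mult_distrib
        sum_distrib_left [symmetric] real_sqrt_mult)
qed (auto simp: cscale_vec_def cscale_add_right cscale_add_left cscale_cscale cscale_of_real vec_eq_iff)
end

lemma cscale_Pair [simp]: "c *\<^sub>C (x, y) = (c *\<^sub>C x, c *\<^sub>C y)"
  by (simp add: cscale_prod_def)

lemma cscale_vec_nth [simp]: "(c *\<^sub>C v) $ i = c *\<^sub>C (v $ i)"
  by (simp add: cscale_vec_def)

lemma cscale_eq_vector_scalar_mult: "c *\<^sub>C (v :: complex ^ 'n) = c *s v"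
  by (simp add: vec_eq_iff)

lemma cscale_one [simp]: "1 *\<^sub>C x = x"
  using cscale_of_real[of 1 x] by simp

lemma cscale_zero_left [simp]: "0 *\<^sub>C x = 0"
  using cscale_of_real[of 0 x] by simp

lemma cscale_zero_right [simp]: "c *\<^sub>C (0::'a::complex_vec) = 0"
  using cscale_add_right[of c 0 "0::'a"] by simp

lemma cscale_minus_one: "(-1) *\<^sub>C x = - x"
  using cscale_of_real[of "-1" x] by simp

lemma cscale_scaleR: "c *\<^sub>C r *\<^sub>R x = r *\<^sub>R c *\<^sub>C x"
  by (metis cscale_cscale cscale_of_real mult.commute)

lemma bounded_bilinear_cscale: "bounded_bilinear (\<lambda>c x. c *\<^sub>C x)"
proof
  fix r a and b :: "'b::complex_vec"
  show "(r *\<^sub>R a) *\<^sub>C b = r *\<^sub>R a *\<^sub>C b"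
    by (metis cscale_cscale cscale_of_real scaleR_conv_of_real)
qed (auto simp: cscale_add_right cscale_add_left norm_cscale cscale_scaleR intro!: exI[of _ 1])

lemmas has_derivative_cscale [derivative_intros] = bounded_bilinear.FDERIV[OF bounded_bilinear_cscale]
lemmas continuous_on_cscale [continuous_intros] = bounded_bilinear.continuous_on[OF bounded_bilinear_cscale]
lemmas tendsto_cscale [tendsto_intros] = bounded_bilinear.tendsto[OF bounded_bilinear_cscale]
lemmas bounded_linear_cscale_right = bounded_bilinear.bounded_linear_right[OF bounded_bilinear_cscale]
lemmas cscale_diff_right = bounded_bilinear.diff_right[OF bounded_bilinear_cscale]

text \<open>Complex homogeneity is the only condition added: additivity and boundedness come with a
  Frechet derivative. Working over the class makes pairs of a complex time and a point of C^n a
  legitimate domain, so that a flow is one holomorphic map in both variables.\<close>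

definition cholo :: "'a set \<Rightarrow> ('a::complex_vec \<Rightarrow> 'b::complex_vec) \<Rightarrow> bool" where
  "cholo U F \<longleftrightarrow> (\<forall>x\<in>U. \<exists>D. (F has_derivative D) (at x) \<and> (\<forall>c v. D (c *\<^sub>C v) = c *\<^sub>C D v))"

abbreviation FD :: "('a::complex_vec \<Rightarrow> 'b::complex_vec) \<Rightarrow> 'a \<Rightarrow> 'a \<Rightarrow> 'b" where
  "FD F x \<equiv> frechet_derivative F (at x)"

lemma choloI:
  assumes "\<And>x. x \<in> U \<Longrightarrow> (F has_derivative D x) (at x)"
    and "\<And>x c v. x \<in> U \<Longrightarrow> D x (c *\<^sub>C v) = c *\<^sub>C D x v"
  shows "cholo U F"
  unfolding cholo_def using assms by blast

lemma cholo_has_derivative: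
  assumes "cholo U F" "x \<in> U"
  shows "(F has_derivative FD F x) (at x)"
  using assms unfolding cholo_def by (metis frechet_derivative_at)

lemma FD_eq: "(F has_derivative D) (at x) \<Longrightarrow> FD F x = D"
  by (metis frechet_derivative_at)

lemma cholo_FD_cscale:
  assumes "cholo U F" "x \<in> U"
  shows "FD F x (c *\<^sub>C v) = c *\<^sub>C FD F x v"
  using assms unfolding cholo_def by (metis frechet_derivative_at)

lemma cholo_bounded_linear: "cholo U F \<Longrightarrow> x \<in> U \<Longrightarrow> bounded_linear (FD F x)"
  using cholo_has_derivative has_derivative_bounded_linear by blast

lemma holo_on_eq_cholo: "holo_on U F \<longleftrightarrow> cholo U F"
  by (simp add: holo_on_def cholo_def cscale_eq_vector_scalar_mult)

lemma cholo_subset: "cholo U F \<Longrightarrow> V \<subseteq> U \<Longrightarrow> cholo V F"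
  by (auto simp: cholo_def)

lemma cholo_continuous_on: "cholo U F \<Longrightarrow> continuous_on U F"
  using cholo_has_derivative
  by (metis continuous_at_imp_continuous_on has_derivative_continuous)

lemma cholo_cong:
  assumes "open U" "\<And>x. x \<in> U \<Longrightarrow> F x = G x" "cholo U F"
  shows "cholo U G"
proof (rule choloI[where D = "FD F"])
  fix x assume "x \<in> U"
  then show "(G has_derivative FD F x) (at x)"
    using assms cholo_has_derivative[of U F x] has_derivative_transform_within_open by blast
qed (use assms cholo_FD_cscale in blast)

lemma cholo_compose:
  assumes "cholo U F" "cholo V G" "\<And>x. x \<in> U \<Longrightarrow> F x \<in> V"
  shows "cholo U (\<lambda>x. G (F x))"
proof (rule choloI)
  fix x assume x: "x \<in> U"
  show "((\<lambda>x. G (F x)) has_derivative (\<lambda>v. FD G (F x) (FD F x v))) (at x)"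
    by (rule has_derivative_compose[OF cholo_has_derivative[OF assms(1) x]
          cholo_has_derivative[OF assms(2) assms(3)[OF x]]])
qed (simp add: assms(3) cholo_FD_cscale[OF assms(1)] cholo_FD_cscale[OF assms(2)])

lemma FD_compose:
  assumes "cholo U F" "cholo V G" "x \<in> U" "F x \<in> V"
  shows "FD (\<lambda>x. G (F x)) x v = FD G (F x) (FD F x v)"
proof -
  have "((\<lambda>x. G (F x)) has_derivative (\<lambda>v. FD G (F x) (FD F x v))) (at x)"
    using assms by (rule_tac has_derivative_compose[OF cholo_has_derivative cholo_has_derivative])
  then show ?thesis by (simp add: FD_eq)
qed

lemma cholo_linear:
  assumes "bounded_linear F" "\<And>c v. F (c *\<^sub>C v) = c *\<^sub>C F v"
  shows "cholo U F"
  by (rule choloI[where D = "\<lambda>_. F"]) (use assms bounded_linear_imp_has_derivative in auto)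

lemma cholo_const [simp]: "cholo U (\<lambda>_. c)"
  by (rule choloI[where D = "\<lambda>_ _. 0"]) auto

lemma cholo_ident [simp]: "cholo U (\<lambda>x. x)"
  by (rule cholo_linear) auto

lemma cholo_fst: "cholo U fst" and cholo_snd: "cholo U snd"
  by (auto intro!: cholo_linear bounded_linear_fst bounded_linear_snd simp: cscale_prod_def)

lemma cholo_nth: "cholo U (\<lambda>v. v $ i)"
  by (auto intro!: cholo_linear bounded_linear_vec_nth)

lemma cholo_Pair:
  assumes "cholo U F" "cholo U G"
  shows "cholo U (\<lambda>x. (F x, G x))"
  by (rule choloI[where D = "\<lambda>x v. (FD F x v, FD G x v)"])
    (auto intro!: has_derivative_Pair cholo_has_derivative[OF assms(1)] cholo_has_derivative[OF assms(2)]
      simp: cholo_FD_cscale[OF assms(1)] cholo_FD_cscale[OF assms(2)])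

lemma cholo_add:
  assumes "cholo U F" "cholo U G"
  shows "cholo U (\<lambda>x. F x + G x)"
  by (rule choloI[where D = "\<lambda>x v. FD F x v + FD G x v"])
    (auto intro!: has_derivative_add cholo_has_derivative[OF assms(1)] cholo_has_derivative[OF assms(2)]
      simp: cholo_FD_cscale[OF assms(1)] cholo_FD_cscale[OF assms(2)] cscale_add_right)

lemma cholo_diff:
  assumes "cholo U F" "cholo U G"
  shows "cholo U (\<lambda>x. F x - G x)"
  by (rule choloI[where D = "\<lambda>x v. FD F x v - FD G x v"])
    (auto intro!: has_derivative_diff cholo_has_derivative[OF assms(1)] cholo_has_derivative[OF assms(2)]
      simp: cholo_FD_cscale[OF assms(1)] cholo_FD_cscale[OF assms(2)] cscale_diff_right)

lemma cholo_cscale: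
  assumes "cholo U f" "cholo U G"
  shows "cholo U (\<lambda>x. f x *\<^sub>C G x)"
  by (rule choloI[where D = "\<lambda>x v. f x *\<^sub>C FD G x v + FD f x v *\<^sub>C G x"])
    (auto intro!: has_derivative_cscale cholo_has_derivative[OF assms(1)] cholo_has_derivative[OF assms(2)]
      simp: cholo_FD_cscale[OF assms(1)] cholo_FD_cscale[OF assms(2)] cscale_add_right cscale_cscale mult_ac)

lemma cholo_sum: "(\<And>i. i \<in> I \<Longrightarrow> cholo U (F i)) \<Longrightarrow> cholo U (\<lambda>x. \<Sum>i\<in>I. F i x)"
  by (induction I rule: infinite_finite_induct) (auto intro!: cholo_add)

lemma has_derivative_vecI:
  fixes F :: "'a::real_normed_vector \<Rightarrow> ('b::euclidean_space) ^ 'n"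
  assumes "\<And>i. ((\<lambda>x. F x $ i) has_derivative (\<lambda>v. D v $ i)) (at x within S)"
  shows "(F has_derivative D) (at x within S)"
proof (subst has_derivative_componentwise_within, intro ballI)
  fix e :: "'b ^ 'n" assume "e \<in> Basis"
  then obtain i b where "e = axis i b" by (auto simp: Basis_vec_def)
  then show "((\<lambda>x. F x \<bullet> e) has_derivative (\<lambda>v. D v \<bullet> e)) (at x within S)"
    using has_derivative_inner_left[OF assms, of i b] by (simp add: inner_axis)
qed

lemma cholo_vec_lambda:
  assumes "\<And>i. cholo U (F i)"
  shows "cholo U (\<lambda>x. \<chi> i. F i x)"
proof (rule choloI[where D = "\<lambda>x v. \<chi> i. FD (F i) x v"])
  fix x assume "x \<in> U"
  then show "((\<lambda>x. \<chi> i. F i x) has_derivative (\<lambda>v. \<chi> i. FD (F i) x v)) (at x)"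
    by (intro has_derivative_vecI) (simp add: cholo_has_derivative[OF assms])
qed (simp add: vec_eq_iff cholo_FD_cscale[OF assms])

lemma cholo_imp_holomorphic_on:
  assumes "cholo U f"
  shows "f holomorphic_on U"
  unfolding holomorphic_on_def
proof
  fix z assume z: "z \<in> U"
  have eq: "FD f z = (\<lambda>v. FD f z 1 * v)"
  proof
    fix v show "FD f z v = FD f z 1 * v"
      using cholo_FD_cscale[OF assms z, of v 1]
      by (simp only: cscale_complex_def mult_1_right mult.commute[of v "FD f z 1"])
  qed
  have "(f has_field_derivative FD f z 1) (at z)"
    unfolding has_field_derivative_def
    by (rule has_derivative_eq_rhs[OF cholo_has_derivative[OF assms z] eq])
  then show "f field_differentiable at z within U"
    using field_differentiable_at_within field_differentiable_def by blast
qed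

text \<open>A complex functional whose real part is the \<open>b\<close>-coordinate; it reduces vector-valued
  statements to scalar ones.\<close>

definition cfunc :: "'a::complex_vec \<Rightarrow> 'a \<Rightarrow> complex" where
  "cfunc b x = Complex (x \<bullet> b) (- ((\<i> *\<^sub>C x) \<bullet> b))"

lemma bounded_linear_cfunc: "bounded_linear (cfunc b)"
proof -
  have 1: "bounded_linear (\<lambda>x. x \<bullet> b)" "bounded_linear (\<lambda>x. - ((\<i> *\<^sub>C x) \<bullet> b))"
    by (rule bounded_linear_inner_left)
      (rule bounded_linear_minus[OF bounded_linear_compose[OF bounded_linear_inner_left bounded_linear_cscale_right]])
  have "cfunc b = (\<lambda>x. of_real (x \<bullet> b) + \<i> * of_real (- ((\<i> *\<^sub>C x) \<bullet> b)))"
    by (auto simp: cfunc_def complex_eq_iff)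
  then show ?thesis
    using bounded_linear_add[OF bounded_linear_compose[OF bounded_linear_of_real 1(1)]
      bounded_linear_compose[OF bounded_linear_mult_right[of \<i>] bounded_linear_compose[OF bounded_linear_of_real 1(2)]]]
    by (rule ssubst[where P = bounded_linear])
qed

lemma cfunc_cscale: "cfunc b (c *\<^sub>C x) = c * cfunc b x"
proof -
  have 1: "c *\<^sub>C x = Re c *\<^sub>R x + Im c *\<^sub>R (\<i> *\<^sub>C x)" for x :: 'a and c
    by (subst complex_eq[of c]) (simp add: cscale_add_left cscale_of_real flip: cscale_scaleR,
        metis cscale_cscale cscale_of_real mult.commute)
  have 2: "\<i> *\<^sub>C \<i> *\<^sub>C x = - x" for x :: 'a
    by (simp add: cscale_cscale cscale_minus_one)
  have "\<i> *\<^sub>C c *\<^sub>C x = Re c *\<^sub>R (\<i> *\<^sub>C x) - Im c *\<^sub>R x"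
    by (subst 1[of c]) (simp add: cscale_add_right cscale_scaleR 2)
  then have i: "(\<i> *\<^sub>C c *\<^sub>C x) \<bullet> b = Re c * ((\<i> *\<^sub>C x) \<bullet> b) - Im c * (x \<bullet> b)"
    by (simp add: inner_diff_left)
  have r: "(c *\<^sub>C x) \<bullet> b = Re c * (x \<bullet> b) + Im c * ((\<i> *\<^sub>C x) \<bullet> b)"
    by (subst 1[of c]) (simp add: inner_add_left)
  show ?thesis
    unfolding cfunc_def i r by (rule complex_eqI) (simp_all)
qed

lemma cfunc_eqI:
  assumes "\<And>b. b \<in> Basis \<Longrightarrow> cfunc b x = cfunc b y"
  shows "x = y"
proof (rule euclidean_eqI)
  fix b :: 'a assume "b \<in> Basis"
  then have "Re (cfunc b x) = Re (cfunc b y)" by (simp only: assms)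
  then show "x \<bullet> b = y \<bullet> b" by (simp add: cfunc_def)
qed

lemma cholo_cfunc: "cholo U F \<Longrightarrow> cholo U (\<lambda>x. cfunc b (F x))"
  by (rule cholo_compose[OF _ cholo_linear[where U = UNIV, OF bounded_linear_cfunc _]])
    (auto simp: cfunc_cscale)

section \<open>Cauchy's formula for the derivative and the regularity it yields\<close>

abbreviation unit_circ :: "real \<Rightarrow> complex" where
  "unit_circ \<theta> \<equiv> cis (2 * pi * \<theta>)"

text \<open>On the circle, the kernel 1/u^2 and du = 2 pi i u d\<theta> combine to 1/u, which is the
  conjugate of u. The formula has no singular kernel left and carries over to vector values.\<close>

lemma cauchy_scalar:
  assumes "open U" "f holomorphic_on U" "cball 0 1 \<subseteq> U"
  shows "deriv f 0 = integral {0..1} (\<lambda>\<theta>. cnj (unit_circ \<theta>) * f (unit_circ \<theta>))"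
proof -
  have c: "continuous_on (cball 0 1) f" "f holomorphic_on ball 0 1"
    using assms by (meson ball_subset_cball holomorphic_on_imp_continuous_on holomorphic_on_subset order_trans)+
  have "(f has_field_derivative (1 / (2 * of_real pi * \<i>) *
      contour_integral (circlepath 0 1) (\<lambda>u. f u / (u-0)^2))) (at 0)"
    by (rule Cauchy_derivative_integral_circlepath(2)[OF c]) auto
  then have "deriv f 0 = 1 / (2 * of_real pi * \<i>) *
      contour_integral (circlepath 0 1) (\<lambda>u. f u / u^2)"
    by (simp add: DERIV_imp_deriv)
  also have "\<dots> = 1 / (2 * of_real pi * \<i>) * integral {0..1} (\<lambda>\<theta>.
      f (unit_circ \<theta>) / (unit_circ \<theta>)^2 * (2 * of_real pi * \<i> * unit_circ \<theta>))"
    by (simp only: contour_integral_integral vector_derivative_circlepath)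
      (simp add: circlepath cis_conv_exp mult_ac)
  also have "\<dots> = integral {0..1} (\<lambda>\<theta>. 1 / (2 * of_real pi * \<i>) *
      (f (unit_circ \<theta>) / (unit_circ \<theta>)^2 * (2 * of_real pi * \<i> * unit_circ \<theta>)))"
    by (simp only: integral_mult_right)
  also have "\<dots> = integral {0..1} (\<lambda>\<theta>. cnj (unit_circ \<theta>) * f (unit_circ \<theta>))"
    by (rule integral_cong) (simp add: power2_eq_square field_simps cis_cnj flip: cis_inverse)
  finally show ?thesis .
qed

lemma continuous_on_unit_circ [continuous_intros]:
  "continuous_on A g \<Longrightarrow> continuous_on A (\<lambda>x. unit_circ (g x))"
  by (auto simp: cis_conv_exp intro!: continuous_intros)

text \<open>On the complex line through x in direction v this is the one-variable formula, applied
  to each functional \<open>cfunc b\<close>. It expresses the derivative through values of F alone,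
  which is how continuity, holomorphy and limits of derivatives are obtained although
  \<open>cholo\<close> asks only for pointwise differentiability.\<close>

lemma FD_eq_integral:
  assumes U: "open U" and F: "cholo U F" and v: "\<And>c. norm c \<le> 1 \<Longrightarrow> x + c *\<^sub>C v \<in> U"
  shows "FD F x v = integral {0..1} (\<lambda>\<theta>. cnj (unit_circ \<theta>) *\<^sub>C F (x + unit_circ \<theta> *\<^sub>C v))"
    and "(\<lambda>\<theta>. cnj (unit_circ \<theta>) *\<^sub>C F (x + unit_circ \<theta> *\<^sub>C v)) integrable_on {0..1}"
proof -
  let ?l = "\<lambda>c. x + c *\<^sub>C v"
  have l: "cholo V ?l" for V
    by (intro cholo_add cholo_cscale cholo_const cholo_ident)
  have contl: "continuous_on UNIV ?l"
    by (rule cholo_continuous_on[OF l])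
  define V where "V = ?l -` U"
  have V: "open V" "cball 0 1 \<subseteq> V"
    using U v contl by (auto simp: V_def intro!: open_vimage)
  have "continuous_on {0..1} (\<lambda>\<theta>. F (x + unit_circ \<theta> *\<^sub>C v))"
    by (rule continuous_on_compose2[OF cholo_continuous_on[OF F]]) (auto intro!: continuous_intros v)
  then have "continuous_on {0..1} (\<lambda>\<theta>. cnj (unit_circ \<theta>) *\<^sub>C F (x + unit_circ \<theta> *\<^sub>C v))"
    by (auto intro!: continuous_intros)
  then show int: "(\<lambda>\<theta>. cnj (unit_circ \<theta>) *\<^sub>C F (x + unit_circ \<theta> *\<^sub>C v)) integrable_on {0..1}"
    by (rule integrable_continuous_interval)
  show "FD F x v = integral {0..1} (\<lambda>\<theta>. cnj (unit_circ \<theta>) *\<^sub>C F (x + unit_circ \<theta> *\<^sub>C v))"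
  proof (rule cfunc_eqI)
    fix b :: 'b assume "b \<in> Basis"
    let ?f = "\<lambda>c. cfunc b (F (?l c))"
    have xU: "x \<in> U" using v[of 0] by simp
    have "(?l has_derivative (\<lambda>h. h *\<^sub>C v)) (at 0)"
      by (rule has_derivative_eq_rhs[OF has_derivative_add[OF has_derivative_const
            has_derivative_cscale[OF has_derivative_ident has_derivative_const]]]) auto
    then have "((\<lambda>c. F (?l c)) has_derivative (\<lambda>h. FD F x (h *\<^sub>C v))) (at 0)"
      by (rule has_derivative_compose) (simp add: cholo_has_derivative[OF F xU])
    then have "(?f has_derivative (\<lambda>h. cfunc b (FD F x (h *\<^sub>C v)))) (at 0)"
      by (rule bounded_linear.has_derivative[OF bounded_linear_cfunc])
    then have "(?f has_field_derivative cfunc b (FD F x v)) (at 0)"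
      by (simp add: has_field_derivative_def cholo_FD_cscale[OF F xU] cfunc_cscale mult_commute_abs)
    then have "cfunc b (FD F x v) = deriv ?f 0"
      by (simp add: DERIV_imp_deriv)
    also have "\<dots> = integral {0..1} (\<lambda>\<theta>. cnj (unit_circ \<theta>) * ?f (unit_circ \<theta>))"
    proof (rule cauchy_scalar[OF V(1) _ V(2)])
      show "?f holomorphic_on V"
        by (intro cholo_imp_holomorphic_on cholo_cfunc cholo_compose[OF l F]) (auto simp: V_def)
    qed
    also have "\<dots> = integral {0..1} (\<lambda>\<theta>. cfunc b (cnj (unit_circ \<theta>) *\<^sub>C F (x + unit_circ \<theta> *\<^sub>C v)))"
      by (simp add: cfunc_cscale)
    also have "\<dots> = cfunc b (integral {0..1} (\<lambda>\<theta>. cnj (unit_circ \<theta>) *\<^sub>C F (x + unit_circ \<theta> *\<^sub>C v)))"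
      using integral_linear[OF int bounded_linear_cfunc[of b]] by (simp add: o_def)
    finally show "cfunc b (FD F x v) = cfunc b (integral {0..1} (\<lambda>\<theta>. cnj (unit_circ \<theta>) *\<^sub>C F (x + unit_circ \<theta> *\<^sub>C v)))" .
  qed
qed

lemma continuous_on_locally:
  assumes "\<And>x. x \<in> S \<Longrightarrow> \<exists>A. open A \<and> x \<in> A \<and> continuous_on (S \<inter> A) f"
  shows "continuous_on S f"
  unfolding continuous_on_def
proof
  fix x assume x: "x \<in> S"
  then obtain A where A: "open A" "x \<in> A" "continuous_on (S \<inter> A) f" using assms by blast
  have "at x within S = at x within (S \<inter> A)"
    by (rule at_within_nhd[OF A(2,1)]) auto
  then show "(f \<longlongrightarrow> f x) (at x within S)"
    using A x by (auto simp: continuous_on_def)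
qed

lemma FD_scaleR:
  assumes "cholo U F" "x \<in> U"
  shows "FD F x (r *\<^sub>R v) = r *\<^sub>R FD F x v"
  using cholo_FD_cscale[OF assms, of "of_real r" v] by (simp add: cscale_of_real)

lemma circle_in_set:
  assumes r: "cball x0 (2 * r) \<subseteq> U" and x: "x \<in> ball x0 r" and w: "norm w \<le> r" "norm c \<le> 1"
  shows "x + c *\<^sub>C w \<in> U"
proof -
  have "norm (c *\<^sub>C w) \<le> 1 * norm w"
    unfolding norm_cscale by (rule mult_right_mono[OF w(2) norm_ge_zero])
  then have "dist x0 (x + c *\<^sub>C w) \<le> 2 * r"
    using x w norm_triangle_ineq4[of "x0 - x" "c *\<^sub>C w"]
    by (auto simp: dist_norm algebra_simps)
  then show ?thesis using r by auto
qed

text \<open>A vector of length at most r keeps the circle around any point of the ball of radius r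
  inside the ball of radius 2r. Hence a single scale s serves all x near x0, and the integral
  depends on x only through the integrand.\<close>

lemma FD_eq_scaled_integral:
  assumes U: "open U" and F: "cholo U F" and r: "cball x0 (2 * r) \<subseteq> U"
    and x: "x \<in> ball x0 r" and s: "s > 0" "s * norm v \<le> r"
  shows "FD F x v = (1 / s) *\<^sub>R integral {0..1} (\<lambda>\<theta>. cnj (unit_circ \<theta>) *\<^sub>C F (x + unit_circ \<theta> *\<^sub>C (s *\<^sub>R v)))"
proof -
  have in_U: "x + c *\<^sub>C (s *\<^sub>R v) \<in> U" if "norm c \<le> 1" for c
    by (rule circle_in_set[OF r x _ that]) (use s in auto)
  have "x \<in> U" using in_U[of 0] by simp
  then have "FD F x v = (1 / s) *\<^sub>R FD F x (s *\<^sub>R v)"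
    using s by (simp add: FD_scaleR[OF F])
  then show ?thesis
    using FD_eq_integral(1)[OF U F in_U] by simp
qed

lemma obtain_double_cball:
  fixes x :: "'a::euclidean_space"
  assumes "open U" "x \<in> U"
  obtains r where "r > 0" "cball x (2 * r) \<subseteq> U"
proof -
  obtain e where "e > 0" "cball x e \<subseteq> U" using assms open_contains_cball by blast
  then show ?thesis using that[of "e / 2"] by auto
qed

lemma obtain_small_scale:
  fixes v :: "'a::real_normed_vector" and r :: real
  assumes "r > 0"
  obtains s where "s > 0" "s * norm v \<le> r"
proof
  show "r / (norm v + 1) > 0" using assms by (simp add: add_nonneg_pos)
  have "norm v * r \<le> r * (norm v + 1)" using assms by (simp add: algebra_simps)
  moreover have "norm v + 1 > 0" by (simp add: add_nonneg_pos)
  ultimately show "r / (norm v + 1) * norm v \<le> r"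
    by (simp add: pos_divide_le_eq mult.commute)
qed

text \<open>Locally in x the derivative is an integral of values of f over a fixed interval with a
  fixed scale, so joint continuity passes from f to it.\<close>

lemma continuous_on_FD_param:
  fixes f :: "'a::complex_vec \<Rightarrow> 'c::topological_space \<Rightarrow> 'b::complex_vec"
  assumes U: "open U" and f: "\<And>t. t \<in> T \<Longrightarrow> cholo U (\<lambda>x. f x t)"
    and cont: "continuous_on (U \<times> T) (\<lambda>(x, t). f x t)"
  shows "continuous_on (U \<times> T) (\<lambda>(x, t). FD (\<lambda>x. f x t) x v)"
proof (rule continuous_on_locally)
  fix p assume "p \<in> U \<times> T"
  then obtain x0 t0 where p: "p = (x0, t0)" "x0 \<in> U" "t0 \<in> T" by auto
  obtain r where r: "r > 0" "cball x0 (2 * r) \<subseteq> U" using obtain_double_cball[OF U p(2)] .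
  obtain s where s: "s > 0" "s * norm v \<le> r" using obtain_small_scale[OF r(1)] .
  let ?A = "ball x0 r \<times> (UNIV :: 'c set)"
  have cont': "continuous_on (((U \<times> T) \<inter> ?A) \<times> cbox 0 1)
      (\<lambda>(q, \<theta>). cnj (unit_circ \<theta>) *\<^sub>C f (fst q + unit_circ \<theta> *\<^sub>C (s *\<^sub>R v)) (snd q))"
  proof -
    have "continuous_on (((U \<times> T) \<inter> ?A) \<times> cbox 0 1)
        (\<lambda>z. (\<lambda>(x, t). f x t) (fst (fst z) + unit_circ (snd z) *\<^sub>C (s *\<^sub>R v), snd (fst z)))"
    proof (rule continuous_on_compose2[OF cont])
      show "continuous_on (((U \<times> T) \<inter> ?A) \<times> cbox 0 1)
          (\<lambda>z. (fst (fst z) + unit_circ (snd z) *\<^sub>C (s *\<^sub>R v), snd (fst z)))"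
        by (intro continuous_intros)
    qed (use s in \<open>auto intro!: circle_in_set[OF r(2)]\<close>)
    then show ?thesis
      by (auto simp: case_prod_beta intro!: continuous_intros)
  qed
  have "continuous_on ((U \<times> T) \<inter> ?A) (\<lambda>q. (1 / s) *\<^sub>R integral (cbox 0 1)
      (\<lambda>\<theta>. cnj (unit_circ \<theta>) *\<^sub>C f (fst q + unit_circ \<theta> *\<^sub>C (s *\<^sub>R v)) (snd q)))"
    by (intro continuous_on_scaleR continuous_on_const integral_continuous_on_param cont')
  moreover have "(1 / s) *\<^sub>R integral (cbox 0 1)
      (\<lambda>\<theta>. cnj (unit_circ \<theta>) *\<^sub>C f (fst q + unit_circ \<theta> *\<^sub>C (s *\<^sub>R v)) (snd q))
      = (\<lambda>(x, t). FD (\<lambda>x. f x t) x v) q" if "q \<in> (U \<times> T) \<inter> ?A" for q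
    using that FD_eq_scaled_integral[OF U f r(2) _ s, of "snd q" "fst q"] by (auto simp: case_prod_beta)
  ultimately have "continuous_on ((U \<times> T) \<inter> ?A) (\<lambda>(x, t). FD (\<lambda>x. f x t) x v)"
    using continuous_on_cong by (smt (verit))
  then show "\<exists>A. open A \<and> p \<in> A \<and> continuous_on ((U \<times> T) \<inter> A) (\<lambda>(x, t). FD (\<lambda>x. f x t) x v)"
    using p r by (intro exI[of _ ?A]) (auto intro!: open_Times)
qed

lemma continuous_on_Blinfun_FD_param:
  fixes f :: "'a::complex_vec \<Rightarrow> 'c::t2_space \<Rightarrow> 'b::complex_vec"
  assumes U: "open U" and f: "\<And>t. t \<in> T \<Longrightarrow> cholo U (\<lambda>x. f x t)"
    and cont: "continuous_on (U \<times> T) (\<lambda>(x, t). f x t)"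
  shows "continuous_on (U \<times> T) (\<lambda>(x, t). Blinfun (FD (\<lambda>x. f x t) x))"
proof (rule continuous_on_blinfun_componentwise)
  fix b :: 'a
  show "continuous_on (U \<times> T) (\<lambda>p. blinfun_apply (case p of (x, t) \<Rightarrow> Blinfun (FD (\<lambda>x. f x t) x)) b)"
    by (rule continuous_on_cong[THEN iffD1, OF refl _ continuous_on_FD_param[OF assms, of b]])
      (auto simp: bounded_linear_Blinfun_apply cholo_bounded_linear[OF f])
qed

lemma continuous_on_Blinfun_FD:
  assumes "open U" "cholo U F"
  shows "continuous_on U (\<lambda>x. Blinfun (FD F x))"
proof -
  \<comment> \<open>A one-point parameter set reduces the claim to the version with
    parameters.\<close>
  have c: "continuous_on (U \<times> {0::real}) (\<lambda>(x, t). F x)"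
    by (auto simp: case_prod_beta intro!: continuous_on_compose2[OF cholo_continuous_on[OF assms(2)]] continuous_intros)
  have "continuous_on U (\<lambda>x. (\<lambda>(x, t::real). Blinfun (FD F x)) (x, 0))"
    by (rule continuous_on_compose2[OF continuous_on_Blinfun_FD_param[OF assms(1) _ c]])
      (auto intro!: continuous_intros assms)
  then show ?thesis by simp
qed

text \<open>The Leibniz rule wants a jointly continuous derivative in x; Cauchy's formula supplies
  it from the joint continuity of f. Complex homogeneity of the derivative survives because
  integration commutes with \<open>cscale\<close>.\<close>

lemma cholo_integral:
  fixes f :: "'a::complex_vec \<Rightarrow> real \<Rightarrow> 'b::complex_vec"
  assumes U: "open U" and f: "\<And>t. t \<in> {0..1} \<Longrightarrow> cholo U (\<lambda>x. f x t)"
    and cont: "continuous_on (U \<times> {0..1}) (\<lambda>(x, t). f x t)"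
  shows "\<And>x. x \<in> U \<Longrightarrow> ((\<lambda>x. integral {0..1} (f x)) has_derivative
      (\<lambda>v. integral {0..1} (\<lambda>t. FD (\<lambda>x. f x t) x v))) (at x)"
    and "cholo U (\<lambda>x. integral {0..1} (f x))"
proof -
  let ?D = "\<lambda>x t. Blinfun (FD (\<lambda>x. f x t) x)"
  note contD = continuous_on_Blinfun_FD_param[OF U f cont]
  have D: "blinfun_apply (?D x t) = FD (\<lambda>x. f x t) x" if "x \<in> U" "t \<in> {0..1}" for x t
    using that by (simp add: bounded_linear_Blinfun_apply cholo_bounded_linear[OF f])
  have contDx: "continuous_on {0..1} (?D x)" if "x \<in> U" for x
  proof -
    have "continuous_on {0..1} (\<lambda>t. (\<lambda>(x, t). ?D x t) (x, t))"
      by (rule continuous_on_compose2[OF contD]) (use that in \<open>auto intro!: continuous_intros\<close>)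
    then show ?thesis by simp
  qed
  have intD: "(?D x) integrable_on {0..1}" if "x \<in> U" for x
    using contDx[OF that] by (rule integrable_continuous_interval)
  have eq: "blinfun_apply (integral {0..1} (?D x)) v = integral {0..1} (\<lambda>t. FD (\<lambda>x. f x t) x v)"
    if "x \<in> U" for x v
    unfolding blinfun_apply_integral[OF intD[OF that]]
    by (rule integral_cong) (simp only: D[OF that])
  show der: "((\<lambda>x. integral {0..1} (f x)) has_derivative
      (\<lambda>v. integral {0..1} (\<lambda>t. FD (\<lambda>x. f x t) x v))) (at x)" if x: "x \<in> U" for x
  proof -
    obtain r where r: "r > 0" "ball x r \<subseteq> U" using U x open_contains_ball by blast
    have "((\<lambda>x. integral (cbox 0 1) (f x)) has_derivative blinfun_apply (integral (cbox 0 1) (?D x)))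
        (at x within ball x r)"
    proof (rule leibniz_rule)
      fix y t assume y: "y \<in> ball x r" "t \<in> cbox 0 (1::real)"
      then have y': "y \<in> U" using r by auto
      have "((\<lambda>x. f x t) has_derivative FD (\<lambda>x. f x t) y) (at y within ball x r)"
        by (rule has_derivative_at_withinI[OF cholo_has_derivative[OF f y']]) (use y in auto)
      then show "((\<lambda>x. f x t) has_derivative blinfun_apply (?D y t)) (at y within ball x r)"
        using D[OF y'] y by simp
    next
      fix y assume y: "y \<in> ball x r"
      have "continuous_on {0..1} (\<lambda>t. (\<lambda>(x, t). f x t) (y, t))"
        by (rule continuous_on_compose2[OF cont]) (use y r in \<open>auto intro!: continuous_intros\<close>)
      then show "f y integrable_on cbox 0 1"
        by (simp add: integrable_continuous_interval)
    next
      show "continuous_on (ball x r \<times> cbox 0 1) (\<lambda>(x, t). ?D x t)"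
        by (rule continuous_on_subset[OF contD]) (use r in auto)
    qed (use r in auto)
    then have "((\<lambda>x. integral {0..1} (f x)) has_derivative blinfun_apply (integral {0..1} (?D x))) (at x)"
      using r by (simp add: at_within_open[OF _ open_ball])
    then show ?thesis
      by (rule has_derivative_eq_rhs) (simp add: eq[OF x] fun_eq_iff)
  qed
  show "cholo U (\<lambda>x. integral {0..1} (f x))"
  proof (rule choloI[OF der])
    fix x c v assume x: "x \<in> U"
    have int: "(\<lambda>t. FD (\<lambda>x. f x t) x v) integrable_on {0..1}"
    proof -
      have "continuous_on {0..1} (\<lambda>t. blinfun_apply (?D x t) v)"
        by (intro continuous_intros contDx x)
      then show ?thesis
        by (intro integrable_continuous_interval)
          (erule continuous_on_eq, simp only: D[OF x])
    qed
    have "integral {0..1} (\<lambda>t. FD (\<lambda>x. f x t) x (c *\<^sub>C v)) = integral {0..1} (\<lambda>t. c *\<^sub>C FD (\<lambda>x. f x t) x v)"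
      by (rule integral_cong) (simp add: cholo_FD_cscale[OF f x])
    also have "\<dots> = c *\<^sub>C integral {0..1} (\<lambda>t. FD (\<lambda>x. f x t) x v)"
      using integral_linear[OF int bounded_linear_cscale_right[of c]] by (simp add: o_def)
    finally show "integral {0..1} (\<lambda>t. FD (\<lambda>x. f x t) x (c *\<^sub>C v)) =
        c *\<^sub>C integral {0..1} (\<lambda>t. FD (\<lambda>x. f x t) x v)" .
  qed
qed

lemma FD_local_formula:
  assumes U: "open U" and F: "cholo U F" and x: "x \<in> U"
  obtains r s where "r > 0" "s > 0" "cball x (2 * r) \<subseteq> U" "s * norm v \<le> r"
    "\<And>y. y \<in> ball x r \<Longrightarrow> FD F y v = (1 / s) *\<^sub>R integral {0..1} (\<lambda>\<theta>. cnj (unit_circ \<theta>) *\<^sub>C F (y + unit_circ \<theta> *\<^sub>C (s *\<^sub>R v)))"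
    "\<And>\<theta>. cholo (ball x r) (\<lambda>y. cnj (unit_circ \<theta>) *\<^sub>C F (y + unit_circ \<theta> *\<^sub>C (s *\<^sub>R v)))"
    "continuous_on (ball x r \<times> {0..1}) (\<lambda>(y, \<theta>). cnj (unit_circ \<theta>) *\<^sub>C F (y + unit_circ \<theta> *\<^sub>C (s *\<^sub>R v)))"
proof -
  obtain r where r: "r > 0" "cball x (2 * r) \<subseteq> U" using obtain_double_cball[OF U x] .
  obtain s where s: "s > 0" "s * norm v \<le> r" using obtain_small_scale[OF r(1)] .
  show ?thesis
  proof (rule that[OF r(1) s(1) r(2) s(2)])
    show "FD F y v = (1 / s) *\<^sub>R integral {0..1} (\<lambda>\<theta>. cnj (unit_circ \<theta>) *\<^sub>C F (y + unit_circ \<theta> *\<^sub>C (s *\<^sub>R v)))"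
      if "y \<in> ball x r" for y
      by (rule FD_eq_scaled_integral[OF U F r(2) that s])
    show "cholo (ball x r) (\<lambda>y. cnj (unit_circ \<theta>) *\<^sub>C F (y + unit_circ \<theta> *\<^sub>C (s *\<^sub>R v)))" for \<theta>
    proof (rule cholo_cscale[OF cholo_const cholo_compose[OF cholo_add[OF cholo_ident cholo_const] F]])
      show "y + unit_circ \<theta> *\<^sub>C s *\<^sub>R v \<in> U" if "y \<in> ball x r" for y
        by (rule circle_in_set[OF r(2) that]) (use s in auto)
    qed
    have "continuous_on (ball x r \<times> {0..1}) (\<lambda>p. F (fst p + unit_circ (snd p) *\<^sub>C (s *\<^sub>R v)))"
      by (rule continuous_on_compose2[OF cholo_continuous_on[OF F]])
        (use s in \<open>auto intro!: continuous_intros circle_in_set[OF r(2)]\<close>)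
    then show "continuous_on (ball x r \<times> {0..1}) (\<lambda>(y, \<theta>). cnj (unit_circ \<theta>) *\<^sub>C F (y + unit_circ \<theta> *\<^sub>C (s *\<^sub>R v)))"
      by (auto simp: case_prod_beta intro!: continuous_intros)
  qed
qed

lemma cholo_ballI:
  assumes "\<And>x. x \<in> U \<Longrightarrow> \<exists>r>0. cholo (ball x r) F"
  shows "cholo U F"
  unfolding cholo_def
proof
  fix x assume "x \<in> U"
  then obtain r where "r > 0" "cholo (ball x r) F" using assms by blast
  then show "\<exists>D. (F has_derivative D) (at x) \<and> (\<forall>c v. D (c *\<^sub>C v) = c *\<^sub>C D v)"
    by (auto simp: cholo_def)
qed

text \<open>Near each point the directional derivative is an integral of translates of F, and these
  are holomorphic in the base point.\<close>

lemma cholo_FD: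
  assumes U: "open U" and F: "cholo U F"
  shows "cholo U (\<lambda>x. FD F x v)"
proof (rule cholo_ballI)
  fix x assume "x \<in> U"
  show "\<exists>r>0. cholo (ball x r) (\<lambda>x. FD F x v)"
  proof (rule FD_local_formula[OF U F \<open>x \<in> U\<close>, where v = v])
    fix r s :: real assume rs: "r > 0" "s > 0" and r: "cball x (2 * r) \<subseteq> U" and s: "s * norm v \<le> r"
      and rs': "\<And>y. y \<in> ball x r \<Longrightarrow> FD F y v = (1 / s) *\<^sub>R integral {0..1} (\<lambda>\<theta>. cnj (unit_circ \<theta>) *\<^sub>C F (y + unit_circ \<theta> *\<^sub>C (s *\<^sub>R v)))"
      "\<And>\<theta>. cholo (ball x r) (\<lambda>y. cnj (unit_circ \<theta>) *\<^sub>C F (y + unit_circ \<theta> *\<^sub>C (s *\<^sub>R v)))"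
      "continuous_on (ball x r \<times> {0..1}) (\<lambda>(y, \<theta>). cnj (unit_circ \<theta>) *\<^sub>C F (y + unit_circ \<theta> *\<^sub>C (s *\<^sub>R v)))"
    note rs = rs rs'
    note int = cholo_integral(2)[OF open_ball rs(4,5)]
    have "cholo (ball x r) (\<lambda>y. complex_of_real (1 / s) *\<^sub>C integral {0..1} (\<lambda>\<theta>. cnj (unit_circ \<theta>) *\<^sub>C F (y + unit_circ \<theta> *\<^sub>C (s *\<^sub>R v))))"
      by (rule cholo_cscale[OF cholo_const int])
    then have "cholo (ball x r) (\<lambda>x. FD F x v)"
      by (rule cholo_cong[OF open_ball, rotated]) (simp only: rs(3) cscale_of_real)
    then show "\<exists>r>0. cholo (ball x r) (\<lambda>x. FD F x v)" using rs by blast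
  qed
qed

text \<open>Differentiating the Cauchy integral for direction v in direction w moves the derivative
  onto F under the integral, and the result is the Cauchy integral of \<open>FD F y w\<close> for
  direction v.\<close>

lemma FD_symmetric:
  assumes U: "open U" and F: "cholo U F" and x: "x \<in> U"
  shows "FD (\<lambda>y. FD F y v) x w = FD (\<lambda>y. FD F y w) x v"
proof -
  show ?thesis
  proof (rule FD_local_formula[OF U F x, where v = v])
    fix r s :: real assume rs: "r > 0" "s > 0" and r: "cball x (2 * r) \<subseteq> U" and s: "s * norm v \<le> r"
      and rs': "\<And>y. y \<in> ball x r \<Longrightarrow> FD F y v = (1 / s) *\<^sub>R integral {0..1} (\<lambda>\<theta>. cnj (unit_circ \<theta>) *\<^sub>C F (y + unit_circ \<theta> *\<^sub>C (s *\<^sub>R v)))"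
      "\<And>\<theta>. cholo (ball x r) (\<lambda>y. cnj (unit_circ \<theta>) *\<^sub>C F (y + unit_circ \<theta> *\<^sub>C (s *\<^sub>R v)))"
      "continuous_on (ball x r \<times> {0..1}) (\<lambda>(y, \<theta>). cnj (unit_circ \<theta>) *\<^sub>C F (y + unit_circ \<theta> *\<^sub>C (s *\<^sub>R v)))"
    note rs = rs rs'
    have xr: "x \<in> ball x r" using rs by simp
    let ?f = "\<lambda>y \<theta>. cnj (unit_circ \<theta>) *\<^sub>C F (y + unit_circ \<theta> *\<^sub>C (s *\<^sub>R v))"
    have fd: "FD (\<lambda>y. ?f y \<theta>) x w = cnj (unit_circ \<theta>) *\<^sub>C FD F (x + unit_circ \<theta> *\<^sub>C (s *\<^sub>R v)) w" for \<theta>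
    proof -
      have "x + unit_circ \<theta> *\<^sub>C (s *\<^sub>R v) \<in> U"
        by (rule circle_in_set[OF r xr]) (use rs s in auto)
      then have "(F has_derivative FD F (x + unit_circ \<theta> *\<^sub>C (s *\<^sub>R v))) (at (x + unit_circ \<theta> *\<^sub>C (s *\<^sub>R v)))"
        by (rule cholo_has_derivative[OF F])
      then have "((\<lambda>y. F (y + unit_circ \<theta> *\<^sub>C (s *\<^sub>R v))) has_derivative FD F (x + unit_circ \<theta> *\<^sub>C (s *\<^sub>R v))) (at x)"
        by (rule has_derivative_compose[rotated])
          (rule has_derivative_eq_rhs[OF has_derivative_add[OF has_derivative_ident has_derivative_const]], simp)
      from bounded_linear.has_derivative[OF bounded_linear_cscale_right[of "cnj (unit_circ \<theta>)"] this]
      show ?thesis by (simp add: FD_eq)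
    qed
    have G: "cholo U (\<lambda>y. FD F y w)" by (rule cholo_FD[OF U F])
    have "((\<lambda>y. integral {0..1} (?f y)) has_derivative (\<lambda>w. integral {0..1} (\<lambda>\<theta>. FD (\<lambda>y. ?f y \<theta>) x w))) (at x)"
      by (rule cholo_integral(1)[OF open_ball rs(4,5) xr])
    then have "((\<lambda>y. (1 / s) *\<^sub>R integral {0..1} (?f y)) has_derivative
        (\<lambda>w. (1 / s) *\<^sub>R integral {0..1} (\<lambda>\<theta>. FD (\<lambda>y. ?f y \<theta>) x w))) (at x)"
      by (rule has_derivative_scaleR_right)
    then have "((\<lambda>y. FD F y v) has_derivative
        (\<lambda>w. (1 / s) *\<^sub>R integral {0..1} (\<lambda>\<theta>. FD (\<lambda>y. ?f y \<theta>) x w))) (at x)"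
      by (rule has_derivative_transform_within_open[OF _ open_ball xr]) (simp only: rs(3))
    then have "FD (\<lambda>y. FD F y v) x w = (1 / s) *\<^sub>R integral {0..1} (\<lambda>\<theta>. FD (\<lambda>y. ?f y \<theta>) x w)"
      by (simp add: FD_eq)
    also have "\<dots> = (1 / s) *\<^sub>R integral {0..1} (\<lambda>\<theta>. cnj (unit_circ \<theta>) *\<^sub>C FD F (x + unit_circ \<theta> *\<^sub>C (s *\<^sub>R v)) w)"
      by (simp only: fd)
    also have "\<dots> = FD (\<lambda>y. FD F y w) x v"
      by (rule FD_eq_scaled_integral[OF U G r xr rs(2) s, symmetric])
    finally show ?thesis .
  qed
qed

text \<open>Weierstrass' theorem: by Cauchy's formula uniform closeness of the maps forces uniform
  closeness of their derivatives on a smaller ball, which is what the theorem on sequences of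
  derivatives asks for.\<close>

lemma cholo_uniform_limit:
  fixes f :: "nat \<Rightarrow> 'a::complex_vec \<Rightarrow> 'b::complex_vec"
  assumes U: "open U" and f: "\<And>n. cholo U (f n)" and lim: "uniform_limit U f F sequentially"
  shows "cholo U F"
proof (rule cholo_ballI)
  fix x0 assume x0: "x0 \<in> U"
  obtain r where r: "r > 0" "cball x0 (2 * r) \<subseteq> U" using obtain_double_cball[OF U x0] .
  have contF: "continuous_on U F"
    by (rule uniform_limit_theorem[OF _ lim]) (auto intro!: always_eventually cholo_continuous_on f)
  have sub: "ball x0 r \<subseteq> U" using r by (smt (verit) mem_ball mem_cball subsetI subset_iff)
  \<comment> \<open>The direction is normalised to length r, so that one circle radius works for all
    h, and the factor in front undoes this. For h = 0 that factor is 0.\<close>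
  define I where "I G x h = (norm h / r) *\<^sub>R integral {0..1} (\<lambda>\<theta>. cnj (unit_circ \<theta>) *\<^sub>C G (x + unit_circ \<theta> *\<^sub>C ((r / norm h) *\<^sub>R h)))"
    for G :: "'a \<Rightarrow> 'b" and x h
  have in_U: "x + unit_circ \<theta> *\<^sub>C ((r / norm h) *\<^sub>R h) \<in> U" if "x \<in> ball x0 r" for x h \<theta>
    by (rule circle_in_set[OF r(2) that]) (use r in auto)
  have I_f: "FD (f n) x h = I (f n) x h" if "x \<in> ball x0 r" for n x h
  proof (cases "h = 0")
    case True
    have "FD (f n) x h = 0"
      using FD_scaleR[OF f, of x n 0 0] that sub True by auto
    then show ?thesis using True by (simp add: I_def)
  next
    case False
    then show ?thesis
      using FD_eq_scaled_integral[OF U f r(2) that, of "r / norm h" h n] r by (simp add: I_def)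
  qed
  have contI: "continuous_on {0..1} (\<lambda>\<theta>. cnj (unit_circ \<theta>) *\<^sub>C G (x + unit_circ \<theta> *\<^sub>C ((r / norm h) *\<^sub>R h)))"
    if "x \<in> ball x0 r" "continuous_on U G" for G x h
    by (intro continuous_intros continuous_on_compose2[OF that(2)]) (use in_U that in auto)
  have est: "norm (FD (f n) x h - I F x h) \<le> e * norm h"
    if n: "\<And>y. y \<in> U \<Longrightarrow> norm (f n y - F y) \<le> e * r" and x: "x \<in> ball x0 r" for n x h e
  proof -
    let ?g = "\<lambda>G \<theta>. cnj (unit_circ \<theta>) *\<^sub>C G (x + unit_circ \<theta> *\<^sub>C ((r / norm h) *\<^sub>R h))"
    have c: "continuous_on {0..1} (?g (f n))" "continuous_on {0..1} (?g F)"
      by (intro contI x contF cholo_continuous_on[OF f])+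
    have "norm (integral {0..1} (\<lambda>\<theta>. ?g (f n) \<theta> - ?g F \<theta>)) \<le> e * r * (1 - 0)"
    proof (rule integral_bound)
      show "continuous_on {0..1} (\<lambda>\<theta>. ?g (f n) \<theta> - ?g F \<theta>)"
        by (intro continuous_on_diff c)
      show "\<And>\<theta>. \<theta> \<in> {0..1} \<Longrightarrow> norm (?g (f n) \<theta> - ?g F \<theta>) \<le> e * r"
        using n in_U[OF x] by (simp add: norm_cscale flip: cscale_diff_right)
    qed auto
    then have "norm (integral {0..1} (?g (f n)) - integral {0..1} (?g F)) \<le> e * r"
      using c by (simp add: integral_diff integrable_continuous_interval)
    then have "(norm h / r) * norm (integral {0..1} (?g (f n)) - integral {0..1} (?g F)) \<le> (norm h / r) * (e * r)"
      using r by (intro mult_left_mono) auto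
    moreover have "norm (I (f n) x h - I F x h) = (norm h / r) * norm (integral {0..1} (?g (f n)) - integral {0..1} (?g F))"
      using r unfolding I_def by (simp flip: scaleR_diff_right)
    ultimately show ?thesis
      using r by (simp add: I_f[OF x] mult.commute)
  qed
  have nle: "\<forall>\<^sub>F n in sequentially. \<forall>x\<in>ball x0 r. \<forall>h. norm (FD (f n) x h - I F x h) \<le> e * norm h"
    if "e > 0" for e
  proof -
    have "\<forall>\<^sub>F n in sequentially. \<forall>y\<in>U. dist (f n y) (F y) < e * r"
      using lim that r by (auto simp: uniform_limit_iff)
    then show ?thesis
    proof eventually_elim
      case (elim n)
      then have "\<And>y. y \<in> U \<Longrightarrow> norm (f n y - F y) \<le> e * r"
        by (auto simp: dist_norm less_imp_le)
      then show ?case using est by blast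
    qed
  qed
  have tends: "(\<lambda>n. f n x) \<longlonglongrightarrow> F x" if "x \<in> U" for x
    using lim that by (rule tendsto_uniform_limitI)
  have "\<exists>g. \<forall>x\<in>ball x0 r. (\<lambda>n. f n x) \<longlonglongrightarrow> g x \<and> (g has_derivative I F x) (at x within ball x0 r)"
  proof (rule has_derivative_sequence[OF convex_ball _ nle])
    show "(f n has_derivative FD (f n) x) (at x within ball x0 r)" if "x \<in> ball x0 r" for n x
      by (rule has_derivative_at_withinI[OF cholo_has_derivative[OF f]]) (use that sub in auto)
    show "x0 \<in> ball x0 r" using r by simp
    show "(\<lambda>n. f n x0) \<longlonglongrightarrow> F x0" by (rule tends[OF x0])
  qed
  then obtain g where g: "\<And>x. x \<in> ball x0 r \<Longrightarrow> (\<lambda>n. f n x) \<longlonglongrightarrow> g x"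
    "\<And>x. x \<in> ball x0 r \<Longrightarrow> (g has_derivative I F x) (at x within ball x0 r)" by blast
  have gF: "g x = F x" if "x \<in> ball x0 r" for x
    using LIMSEQ_unique[OF g(1) tends] that sub by blast
  have der: "(F has_derivative I F x) (at x)" if "x \<in> ball x0 r" for x
  proof -
    have "(g has_derivative I F x) (at x)" using g(2)[OF that] that by (simp add: at_within_open[OF _ open_ball])
    then show ?thesis
      by (rule has_derivative_transform_within_open[OF _ open_ball that]) (simp add: gF)
  qed
  have FDlim: "(\<lambda>n. FD (f n) x h) \<longlonglongrightarrow> I F x h" if x: "x \<in> ball x0 r" for x h
  proof (rule metric_LIMSEQ_I)
    fix e :: real assume "e > 0"
    then have e: "e / (norm h + 1) > 0" by (simp add: add_nonneg_pos)
    have lt: "e / (norm h + 1) * norm h < e"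
    proof -
      have "norm h + 1 > 0" by (simp add: add_nonneg_pos)
      then show ?thesis using \<open>e > 0\<close> by (simp add: pos_divide_less_eq)
    qed
    from nle[OF e] obtain N where N: "\<forall>n\<ge>N. norm (FD (f n) x h - I F x h) \<le> e / (norm h + 1) * norm h"
      using x unfolding eventually_sequentially by blast
    then show "\<exists>N. \<forall>n\<ge>N. dist (FD (f n) x h) (I F x h) < e"
      unfolding dist_norm using le_less_trans[OF N[rule_format] lt] by blast
  qed
  have "cholo (ball x0 r) F"
  proof (rule choloI[OF der])
    fix x c v assume x: "x \<in> ball x0 r"
    have "(\<lambda>n. FD (f n) x (c *\<^sub>C v)) \<longlonglongrightarrow> c *\<^sub>C I F x v"
      using tendsto_cscale[OF tendsto_const FDlim[OF x]] x sub
      by (simp add: cholo_FD_cscale[OF f] subset_iff)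
    then show "I F x (c *\<^sub>C v) = c *\<^sub>C I F x v"
      using FDlim[OF x] LIMSEQ_unique by blast
  qed
  then show "\<exists>r>0. cholo (ball x0 r) F" using r by blast
qed

lemma cholo_FD_bound:
  assumes U: "open U" and F: "cholo U F" and S: "compact S" "S \<subseteq> U"
  obtains K where "K \<ge> 0" "\<forall>x\<in>S. \<forall>v. norm (FD F x v) \<le> K * norm v"
proof -
  have "compact ((\<lambda>x. Blinfun (FD F x)) ` S)"
    by (intro compact_continuous_image S continuous_on_subset[OF continuous_on_Blinfun_FD[OF U F]])
  then have "bounded ((\<lambda>x. Blinfun (FD F x)) ` S)" by (rule compact_imp_bounded)
  then obtain B where "B > 0" and B: "\<forall>y\<in>(\<lambda>x. Blinfun (FD F x)) ` S. norm y \<le> B"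
    unfolding bounded_pos by blast
  show ?thesis
  proof (rule that[of B], safe)
    fix x v assume x: "x \<in> S"
    have "norm (FD F x v) = norm (blinfun_apply (Blinfun (FD F x)) v)"
      using x S by (simp add: bounded_linear_Blinfun_apply cholo_bounded_linear[OF F] subset_iff)
    also have "\<dots> \<le> norm (Blinfun (FD F x)) * norm v" by (rule norm_blinfun)
    also have "\<dots> \<le> B * norm v" using B x by (simp add: mult_right_mono)
    finally show "norm (FD F x v) \<le> B * norm v" .
  qed (use \<open>B > 0\<close> in auto)
qed

lemma cholo_lipschitz:
  assumes U: "open U" and F: "cholo U F" and S: "compact S" "S \<subseteq> U" "convex S"
  obtains K where "K \<ge> 0" "\<forall>x\<in>S. \<forall>y\<in>S. norm (F x - F y) \<le> K * norm (x - y)"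
proof -
  obtain K where K: "K \<ge> 0" "\<forall>x\<in>S. \<forall>v. norm (FD F x v) \<le> K * norm v"
    by (rule cholo_FD_bound[OF U F S(1,2)])
  show ?thesis
  proof (rule that[OF K(1)], intro ballI)
    fix x y assume "x \<in> S" "y \<in> S"
    show "norm (F x - F y) \<le> K * norm (x - y)"
    proof (rule differentiable_bound[OF S(3)])
      show "(F has_derivative FD F z) (at z within S)" if "z \<in> S" for z
        by (rule has_derivative_at_withinI[OF cholo_has_derivative[OF F]]) (use that S in auto)
      show "onorm (FD F z) \<le> K" if "z \<in> S" for z
        using K that by (intro onorm_le) auto
    qed fact+
  qed
qed

section \<open>Flows of holomorphic vector fields\<close>

lemma open_polydisc: "open (polydisc r :: (complex ^ 'n) set)"
proof -
  have "polydisc r = (\<Inter>i\<in>UNIV. (\<lambda>z :: complex ^ 'n. norm (z $ i)) -` {..<r})"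
    by (auto simp: polydisc_def)
  moreover have "open ((\<lambda>z :: complex ^ 'n. norm (z $ i)) -` {..<r})" for i
    by (intro open_vimage continuous_intros)
  ultimately show ?thesis by (simp add: open_INT)
qed

lemma ball_subset_polydisc: "r \<le> 1 \<Longrightarrow> ball 0 r \<subseteq> (polydisc 1 :: (complex ^ 'n) set)"
proof
  fix z :: "complex ^ 'n" assume "r \<le> 1" "z \<in> ball 0 r"
  then have "norm (z $ i) < 1" for i
    using Finite_Cartesian_Product.norm_nth_le[of z i] by simp
  then show "z \<in> polydisc 1" by (simp add: polydisc_def)
qed

lemma holomorphic_vec_eq_0:
  fixes u :: "complex \<Rightarrow> 'a::complex_vec"
  assumes "open U" "connected U" "cholo U u" "open V" "V \<noteq> {}" "V \<subseteq> U" "\<And>\<sigma>. \<sigma> \<in> V \<Longrightarrow> u \<sigma> = 0" "\<sigma> \<in> U"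
  shows "u \<sigma> = 0"
proof (rule cfunc_eqI)
  fix b :: 'a assume "b \<in> Basis"
  have hol: "(\<lambda>x. cfunc b (u x)) holomorphic_on U"
    by (rule cholo_imp_holomorphic_on[OF cholo_cfunc[OF assms(3)]])
  show "cfunc b (u \<sigma>) = cfunc b 0"
    by (rule analytic_continuation_open[OF assms(4,1,5,2,6) hol holomorphic_on_const _ assms(8)])
      (simp add: assms(7))
qed

text \<open>At a maximum point of the norm on a small closed disc the mean value bound gives M \<le>
  M/2, so u vanishes there; the identity theorem carries this to the whole disc. The inequality is
  therefore asked for only near 0, where Lipschitz constants are available.\<close>

lemma linear_ode_zero:
  fixes u :: "complex \<Rightarrow> 'a::complex_vec"
  assumes u: "cholo (ball 0 r) u" and u0: "u 0 = 0" and \<rho>: "0 < \<rho>"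
    and K: "\<And>\<sigma>. norm \<sigma> < r \<Longrightarrow> norm \<sigma> < \<rho> \<Longrightarrow> norm (FD u \<sigma> 1) \<le> K * norm (u \<sigma>)"
    and \<sigma>: "norm \<sigma> < r"
  shows "u \<sigma> = 0"
proof -
  have r: "r > 0" using \<sigma> norm_ge_zero[of \<sigma>] by linarith
  define K' where "K' = max K 1"
  \<comment> \<open>Chosen so that \<open>\<rho>' * K'\<close> is at most 1/2; \<open>K'\<close> is
    at least 1 so that the division is harmless.\<close>
  define \<rho>' where "\<rho>' = min (min r \<rho>) (1 / K') / 2"
  have K': "K' \<ge> 1" "K' \<ge> K" by (auto simp: K'_def)
  have \<rho>': "\<rho>' > 0" "\<rho>' < r" "\<rho>' < \<rho>" "\<rho>' * K' \<le> 1 / 2"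
  proof -
    show "\<rho>' > 0" "\<rho>' < r" "\<rho>' < \<rho>" using r \<rho> K' by (auto simp: \<rho>'_def min_def)
    have "\<rho>' \<le> (1 / K') / 2" by (simp add: \<rho>'_def)
    then show "\<rho>' * K' \<le> 1 / 2" using K' by (simp add: field_simps)
  qed
  have sub: "cball 0 \<rho>' \<subseteq> ball 0 r" using \<rho>' by auto
  have "continuous_on (cball 0 \<rho>') (\<lambda>\<sigma>. norm (u \<sigma>))"
    by (intro continuous_on_norm continuous_on_subset[OF cholo_continuous_on[OF u]] sub)
  then obtain \<sigma>0 where \<sigma>0: "\<sigma>0 \<in> cball 0 \<rho>'" "\<forall>y\<in>cball 0 \<rho>'. norm (u y) \<le> norm (u \<sigma>0)"
    using continuous_attains_sup[of "cball 0 \<rho>'" "\<lambda>\<sigma>. norm (u \<sigma>)"] \<rho>' by auto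
  have "norm (u \<sigma>0 - u 0) \<le> (K' * norm (u \<sigma>0)) * norm (\<sigma>0 - 0)"
  proof (rule differentiable_bound[OF convex_cball[of 0 \<rho>']])
    fix x :: complex assume x: "x \<in> cball 0 \<rho>'"
    then have xr: "x \<in> ball 0 r" using sub by blast
    show "(u has_derivative FD u x) (at x within cball 0 \<rho>')"
      by (rule has_derivative_at_withinI[OF cholo_has_derivative[OF u xr]])
    show "onorm (FD u x) \<le> K' * norm (u \<sigma>0)"
    proof (rule onorm_le)
      fix h :: complex
      have "norm (FD u x 1) \<le> K * norm (u x)" using x xr \<rho>' by (intro K) auto
      also have "\<dots> \<le> K' * norm (u \<sigma>0)" using \<sigma>0(2) x K' by (intro mult_mono) auto
      finally have "norm h * norm (FD u x 1) \<le> norm h * (K' * norm (u \<sigma>0))"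
        by (rule mult_left_mono) simp
      moreover have "FD u x h = h *\<^sub>C FD u x 1"
        using cholo_FD_cscale[OF u xr, of h 1] by simp
      ultimately show "norm (FD u x h) \<le> K' * norm (u \<sigma>0) * norm h"
        by (simp add: norm_cscale mult_ac)
    qed
  qed (use \<sigma>0 \<rho>' in auto)
  also have "\<dots> \<le> (K' * norm (u \<sigma>0)) * \<rho>'"
    using \<sigma>0(1) K' by (intro mult_left_mono) auto
  also have "\<dots> = (\<rho>' * K') * norm (u \<sigma>0)" by simp
  also have "\<dots> \<le> 1 / 2 * norm (u \<sigma>0)" by (rule mult_right_mono[OF \<rho>'(4) norm_ge_zero])
  finally have "norm (u \<sigma>0) = 0" using u0 by simp
  then have "u y = 0" if "y \<in> ball 0 \<rho>'" for y
    using \<sigma>0(2) that by force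
  moreover have "ball 0 \<rho>' \<subseteq> ball 0 r" using sub ball_subset_cball by blast
  ultimately show ?thesis
    using holomorphic_vec_eq_0[OF open_ball _ u open_ball, of 0 \<rho>' \<sigma>] \<rho>' \<sigma> by simp
qed

definition solves :: "(complex ^ 'n \<Rightarrow> complex ^ 'n) \<Rightarrow> real \<Rightarrow> (complex \<Rightarrow> complex ^ 'n) \<Rightarrow> bool" where
  "solves X r \<gamma> \<longleftrightarrow> (\<forall>\<sigma>. norm \<sigma> < r \<longrightarrow> \<gamma> \<sigma> \<in> polydisc 1 \<and>
     (\<gamma> has_derivative (\<lambda>h. h *\<^sub>C X (\<gamma> \<sigma>))) (at \<sigma>))"

lemma solvesD:
  assumes "solves X r \<gamma>" "norm \<sigma> < r"
  shows "\<gamma> \<sigma> \<in> polydisc 1" "(\<gamma> has_derivative (\<lambda>h. h *\<^sub>C X (\<gamma> \<sigma>))) (at \<sigma>)"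
  using assms by (auto simp: solves_def)

lemma solves_cholo: "solves X r \<gamma> \<Longrightarrow> cholo (ball 0 r) \<gamma>"
  by (rule choloI[where D = "\<lambda>\<sigma> h. h *\<^sub>C X (\<gamma> \<sigma>)"]) (auto simp: solves_def cscale_cscale)

lemma solves_mono: "solves X r \<gamma> \<Longrightarrow> r' \<le> r \<Longrightarrow> solves X r' \<gamma>"
  by (auto simp: solves_def)

text \<open>The difference of two solutions satisfies the inequality of
  \<open>linear_ode_zero\<close> as long as both curves stay in one compact ball around the initial
  point, where X is Lipschitz. This holds for short times, which is enough.\<close>

lemma solves_unique:
  assumes X: "cholo (polydisc 1) X" and 1: "solves X r \<gamma>" and 2: "solves X r \<eta>"
    and eq: "\<gamma> 0 = \<eta> 0" and \<sigma>: "norm \<sigma> < r"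
  shows "\<gamma> \<sigma> = \<eta> \<sigma>"
proof -
  have r: "r > 0" using \<sigma> norm_ge_zero[of \<sigma>] by linarith
  have c: "cholo (ball 0 r) \<gamma>" "cholo (ball 0 r) \<eta>"
    using 1 2 by (auto intro: solves_cholo)
  have "\<gamma> 0 \<in> polydisc 1" using solvesD(1)[OF 1, of 0] r by simp
  then obtain e where e: "e > 0" "cball (\<gamma> 0) e \<subseteq> polydisc 1"
    using open_polydisc open_contains_cball by blast
  obtain K where K: "K \<ge> 0" "\<forall>x\<in>cball (\<gamma> 0) e. \<forall>y\<in>cball (\<gamma> 0) e. norm (X x - X y) \<le> K * norm (x - y)"
    by (rule cholo_lipschitz[OF open_polydisc X compact_cball e(2) convex_cball])
  have ex: "\<exists>d>0. \<forall>x. norm x < d \<longrightarrow> \<zeta> x \<in> cball (\<gamma> 0) e" if "cholo (ball 0 r) \<zeta>" "\<zeta> 0 = \<gamma> 0" for \<zeta>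
  proof -
    have "isCont \<zeta> 0"
      using cholo_has_derivative[OF that(1), of 0] r has_derivative_continuous by auto
    then obtain d where "d > 0" "\<forall>x. dist x 0 < d \<longrightarrow> dist (\<zeta> x) (\<zeta> 0) < e"
      using e(1) unfolding continuous_at_eps_delta by blast
    then show ?thesis using that(2) by (auto simp: dist_commute less_imp_le)
  qed
  obtain d1 where d1: "d1 > 0" "\<forall>x. norm x < d1 \<longrightarrow> \<gamma> x \<in> cball (\<gamma> 0) e" using ex[OF c(1)] by auto
  obtain d2 where d2: "d2 > 0" "\<forall>x. norm x < d2 \<longrightarrow> \<eta> x \<in> cball (\<gamma> 0) e" using ex[OF c(2)] eq by auto
  have "\<gamma> \<sigma> - \<eta> \<sigma> = 0"
  proof (rule linear_ode_zero[OF cholo_diff[OF c] _ _ _ \<sigma>])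
    show "0 < min d1 d2" using d1 d2 by simp
    fix s :: complex assume s: "norm s < r" "norm s < min d1 d2"
    have "((\<lambda>x. \<gamma> x - \<eta> x) has_derivative (\<lambda>h. h *\<^sub>C X (\<gamma> s) - h *\<^sub>C X (\<eta> s))) (at s)"
      by (intro has_derivative_diff solvesD(2)[OF 1 s(1)] solvesD(2)[OF 2 s(1)])
    then have "FD (\<lambda>x. \<gamma> x - \<eta> x) s 1 = X (\<gamma> s) - X (\<eta> s)"
      by (simp add: FD_eq)
    then show "norm (FD (\<lambda>x. \<gamma> x - \<eta> x) s 1) \<le> K * norm (\<gamma> s - \<eta> s)"
      using K(2) d1 d2 s by simp
  qed (use eq in auto)
  then show ?thesis by simp
qed

text \<open>The description in \<open>cflow\<close> fixes neither radius nor curve; it is well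
  defined because two candidates agree on the smaller of their discs. Any concrete solution
  therefore computes the flow.\<close>

lemma cflow_eqI:
  assumes X: "cholo (polydisc 1) X" and \<gamma>: "solves X r \<gamma>" and s: "norm s < r"
  shows "cflow X s (\<gamma> 0) = \<gamma> s"
  unfolding cflow_def
proof (rule the_equality)
  show "\<exists>r>cmod s. \<exists>\<gamma>'. \<gamma>' 0 = \<gamma> 0 \<and> \<gamma> s = \<gamma>' s \<and>
      (\<forall>\<sigma>. cmod \<sigma> < r \<longrightarrow> \<gamma>' \<sigma> \<in> polydisc 1 \<and> (\<gamma>' has_derivative (\<lambda>h. h *s X (\<gamma>' \<sigma>))) (at \<sigma>))"
    using \<gamma> s unfolding solves_def cscale_eq_vector_scalar_mult by blast
next
  fix w assume "\<exists>r>cmod s. \<exists>\<gamma>'. \<gamma>' 0 = \<gamma> 0 \<and> w = \<gamma>' s \<and>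
      (\<forall>\<sigma>. cmod \<sigma> < r \<longrightarrow> \<gamma>' \<sigma> \<in> polydisc 1 \<and> (\<gamma>' has_derivative (\<lambda>h. h *s X (\<gamma>' \<sigma>))) (at \<sigma>))"
  then obtain r' \<gamma>' where \<gamma>': "cmod s < r'" "\<gamma>' 0 = \<gamma> 0" "w = \<gamma>' s" "solves X r' \<gamma>'"
    unfolding solves_def cscale_eq_vector_scalar_mult by blast
  have "\<gamma>' s = \<gamma> s"
    by (rule solves_unique[OF X, of "min r r'"])
      (use \<gamma>' \<gamma> s in \<open>auto intro: solves_mono\<close>)
  then show "w = \<gamma> s" using \<gamma>' by simp
qed

text \<open>C bounds the speed, so the curve from z cannot leave the ball of radius R while |z| +
  C|s| < R. On that domain |s| \<le> R/C, and the Lipschitz constant C/(2R) is chosen to make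
  Picard's operator contract with factor 1/2.\<close>

locale flow_box =
  fixes X :: "complex ^ 'n \<Rightarrow> complex ^ 'n" and R C :: real
  assumes R: "0 < R" "R \<le> 1" and C: "0 < C"
    and holo: "cholo (polydisc 1) X"
    and bound: "\<And>z. z \<in> ball 0 R \<Longrightarrow> norm (X z) \<le> C"
    and dbound: "\<And>z v. z \<in> ball 0 R \<Longrightarrow> norm (FD X z v) \<le> C / (2 * R) * norm v"
begin

lemma ball_polydisc: "ball 0 R \<subseteq> (polydisc 1 :: (complex ^ 'n) set)"
  by (rule ball_subset_polydisc[OF R(2)])

lemma lip: "z \<in> ball 0 R \<Longrightarrow> w \<in> ball 0 R \<Longrightarrow> norm (X z - X w) \<le> C / (2 * R) * norm (z - w)"
proof (rule differentiable_bound[OF convex_ball])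
  fix x :: "complex ^ 'n" assume x: "x \<in> ball 0 R"
  then show "(X has_derivative FD X x) (at x within ball 0 R)"
    using ball_polydisc by (intro has_derivative_at_withinI[OF cholo_has_derivative[OF holo]]) auto
  show "onorm (FD X x) \<le> C / (2 * R)" by (rule onorm_le[OF dbound[OF x]])
qed

definition fdom :: "(complex \<times> (complex ^ 'n)) set" where
  "fdom = {p. norm (snd p) + C * norm (fst p) < R}"

lemma open_fdom: "open fdom"
  unfolding fdom_def by (intro open_Collect_less continuous_intros)

lemma fdom_scale: "(s, z) \<in> fdom \<Longrightarrow> 0 \<le> t \<Longrightarrow> t \<le> 1 \<Longrightarrow> (t *\<^sub>R s, z) \<in> fdom"
proof -
  assume a: "(s, z) \<in> fdom" "0 \<le> t" "t \<le> 1"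
  then have "C * (t * norm s) \<le> C * norm s"
    using C by (intro mult_left_mono mult_left_le_one_le) auto
  then show ?thesis using a by (auto simp: fdom_def)
qed

text \<open>The path integral of X from 0 to the complex time s is rescaled to s times an integral
  over [0,1] along the ray \<tau>s. All iterates then have a common real interval of integration,
  and holomorphy in (s, z) is a matter of integrals with parameters.\<close>

primrec pic :: "nat \<Rightarrow> complex \<times> (complex ^ 'n) \<Rightarrow> complex ^ 'n" where
  "pic 0 p = snd p"
| "pic (Suc k) p = snd p + fst p *\<^sub>C integral {0..1} (\<lambda>\<tau>. X (pic k (\<tau> *\<^sub>R fst p, snd p)))"

lemma in_ball: "p \<in> fdom \<Longrightarrow> norm (w - snd p) \<le> C * norm (fst p) \<Longrightarrow> w \<in> ball 0 R"
  using norm_triangle_sub[of w "snd p"] by (auto simp: fdom_def)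

text \<open>What a Picard step preserves: the distance bound keeps the values in the ball where X is
  bounded by C, and this bound reproduces the distance bound for the next iterate.\<close>

definition near :: "(complex \<times> (complex ^ 'n) \<Rightarrow> complex ^ 'n) \<Rightarrow> bool" where
  "near F \<longleftrightarrow> cholo fdom F \<and> (\<forall>p\<in>fdom. norm (F p - snd p) \<le> C * norm (fst p))"

lemma nearD: "near F \<Longrightarrow> cholo fdom F" "near F \<Longrightarrow> p \<in> fdom \<Longrightarrow> norm (F p - snd p) \<le> C * norm (fst p)"
  by (auto simp: near_def)

lemma continuous_on_path:
  assumes near: "near F"
  shows "continuous_on (fdom \<times> {0..1}) (\<lambda>(p, \<tau>). X (F (\<tau> *\<^sub>R fst p, snd p)))"
    and "\<And>p. p \<in> fdom \<Longrightarrow> continuous_on {0..1} (\<lambda>\<tau>. X (F (\<tau> *\<^sub>R fst p, snd p)))"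
proof -
  have mem: "F (t *\<^sub>R fst p, snd p) \<in> ball 0 R" if "p \<in> fdom" "0 \<le> t" "t \<le> 1" for p t
    using that by (intro in_ball[OF fdom_scale nearD(2)[OF near fdom_scale]]) auto
  have 1: "continuous_on (fdom \<times> {0..1}) (\<lambda>q. F (snd q *\<^sub>R fst (fst q), snd (fst q)))"
    by (rule continuous_on_compose2[OF cholo_continuous_on[OF nearD(1)[OF near]]])
      (auto intro!: continuous_intros fdom_scale)
  have 2: "continuous_on (fdom \<times> {0..1}) (\<lambda>q. X (F (snd q *\<^sub>R fst (fst q), snd (fst q))))"
    by (rule continuous_on_compose2[OF cholo_continuous_on[OF holo] 1])
      (use mem ball_polydisc in force)
  then show "continuous_on (fdom \<times> {0..1}) (\<lambda>(p, \<tau>). X (F (\<tau> *\<^sub>R fst p, snd p)))"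
    by (simp add: case_prod_beta)
  show "continuous_on {0..1} (\<lambda>\<tau>. X (F (\<tau> *\<^sub>R fst p, snd p)))" if "p \<in> fdom" for p
    using continuous_on_compose2[OF 2, of "{0..1}" "\<lambda>\<tau>. (p, \<tau>)"] that
    by (simp add: image_subset_iff continuous_on_Pair)
qed

lemma pic_bound:
  "near (pic k)"
proof (induction k)
  case 0
  show ?case using C by (simp add: near_def cholo_snd)
next
  case (Suc k)
  let ?f = "\<lambda>p \<tau>. X (pic k (\<tau> *\<^sub>R fst p, snd p))"
  note hyp = nearD[OF Suc]
  note cont = continuous_on_path[OF Suc]
  have mem: "pic k (t *\<^sub>R fst p, snd p) \<in> ball 0 R" if "p \<in> fdom" "t \<in> {0..1}" for p t
    using that by (intro in_ball[OF fdom_scale hyp(2)[OF fdom_scale]]) auto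
  have f: "cholo fdom (\<lambda>p. ?f p \<tau>)" if \<tau>: "\<tau> \<in> {0..1}" for \<tau>
  proof (rule cholo_compose[OF cholo_compose[OF _ hyp(1)] holo])
    show "cholo fdom (\<lambda>p. (\<tau> *\<^sub>R fst p, snd p))"
      by (intro cholo_Pair cholo_snd)
        (use cholo_cscale[OF cholo_const cholo_fst, of fdom "of_real \<tau>"] in \<open>simp only: cscale_of_real\<close>)
  qed (use mem \<tau> ball_polydisc in \<open>auto intro!: fdom_scale\<close>)
  have "cholo fdom (\<lambda>p. snd p + fst p *\<^sub>C integral {0..1} (?f p))"
    by (intro cholo_add cholo_cscale cholo_fst cholo_snd cholo_integral(2)[OF open_fdom f cont(1)])
  moreover have "norm (snd p + fst p *\<^sub>C integral {0..1} (?f p) - snd p) \<le> C * norm (fst p)" if p: "p \<in> fdom" for p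
  proof -
    have "norm (integral {0..1} (?f p)) \<le> C * (1 - 0)"
      by (rule integral_bound[OF _ cont(2)[OF p]]) (use mem[OF p] bound in auto)
    then have "norm (fst p) * norm (integral {0..1} (?f p)) \<le> norm (fst p) * C"
      by (intro mult_left_mono) auto
    then show ?thesis by (simp add: norm_cscale mult.commute[of C])
  qed
  ultimately show ?case by (simp add: near_def)
qed

text \<open>The contraction: the Lipschitz constant C/(2R) times |s| \<le> R/C is at most 1/2. Using
  the supremum over all of \<open>fdom\<close> is legitimate since \<open>fdom\<close> contains
  \<tau>s whenever it contains s.\<close>

lemma integral_path_diff:
  assumes F: "near F" and G: "near G" and e: "\<And>p. p \<in> fdom \<Longrightarrow> norm (F p - G p) \<le> e" and p: "p \<in> fdom"
  shows "norm (fst p *\<^sub>C integral {0..1} (\<lambda>\<tau>. X (F (\<tau> *\<^sub>R fst p, snd p)))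
    - fst p *\<^sub>C integral {0..1} (\<lambda>\<tau>. X (G (\<tau> *\<^sub>R fst p, snd p)))) \<le> e / 2"
proof -
  let ?f = "\<lambda>\<tau>. X (F (\<tau> *\<^sub>R fst p, snd p))" and ?g = "\<lambda>\<tau>. X (G (\<tau> *\<^sub>R fst p, snd p))"
  note c = continuous_on_path(2)[OF F p] continuous_on_path(2)[OF G p]
  have e0: "e \<ge> 0" using e[OF p] norm_ge_zero order_trans by blast
  have "norm (integral {0..1} (\<lambda>\<tau>. ?f \<tau> - ?g \<tau>)) \<le> C / (2 * R) * e * (1 - 0)"
  proof (rule integral_bound)
    show "continuous_on {0..1} (\<lambda>\<tau>. ?f \<tau> - ?g \<tau>)" by (intro continuous_on_diff c)
    fix t :: real assume t: "t \<in> {0..1}"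
    have tp: "(t *\<^sub>R fst p, snd p) \<in> fdom" using p t by (intro fdom_scale) auto
    have "norm (?f t - ?g t) \<le> C / (2 * R) * norm (F (t *\<^sub>R fst p, snd p) - G (t *\<^sub>R fst p, snd p))"
      by (rule lip[OF in_ball[OF tp nearD(2)[OF F tp]] in_ball[OF tp nearD(2)[OF G tp]]])
    also have "\<dots> \<le> C / (2 * R) * e" using e[OF tp] C R by (intro mult_left_mono) auto
    finally show "norm (?f t - ?g t) \<le> C / (2 * R) * e" .
  qed auto
  then have 1: "norm (integral {0..1} ?f - integral {0..1} ?g) \<le> C / (2 * R) * e"
    using c by (simp add: integral_diff integrable_continuous_interval)
  have s: "norm (fst p) * C \<le> R"
    using p norm_ge_zero[of "snd p"] unfolding fdom_def mem_Collect_eq by (simp only: mult.commute[of C])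
  have "norm (fst p) * norm (integral {0..1} ?f - integral {0..1} ?g) \<le> norm (fst p) * (C / (2 * R) * e)"
    by (rule mult_left_mono[OF 1 norm_ge_zero])
  also have "\<dots> = (norm (fst p) * C) * (e / (2 * R))" by simp
  also have "\<dots> \<le> R * (e / (2 * R))" using s e0 R by (intro mult_right_mono) auto
  also have "\<dots> = e / 2" using R by simp
  finally show ?thesis by (simp add: norm_cscale flip: cscale_diff_right)
qed

lemma pic_step: "p \<in> fdom \<Longrightarrow> norm (pic (Suc k) p - pic k p) \<le> R * (1 / 2) ^ k"
proof (induction k arbitrary: p)
  case 0
  then have "norm (pic (Suc 0) p - snd p) \<le> C * norm (fst p)" by (rule nearD(2)[OF pic_bound])
  also have "\<dots> \<le> R"
    using 0 norm_ge_zero[of "snd p"] unfolding fdom_def mem_Collect_eq by linarith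
  finally show ?case by simp
next
  case (Suc k)
  have "norm (fst p *\<^sub>C integral {0..1} (\<lambda>\<tau>. X (pic (Suc k) (\<tau> *\<^sub>R fst p, snd p)))
    - fst p *\<^sub>C integral {0..1} (\<lambda>\<tau>. X (pic k (\<tau> *\<^sub>R fst p, snd p)))) \<le> (R * (1 / 2) ^ k) / 2"
    by (rule integral_path_diff) (use pic_bound Suc in blast)+
  then show ?case by simp
qed

text \<open>The limit of the iterates, written as a telescoping series so that the Weierstrass test
  with the geometric majorant gives uniform convergence.\<close>

definition phi :: "complex \<times> (complex ^ 'n) \<Rightarrow> complex ^ 'n" where
  "phi p = snd p + (\<Sum>k. pic (Suc k) p - pic k p)"

lemma pic_uniform_limit: "uniform_limit fdom pic phi sequentially"
proof -
  have "uniform_limit fdom (\<lambda>n p. \<Sum>k<n. pic (Suc k) p - pic k p) (\<lambda>p. \<Sum>k. pic (Suc k) p - pic k p) sequentially"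
    by (rule Weierstrass_m_test[OF pic_step]) (auto intro!: summable_mult summable_geometric)
  then have "uniform_limit fdom (\<lambda>n p. snd p + (\<Sum>k<n. pic (Suc k) p - pic k p))
      (\<lambda>p. snd p + (\<Sum>k. pic (Suc k) p - pic k p)) sequentially"
    by (rule uniform_limit_add[OF uniform_limit_const])
  moreover have "snd p + (\<Sum>k<n. pic (Suc k) p - pic k p) = pic n p" for n p
    using sum_lessThan_telescope[of "\<lambda>k. pic k p" n] by simp
  ultimately show ?thesis by (simp only: phi_def[abs_def])
qed

lemma cholo_phi: "cholo fdom phi"
  by (rule cholo_uniform_limit[OF open_fdom nearD(1)[OF pic_bound] pic_uniform_limit])

lemma phi_dist: "p \<in> fdom \<Longrightarrow> norm (phi p - snd p) \<le> C * norm (fst p)"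
proof -
  assume p: "p \<in> fdom"
  have "(\<lambda>n. norm (pic n p - snd p)) \<longlonglongrightarrow> norm (phi p - snd p)"
    by (intro tendsto_intros tendsto_uniform_limitI[OF pic_uniform_limit p])
  then show ?thesis
    by (rule LIMSEQ_le_const2) (use nearD(2)[OF pic_bound p] in blast)
qed

lemma near_phi: "near phi"
  using cholo_phi phi_dist by (simp add: near_def)

lemma phi_integral:
  assumes p: "p \<in> fdom"
  shows "phi p = snd p + fst p *\<^sub>C integral {0..1} (\<lambda>\<tau>. X (phi (\<tau> *\<^sub>R fst p, snd p)))"
proof -
  let ?I = "\<lambda>F. fst p *\<^sub>C integral {0..1} (\<lambda>\<tau>. X (F (\<tau> *\<^sub>R fst p, snd p)))"
  have "(\<lambda>n. ?I (pic n)) \<longlonglongrightarrow> ?I phi"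
  proof (rule metric_LIMSEQ_I)
    fix e :: real assume e: "e > 0"
    have "\<forall>\<^sub>F n in sequentially. \<forall>q\<in>fdom. dist (pic n q) (phi q) < e"
      using pic_uniform_limit e unfolding uniform_limit_iff by blast
    then obtain N where N: "\<And>n q. n \<ge> N \<Longrightarrow> q \<in> fdom \<Longrightarrow> dist (pic n q) (phi q) < e"
      unfolding eventually_sequentially by blast
    have "dist (?I (pic n)) (?I phi) < e" if n: "n \<ge> N" for n
    proof -
      have "norm (?I (pic n) - ?I phi) \<le> e / 2"
      proof (rule integral_path_diff[OF pic_bound near_phi _ p])
        show "norm (pic n q - phi q) \<le> e" if "q \<in> fdom" for q
          using N[OF n that] by (simp add: dist_norm)
      qed
      then show ?thesis using e by (simp add: dist_norm)
    qed
    then show "\<exists>N. \<forall>n\<ge>N. dist (?I (pic n)) (?I phi) < e" by blast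
  qed
  then have "(\<lambda>n. snd p + ?I (pic n)) \<longlonglongrightarrow> snd p + ?I phi" by (rule tendsto_add[OF tendsto_const])
  then have "(\<lambda>n. pic (Suc n) p) \<longlonglongrightarrow> snd p + ?I phi" by simp
  moreover have "(\<lambda>n. pic (Suc n) p) \<longlonglongrightarrow> phi p"
    using tendsto_uniform_limitI[OF pic_uniform_limit p] by (rule LIMSEQ_Suc)
  ultimately show ?thesis using LIMSEQ_unique by blast
qed

lemma fdom_ball: "(\<sigma>, z) \<in> fdom \<longleftrightarrow> norm \<sigma> < (R - norm z) / C"
  using C by (simp add: fdom_def field_simps)

text \<open>The integral equation speaks only about rays. On the disc of admissible times each
  scalar component of X along the curve has a holomorphic primitive U, the ray integral equals U
  \<sigma> - U 0, and the complex derivative in time is that of U.\<close>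

lemma phi_deriv:
  assumes p: "(s, z) \<in> fdom"
  shows "((\<lambda>\<sigma>. phi (\<sigma>, z)) has_derivative (\<lambda>h. h *\<^sub>C X (phi (s, z)))) (at s)"
proof -
  define B where "B = ball (0::complex) ((R - norm z) / C)"
  have B: "\<sigma> \<in> B \<longleftrightarrow> (\<sigma>, z) \<in> fdom" for \<sigma> by (simp add: B_def fdom_ball)
  have pair: "cholo B (\<lambda>\<sigma>. (\<sigma>, z))" by (intro cholo_Pair) auto
  have F: "cholo B (\<lambda>\<sigma>. phi (\<sigma>, z))" by (rule cholo_compose[OF pair cholo_phi]) (simp add: B)
  have g: "cholo B (\<lambda>\<sigma>. X (phi (\<sigma>, z)))"
  proof (rule cholo_compose[OF F holo])
    fix \<sigma> assume "\<sigma> \<in> B"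
    then have "phi (\<sigma>, z) \<in> ball 0 R" using in_ball[OF _ phi_dist] B by blast
    then show "phi (\<sigma>, z) \<in> polydisc 1" using ball_polydisc by blast
  qed
  have sB: "s \<in> B" using B p by simp
  have eq: "FD (\<lambda>\<sigma>. phi (\<sigma>, z)) s h = h *\<^sub>C X (phi (s, z))" for h
  proof (rule cfunc_eqI)
    fix b :: "complex ^ 'n" assume "b \<in> Basis"
    let ?u = "\<lambda>\<sigma>. cfunc b (X (phi (\<sigma>, z)))"
    have u: "?u holomorphic_on B" by (rule cholo_imp_holomorphic_on[OF cholo_cfunc[OF g]])
    have "\<exists>U. \<forall>x\<in>B. (U has_field_derivative ?u x) (at x within B)"
    proof (rule holomorphic_convex_primitive[of B "{}" ?u])
      show "continuous_on B ?u" by (rule holomorphic_on_imp_continuous_on[OF u])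
      show "?u field_differentiable at x" if "x \<in> interior B - {}" for x
        using u that by (simp add: B_def holomorphic_on_imp_differentiable_at)
      show "convex B" by (simp add: B_def)
      show "\<exists>U. \<forall>x\<in>B. (U has_field_derivative ?u x) (at x within B)"
        if "\<And>x. x \<in> B \<Longrightarrow> (g has_field_derivative ?u x) (at x within B)" for g
        using that by blast
    qed simp
    then obtain U where U0: "\<forall>x\<in>B. (U has_field_derivative ?u x) (at x within B)" by blast
    have U: "(U has_field_derivative ?u x) (at x)" if "x \<in> B" for x
      using U0 that by (simp add: B_def at_within_open[OF _ open_ball])
    have val: "cfunc b (phi (\<sigma>, z)) = cfunc b z + (U \<sigma> - U 0)" if \<sigma>: "\<sigma> \<in> B" for \<sigma>
    proof -
      have tB: "\<tau> *\<^sub>R \<sigma> \<in> B" if "\<tau> \<in> {0..1}" for \<tau>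
        using that \<sigma> by (simp add: B fdom_scale)
      have "((\<lambda>\<tau>. \<sigma> * ?u (\<tau> *\<^sub>R \<sigma>)) has_integral U (1 *\<^sub>R \<sigma>) - U (0 *\<^sub>R \<sigma>)) {0..1}"
      proof (rule fundamental_theorem_of_calculus)
        fix \<tau> :: real assume \<tau>: "\<tau> \<in> {0..1}"
        have "((\<lambda>\<tau>. \<tau> *\<^sub>R \<sigma>) has_vector_derivative \<sigma>) (at \<tau> within {0..1})"
          unfolding has_vector_derivative_def
          by (rule has_derivative_eq_rhs[OF has_derivative_scaleR_left[OF has_derivative_ident]]) simp
        from field_vector_diff_chain_within[OF this has_field_derivative_at_within[OF U[OF tB[OF \<tau>]]]]
        show "((\<lambda>\<tau>. U (\<tau> *\<^sub>R \<sigma>)) has_vector_derivative \<sigma> * ?u (\<tau> *\<^sub>R \<sigma>)) (at \<tau> within {0..1})"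
          by (simp add: o_def)
      qed simp
      then have "((\<lambda>\<tau>. \<sigma> * ?u (\<tau> *\<^sub>R \<sigma>)) has_integral U \<sigma> - U 0) {0..1}" by simp
      then have 1: "integral {0..1} (\<lambda>\<tau>. \<sigma> * ?u (\<tau> *\<^sub>R \<sigma>)) = U \<sigma> - U 0"
        by (rule integral_unique)
      have fd: "(\<sigma>, z) \<in> fdom" using \<sigma> B by simp
      have int: "(\<lambda>\<tau>. X (phi (\<tau> *\<^sub>R \<sigma>, z))) integrable_on {0..1}"
        using continuous_on_path(2)[OF near_phi fd]
        by (simp add: integrable_continuous_interval)
      have "cfunc b (phi (\<sigma>, z)) = cfunc b z + \<sigma> * cfunc b (integral {0..1} (\<lambda>\<tau>. X (phi (\<tau> *\<^sub>R \<sigma>, z))))"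
        using phi_integral[OF fd]
        by (simp add: bounded_linear.linear[OF bounded_linear_cfunc] linear_add cfunc_cscale)
      also have "cfunc b (integral {0..1} (\<lambda>\<tau>. X (phi (\<tau> *\<^sub>R \<sigma>, z)))) = integral {0..1} (\<lambda>\<tau>. ?u (\<tau> *\<^sub>R \<sigma>))"
        using integral_linear[OF int bounded_linear_cfunc[of b]] by (simp add: o_def)
      finally show ?thesis using 1 by simp
    qed
    have "((\<lambda>\<sigma>. cfunc b z + (U \<sigma> - U 0)) has_field_derivative ?u s) (at s)"
      using U[OF sB] by (auto intro!: derivative_eq_intros)
    then have d1: "((\<lambda>\<sigma>. cfunc b (phi (\<sigma>, z))) has_derivative (*) (?u s)) (at s)"
      unfolding has_field_derivative_def
      by (rule has_derivative_transform_within_open[OF _ _ sB]) (auto simp: B_def val)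
    have d2: "((\<lambda>\<sigma>. cfunc b (phi (\<sigma>, z))) has_derivative (\<lambda>h. cfunc b (FD (\<lambda>\<sigma>. phi (\<sigma>, z)) s h))) (at s)"
      by (rule bounded_linear.has_derivative[OF bounded_linear_cfunc cholo_has_derivative[OF F sB]])
    from has_derivative_unique[OF d1 d2] have "?u s * h = cfunc b (FD (\<lambda>\<sigma>. phi (\<sigma>, z)) s h)"
      by (rule fun_cong)
    then show "cfunc b (FD (\<lambda>\<sigma>. phi (\<sigma>, z)) s h) = cfunc b (h *\<^sub>C X (phi (s, z)))"
      by (simp add: cfunc_cscale mult.commute)
  qed
  show ?thesis
    by (rule has_derivative_eq_rhs[OF cholo_has_derivative[OF F sB]]) (simp add: eq fun_eq_iff)
qed

lemma phi_0: "norm z < R \<Longrightarrow> phi (0, z) = z"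
  using phi_integral[of "(0, z)"] by (simp add: fdom_def)

lemma solves_phi: "solves X ((R - norm z) / C) (\<lambda>\<sigma>. phi (\<sigma>, z))"
  unfolding solves_def
proof (intro allI impI)
  fix \<sigma> :: complex assume "norm \<sigma> < (R - norm z) / C"
  then have \<sigma>: "(\<sigma>, z) \<in> fdom" by (simp add: fdom_ball)
  then have "phi (\<sigma>, z) \<in> ball 0 R" using in_ball[OF _ phi_dist] by blast
  then show "phi (\<sigma>, z) \<in> polydisc 1 \<and>
      ((\<lambda>\<sigma>. phi (\<sigma>, z)) has_derivative (\<lambda>h. h *\<^sub>C X (phi (\<sigma>, z)))) (at \<sigma>)"
    using ball_polydisc phi_deriv[OF \<sigma>] by blast
qed

lemma fdom_norm: "(s, z) \<in> fdom \<Longrightarrow> norm z < R"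
  using mult_nonneg_nonneg[OF less_imp_le[OF C] norm_ge_zero[of s]] unfolding fdom_def by simp

lemma cflow_eq_phi: "(s, z) \<in> fdom \<Longrightarrow> cflow X s z = phi (s, z)"
  using cflow_eqI[OF holo solves_phi, of s z] phi_0[OF fdom_norm] by (simp add: fdom_ball)

lemma cholo_Phi: "cholo fdom (\<lambda>p. cflow X (fst p) (snd p))"
  by (rule cholo_cong[OF open_fdom _ cholo_phi]) (simp add: cflow_eq_phi)

lemma cflow_dist: "(s, z) \<in> fdom \<Longrightarrow> norm (cflow X s z - z) \<le> C * norm s"
  using phi_dist[of "(s, z)"] by (simp add: cflow_eq_phi)

lemma cflow_ball: "(s, z) \<in> fdom \<Longrightarrow> cflow X s z \<in> ball 0 R"
  using in_ball[of "(s, z)" "cflow X s z"] cflow_dist[of s z] by simp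

lemma cflow_0: "norm z < R \<Longrightarrow> cflow X 0 z = z"
  by (subst cflow_eq_phi) (auto simp: fdom_def phi_0)

lemma cflow_deriv:
  assumes "(s, z) \<in> fdom"
  shows "((\<lambda>\<sigma>. cflow X \<sigma> z) has_derivative (\<lambda>h. h *\<^sub>C X (cflow X s z))) (at s)"
proof -
  have "open {\<sigma>. (\<sigma>, z) \<in> fdom}" unfolding fdom_def
    by (simp, intro open_Collect_less continuous_intros)
  then show ?thesis
    unfolding cflow_eq_phi[OF assms]
    by (rule has_derivative_transform_within_open[OF phi_deriv[OF assms]])
      (use assms in \<open>auto simp: cflow_eq_phi\<close>)
qed

text \<open>The curve shifted in time by h again solves the equation, on a disc smaller by |h|, and
  starts at the point reached at time h; uniqueness does the rest.\<close>

lemma cflow_add: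
  assumes "norm z + C * (norm s + norm h) < R"
  shows "cflow X s (cflow X h z) = cflow X (s + h) z"
proof -
  let ?r = "(R - norm z) / C - norm h"
  have dom: "(\<sigma> + h, z) \<in> fdom" if "norm \<sigma> < ?r" for \<sigma>
    using that norm_triangle_ineq[of \<sigma> h] by (simp add: fdom_ball)
  have "solves X ?r (\<lambda>\<sigma>. cflow X (\<sigma> + h) z)"
    unfolding solves_def
  proof (intro allI impI conjI)
    fix \<sigma> :: complex assume "norm \<sigma> < ?r"
    note d = dom[OF this]
    show "cflow X (\<sigma> + h) z \<in> polydisc 1" using cflow_ball[OF d] ball_polydisc by blast
    have "((\<lambda>\<sigma>. \<sigma> + h) has_derivative (\<lambda>x. x)) (at \<sigma>)"
      by (rule has_derivative_eq_rhs[OF has_derivative_add[OF has_derivative_ident has_derivative_const]]) simp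
    from has_derivative_compose[OF this cflow_deriv[OF d]]
    show "((\<lambda>\<sigma>. cflow X (\<sigma> + h) z) has_derivative (\<lambda>x. x *\<^sub>C X (cflow X (\<sigma> + h) z))) (at \<sigma>)" .
  qed
  from cflow_eqI[OF holo this, of s] show ?thesis
    using assms C by (simp add: field_simps)
qed

lemma cflow_minus:
  assumes "norm z + 2 * C * norm s < R"
  shows "cflow X (- s) (cflow X s z) = z"
proof -
  have "norm z < R" using assms mult_nonneg_nonneg[OF less_imp_le[OF C] norm_ge_zero[of s]] by simp
  then show ?thesis using cflow_add[of z "- s" s] cflow_0 assms by simp
qed

lemma FD_Phi_time: "(s, z) \<in> fdom \<Longrightarrow> FD (\<lambda>p. cflow X (fst p) (snd p)) (s, z) (h, 0) = h *\<^sub>C X (cflow X s z)"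
proof -
  assume a: "(s, z) \<in> fdom"
  have "((\<lambda>\<sigma>. (\<sigma>, z)) has_derivative (\<lambda>h. (h, 0))) (at s)"
    by (intro has_derivative_Pair has_derivative_ident has_derivative_const)
  from has_derivative_compose[OF this cholo_has_derivative[OF cholo_Phi a]]
  have "((\<lambda>\<sigma>. cflow X \<sigma> z) has_derivative (\<lambda>h. FD (\<lambda>p. cflow X (fst p) (snd p)) (s, z) (h, 0))) (at s)"
    by simp
  from has_derivative_unique[OF this cflow_deriv[OF a]] show ?thesis by (rule fun_cong)
qed

lemma FD_Phi_space: "(s, z) \<in> fdom \<Longrightarrow>
  ((\<lambda>z. cflow X s z) has_derivative (\<lambda>v. FD (\<lambda>p. cflow X (fst p) (snd p)) (s, z) (0, v))) (at z)"
proof -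
  assume a: "(s, z) \<in> fdom"
  have "((\<lambda>z. (s, z)) has_derivative (\<lambda>h. (0, h))) (at z)"
    by (intro has_derivative_Pair has_derivative_ident has_derivative_const)
  from has_derivative_compose[OF this cholo_has_derivative[OF cholo_Phi a]]
  show ?thesis by simp
qed

end

section \<open>Flows of commuting fields commute\<close>

text \<open>Both sides solve the variational equation \<open>u' = DX(\<Phi>) u\<close> along the flow line, with the same
  initial value.\<close>

lemma FD_Phi_commuting_field:
  assumes X: "flow_box X R C" and Y: "flow_box Y R C"
    and comm: "\<And>z. z \<in> polydisc 1 \<Longrightarrow> commute_at X Y z"
    and s: "(s, z) \<in> flow_box.fdom R C"
  shows "FD (\<lambda>p. cflow X (fst p) (snd p)) (s, z) (0, Y z) = Y (cflow X s z)"
proof -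
  interpret X: flow_box X R C by fact
  interpret Y: flow_box Y R C by fact
  let ?\<Phi> = "\<lambda>p. cflow X (fst p) (snd p)"
  define v where "v = Y z"
  define P where "P p = FD ?\<Phi> p (0, v)" for p
  define B where "B = ball (0::complex) ((R - norm z) / C)"
  have B: "\<sigma> \<in> B \<longleftrightarrow> (\<sigma>, z) \<in> X.fdom" for \<sigma> by (simp add: B_def X.fdom_ball)
  have P: "cholo X.fdom P" unfolding P_def by (rule cholo_FD[OF X.open_fdom X.cholo_Phi])
  have in_disc: "?\<Phi> p \<in> ball 0 R" if "p \<in> X.fdom" for p
    using that X.cflow_ball[of "fst p" "snd p"] by simp
  have in_poly: "?\<Phi> p \<in> polydisc 1" if "p \<in> X.fdom" for p
    using in_disc[OF that] X.ball_polydisc by blast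
  have pair: "cholo B (\<lambda>\<sigma>. (\<sigma>, z))" by (intro cholo_Pair) auto
  have pair_der: "((\<lambda>\<sigma>. (\<sigma>, z)) has_derivative (\<lambda>h. (h, 0))) (at \<sigma>)" for \<sigma>
    by (intro has_derivative_Pair has_derivative_ident has_derivative_const)
  have A: "cholo B (\<lambda>\<sigma>. P (\<sigma>, z))" by (rule cholo_compose[OF pair P]) (simp add: B)
  have \<Phi>B: "cholo B (\<lambda>\<sigma>. cflow X \<sigma> z)"
    using cholo_compose[OF pair X.cholo_Phi] by (simp add: B)
  have YB: "cholo B (\<lambda>\<sigma>. Y (cflow X \<sigma> z))"
    by (rule cholo_compose[OF \<Phi>B Y.holo]) (use in_poly B in force)
  let ?u = "\<lambda>\<sigma>. P (\<sigma>, z) - Y (cflow X \<sigma> z)"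
  have z: "norm z < R" using X.fdom_norm[OF s] .
  have P0: "P (0, z) = v"
  proof -
    have d: "(0, z) \<in> X.fdom" using z by (simp add: X.fdom_def)
    have "((\<lambda>z. cflow X 0 z) has_derivative (\<lambda>v. v)) (at z)"
      by (rule has_derivative_transform_within_open[OF has_derivative_ident open_ball[of 0 R]])
        (use z X.cflow_0 in auto)
    from has_derivative_unique[OF X.FD_Phi_space[OF d] this] show ?thesis
      unfolding P_def by (rule fun_cong)
  qed
  have "?u s = 0"
  proof (rule linear_ode_zero[where r = "(R - norm z) / C" and \<rho> = 1 and K = "C / (2 * R)"])
    show "cholo (ball 0 ((R - norm z) / C)) ?u"
      using cholo_diff[OF A YB] by (simp add: B_def)
    show "?u 0 = 0" using P0 z by (simp add: v_def X.cflow_0)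
    show "norm s < (R - norm z) / C" using s by (simp add: X.fdom_ball)
    fix \<sigma> :: complex assume "norm \<sigma> < (R - norm z) / C"
    then have \<sigma>B: "\<sigma> \<in> B" by (simp add: B_def)
    then have \<sigma>: "(\<sigma>, z) \<in> X.fdom" by (simp add: B)
    let ?w = "cflow X \<sigma> z"
    have w: "?w \<in> polydisc 1" "?w \<in> ball 0 R" using in_poly[OF \<sigma>] in_disc[OF \<sigma>] by simp_all
    have "((\<lambda>\<sigma>. P (\<sigma>, z)) has_derivative (\<lambda>h. FD P (\<sigma>, z) (h, 0))) (at \<sigma>)"
      by (rule has_derivative_compose[OF pair_der cholo_has_derivative[OF P \<sigma>]])
    moreover have "FD P (\<sigma>, z) (1, 0) = FD X ?w (P (\<sigma>, z))"
    proof -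
      \<comment> \<open>Symmetry of second derivatives exchanges time and space: the time derivative
        of the linearised flow is the space derivative of X along the flow.\<close>
      have "FD P (\<sigma>, z) (1, 0) = FD (\<lambda>p. FD ?\<Phi> p (1, 0)) (\<sigma>, z) (0, v)"
        unfolding P_def by (rule FD_symmetric[OF X.open_fdom X.cholo_Phi \<sigma>])
      also have "\<dots> = FD (\<lambda>p. X (?\<Phi> p)) (\<sigma>, z) (0, v)"
      proof -
        have "((\<lambda>p. X (?\<Phi> p)) has_derivative FD (\<lambda>p. X (?\<Phi> p)) (\<sigma>, z)) (at (\<sigma>, z))"
          by (rule cholo_has_derivative[OF cholo_compose[OF X.cholo_Phi X.holo] \<sigma>]) (simp add: in_poly)
        then have "((\<lambda>p. FD ?\<Phi> p (1, 0)) has_derivative FD (\<lambda>p. X (?\<Phi> p)) (\<sigma>, z)) (at (\<sigma>, z))"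
        proof (rule has_derivative_transform_within_open[OF _ X.open_fdom \<sigma>])
          fix p assume "p \<in> X.fdom"
          then show "X (?\<Phi> p) = FD ?\<Phi> p (1, 0)"
            using X.FD_Phi_time[of "fst p" "snd p" 1] by simp
        qed
        then show ?thesis by (simp add: FD_eq)
      qed
      also have "\<dots> = FD X (?\<Phi> (\<sigma>, z)) (FD ?\<Phi> (\<sigma>, z) (0, v))"
        by (rule FD_compose[OF X.cholo_Phi X.holo \<sigma> in_poly[OF \<sigma>]])
      finally show ?thesis by (simp add: P_def)
    qed
    ultimately have dP: "FD (\<lambda>\<sigma>. P (\<sigma>, z)) \<sigma> 1 = FD X ?w (P (\<sigma>, z))" by (simp add: FD_eq)
    have "((\<lambda>\<sigma>. Y (cflow X \<sigma> z)) has_derivative (\<lambda>h. FD Y ?w (h *\<^sub>C X ?w))) (at \<sigma>)"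
      by (rule has_derivative_compose[OF X.cflow_deriv[OF \<sigma>] cholo_has_derivative[OF Y.holo w(1)]])
    then have "FD (\<lambda>\<sigma>. Y (cflow X \<sigma> z)) \<sigma> 1 = FD Y ?w (X ?w)" by (simp add: FD_eq)
    then have dY: "FD (\<lambda>\<sigma>. Y (cflow X \<sigma> z)) \<sigma> 1 = FD X ?w (Y ?w)"
      using comm[OF w(1)] by (simp add: commute_at_def)
    have "FD ?u \<sigma> 1 = FD (\<lambda>\<sigma>. P (\<sigma>, z)) \<sigma> 1 - FD (\<lambda>\<sigma>. Y (cflow X \<sigma> z)) \<sigma> 1"
      using FD_eq[OF has_derivative_diff[OF cholo_has_derivative[OF A \<sigma>B] cholo_has_derivative[OF YB \<sigma>B]]]
      by (rule fun_cong)
    also have "\<dots> = FD X ?w (?u \<sigma>)"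
      using linear_diff[OF bounded_linear.linear[OF cholo_bounded_linear[OF X.holo w(1)]], of "P (\<sigma>, z)" "Y ?w"]
      by (simp only: dP dY)
    finally show "norm (FD ?u \<sigma> 1) \<le> C / (2 * R) * norm (?u \<sigma>)"
      using X.dbound[OF w(2)] by simp
  qed simp
  then show ?thesis by (simp add: P_def v_def)
qed

text \<open>The derivative of the X-flow maps Y to Y, so the X-flow carries integral curves of Y to
  integral curves of Y, and such a curve is determined by its initial point.\<close>

lemma cflow_commute:
  assumes X: "flow_box X R C" and Y: "flow_box Y R C"
    and comm: "\<And>z. z \<in> polydisc 1 \<Longrightarrow> commute_at X Y z"
    and bd: "norm z + C * (norm s + norm u) < R"
  shows "cflow X s (cflow Y u z) = cflow Y u (cflow X s z)"
proof -
  interpret X: flow_box X R C by fact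
  interpret Y: flow_box Y R C by fact
  let ?\<Phi> = "\<lambda>p. cflow X (fst p) (snd p)"
  let ?r = "(R - norm z) / C - norm s"
  have dom: "(\<sigma>, z) \<in> Y.fdom" "(s, cflow Y \<sigma> z) \<in> X.fdom" if "norm \<sigma> < ?r" for \<sigma>
  proof -
    have 1: "norm z + C * norm \<sigma> + C * norm s < R" using that X.C by (simp add: field_simps)
    then show d: "(\<sigma>, z) \<in> Y.fdom"
      using mult_nonneg_nonneg[OF less_imp_le[OF X.C] norm_ge_zero[of s]] by (simp add: Y.fdom_def)
    show "(s, cflow Y \<sigma> z) \<in> X.fdom"
      using Y.cflow_dist[OF d] norm_triangle_sub[of "cflow Y \<sigma> z" z] 1 by (simp add: X.fdom_def)
  qed
  have r: "norm u < ?r" using bd X.C by (simp add: field_simps)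
  then have r0: "norm (0::complex) < ?r" using le_less_trans[OF norm_ge_zero r] by simp
  have "solves Y ?r (\<lambda>\<sigma>. cflow X s (cflow Y \<sigma> z))"
    unfolding solves_def
  proof (intro allI impI conjI)
    fix \<sigma> :: complex assume "norm \<sigma> < ?r"
    note d = dom[OF this]
    let ?w = "cflow Y \<sigma> z"
    show "cflow X s ?w \<in> polydisc 1" using X.cflow_ball[OF d(2)] X.ball_polydisc by blast
    have "((\<lambda>\<sigma>. cflow X s (cflow Y \<sigma> z)) has_derivative (\<lambda>h. FD ?\<Phi> (s, ?w) (0, h *\<^sub>C Y ?w))) (at \<sigma>)"
      by (rule has_derivative_compose[OF Y.cflow_deriv[OF d(1)] X.FD_Phi_space[OF d(2)]])
    moreover have "FD ?\<Phi> (s, ?w) (0, h *\<^sub>C Y ?w) = h *\<^sub>C Y (cflow X s ?w)" for h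
      using cholo_FD_cscale[OF X.cholo_Phi d(2), of h "(0, Y ?w)"]
        FD_Phi_commuting_field[OF X Y comm d(2)] by simp
    ultimately show "((\<lambda>\<sigma>. cflow X s (cflow Y \<sigma> z)) has_derivative (\<lambda>h. h *\<^sub>C Y (cflow X s ?w))) (at \<sigma>)"
      by simp
  qed
  from cflow_eqI[OF Y.holo this r] have "cflow Y u (cflow X s (cflow Y 0 z)) = cflow X s (cflow Y u z)" .
  then show ?thesis using Y.cflow_0 Y.fdom_norm[OF dom(1)[OF r0]] by simp
qed

text \<open>With R = 1/2 the required derivative bound C/(2R) is C itself. The claim covers all
  large C so that finitely many fields can share one constant.\<close>

lemma flow_box_exists:
  assumes X: "cholo (polydisc 1) (X :: complex ^ 'n \<Rightarrow> complex ^ 'n)"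
  shows "\<exists>C0>0. \<forall>C\<ge>C0. flow_box X (1/2) C"
proof -
  have sub: "cball 0 (1/2) \<subseteq> (polydisc 1 :: (complex ^ 'n) set)"
    by (rule order_trans[OF _ ball_subset_polydisc[of 1]]) auto
  obtain K where K: "K \<ge> 0" "\<forall>x\<in>cball 0 (1/2). \<forall>v. norm (FD X x v) \<le> K * norm v"
    by (rule cholo_FD_bound[OF open_polydisc X compact_cball sub])
  have "bounded (X ` cball 0 (1/2))"
    by (intro compact_imp_bounded compact_continuous_image compact_cball
        continuous_on_subset[OF cholo_continuous_on[OF X] sub])
  then obtain b where b: "b > 0" "\<forall>y\<in>X ` cball 0 (1/2). norm y \<le> b"
    unfolding bounded_pos by blast
  have "flow_box X (1/2) C" if C: "C \<ge> max K b" for C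
  proof
    show "0 < C" using C b by simp
    show "norm (X z) \<le> C" if "z \<in> ball 0 (1/2)" for z
    proof -
      have "norm (X z) \<le> b" using b(2) that by auto
      then show ?thesis using C by simp
    qed
    show "norm (FD X z v) \<le> C / (2 * (1/2)) * norm v" if "z \<in> ball 0 (1/2)" for z v
    proof -
      have "norm (FD X z v) \<le> K * norm v" using K(2) that by auto
      also have "\<dots> \<le> C * norm v" using C by (intro mult_right_mono) auto
      finally show ?thesis by simp
    qed
  qed (use X in auto)
  then show ?thesis using b by (intro exI[of _ "max K b"]) auto
qed

section \<open>Words of commuting flows\<close>

lemma cflow_cholo:
  assumes X: "flow_box X R C" and s: "cholo U s" and z: "cholo U z"
    and bd: "\<And>x. x \<in> U \<Longrightarrow> norm (z x) + C * norm (s x) < R"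
  shows "cholo U (\<lambda>x. cflow X (s x) (z x))"
  using cholo_compose[OF cholo_Pair[OF s z] flow_box.cholo_Phi[OF X]] bd
  by (simp add: flow_box.fdom_def[OF X])

locale commuting_flows =
  fixes L :: "nat \<Rightarrow> complex ^ 'n \<Rightarrow> complex ^ 'n" and m :: nat and R C :: real
  assumes C_pos: "0 < C"
    and fb: "\<And>j. j < m \<Longrightarrow> flow_box (L j) R C"
    and comm: "\<And>j l z. j < m \<Longrightarrow> l < m \<Longrightarrow> z \<in> polydisc 1 \<Longrightarrow> commute_at (L j) (L l) z"
begin

abbreviation (input) sz :: "nat \<Rightarrow> (nat \<Rightarrow> complex) \<Rightarrow> real" where
  "sz k s \<equiv> (\<Sum>j<k. norm (s j))"

lemma sz_nonneg: "0 \<le> C * sz k s"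
  using C_pos by (intro mult_nonneg_nonneg sum_nonneg) auto

lemma mflow_dist:
  "k \<le> m \<Longrightarrow> norm z + C * sz k s < R \<Longrightarrow> norm (mflow L k s z - z) \<le> C * sz k s"
proof (induction k)
  case (Suc k)
  let ?w = "mflow L k s z"
  have bd: "norm z + C * sz k s + C * norm (s k) < R"
    using Suc.prems(2) by (simp add: algebra_simps)
  then have w: "norm (?w - z) \<le> C * sz k s"
    using Suc C_pos by (smt (verit) Suc_leD mult_nonneg_nonneg norm_ge_zero)
  then have "norm ?w + C * norm (s k) < R"
    using bd norm_triangle_sub[of ?w z] by simp
  then have "norm (cflow (L k) (s k) ?w - ?w) \<le> C * norm (s k)"
    using flow_box.cflow_dist[OF fb, of k "s k" ?w] Suc.prems(1)
    by (simp add: flow_box.fdom_def[OF fb[of k]])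
  then show ?case
    using w norm_triangle_ineq[of "cflow (L k) (s k) ?w - ?w" "?w - z"] by (simp add: algebra_simps)
qed simp

lemma mflow_norm:
  "k \<le> m \<Longrightarrow> norm z + C * sz k s < R \<Longrightarrow> norm (mflow L k s z) \<le> norm z + C * sz k s"
  using mflow_dist[of k z s] norm_triangle_sub[of "mflow L k s z" z] by simp

lemma mflow_cholo:
  assumes Z: "cholo U Z" and P: "\<And>j. j < k \<Longrightarrow> cholo U (\<lambda>x. P x j)"
    and bd: "\<And>x. x \<in> U \<Longrightarrow> norm (Z x) + C * sz k (P x) < R" and k: "k \<le> m"
  shows "cholo U (\<lambda>x. mflow L k (P x) (Z x))"
  using P bd k
proof (induction k)
  case 0
  then show ?case using Z by simp
next
  case (Suc k)
  have bd': "norm (Z x) + C * sz k (P x) + C * norm (P x k) < R" if "x \<in> U" for x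
    using Suc.prems(2)[OF that] by (simp add: algebra_simps)
  have bd'': "norm (Z x) + C * sz k (P x) < R" if "x \<in> U" for x
    using bd'[OF that] mult_nonneg_nonneg[OF less_imp_le[OF C_pos] norm_ge_zero[of "P x k"]] by linarith
  have "cholo U (\<lambda>x. mflow L k (P x) (Z x))"
    by (rule Suc.IH) (use Suc.prems bd'' in auto)
  moreover have "norm (mflow L k (P x) (Z x)) + C * norm (P x k) < R" if "x \<in> U" for x
    using mflow_norm[OF _ bd''[OF that]] bd'[OF that] Suc.prems(3) by simp
  moreover have "k < m" "cholo U (\<lambda>x. P x k)" using Suc.prems by auto
  ultimately show ?case
    unfolding mflow.simps by (rule_tac cflow_cholo[OF fb])
qed

lemma mflow_zero: "k \<le> m \<Longrightarrow> norm z < R \<Longrightarrow> (\<And>j. j < k \<Longrightarrow> s j = 0) \<Longrightarrow> mflow L k s z = z"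
  by (induction k) (auto simp: flow_box.cflow_0[OF fb])

lemma mflow_cflow_commute:
  assumes j: "j < m"
  shows "k \<le> m \<Longrightarrow> norm z + C * (sz k s + norm u) < R \<Longrightarrow>
    mflow L k s (cflow (L j) u z) = cflow (L j) u (mflow L k s z)"
proof (induction k)
  case (Suc k)
  have bd: "norm z + C * sz k s + C * norm u + C * norm (s k) < R"
    using Suc.prems(2) by (simp add: algebra_simps)
  have nn: "0 \<le> C * norm (s k)" "0 \<le> C * norm u" using C_pos by auto
  have w: "norm (mflow L k s z) \<le> norm z + C * sz k s"
    by (rule mflow_norm) (use bd nn Suc.prems in auto)
  have "mflow L (Suc k) s (cflow (L j) u z) = cflow (L k) (s k) (cflow (L j) u (mflow L k s z))"
    using Suc bd nn by (simp add: algebra_simps)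
  also have "\<dots> = cflow (L j) u (cflow (L k) (s k) (mflow L k s z))"
    by (rule cflow_commute[OF fb fb comm]) (use j Suc.prems w bd in \<open>auto simp: algebra_simps\<close>)
  finally show ?case by simp
qed simp

lemma mflow_upd_irrelevant: "k \<le> j \<Longrightarrow> mflow L k (s(j := w)) z = mflow L k s z"
  by (induction k) auto

text \<open>By commutativity an increment of any one time of the block can be moved in front of the
  whole block. Thus every partial derivative within a block is the value of the field at the initial
  point, pushed forward by one common map.\<close>

lemma mflow_upd:
  assumes "j < k" "k \<le> m" "norm z + C * (sz k s + norm h) < R"
  shows "mflow L k (s(j := s j + h)) z = mflow L k s (cflow (L j) h z)"
  using assms
proof (induction k)
  case (Suc k)
  have bd: "norm z + C * sz k s + C * norm h + C * norm (s k) < R"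
    using Suc.prems(3) by (simp add: algebra_simps)
  have nn: "0 \<le> C * norm (s k)" "0 \<le> C * norm h" using C_pos by auto
  show ?case
  proof (cases "j = k")
    case True
    have w: "norm (mflow L k s z) \<le> norm z + C * sz k s"
      by (rule mflow_norm) (use bd nn Suc.prems in auto)
    have "mflow L (Suc k) (s(j := s j + h)) z = cflow (L k) (s k + h) (mflow L k s z)"
      using True by (simp add: mflow_upd_irrelevant)
    also have "\<dots> = cflow (L k) (s k) (cflow (L k) h (mflow L k s z))"
      by (rule flow_box.cflow_add[OF fb, symmetric])
        (use Suc.prems w bd in \<open>auto simp: algebra_simps\<close>)
    also have "cflow (L k) h (mflow L k s z) = mflow L k s (cflow (L k) h z)"
      by (rule mflow_cflow_commute[symmetric])
        (use Suc.prems bd nn in \<open>auto simp: algebra_simps\<close>)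
    finally show ?thesis using True by simp
  next
    case False
    then show ?thesis
      using Suc bd nn by (auto simp: algebra_simps)
  qed
qed simp

text \<open>The inverse runs the fields in the same order, not in the opposite one, as prescribed by
  the notation for reversed words. This is correct because each flow can be moved past the remaining
  ones; the factor 2 in the bound pays for the way out and back.\<close>

lemma mflow_minus:
  "k \<le> m \<Longrightarrow> norm z + 2 * C * sz k s < R \<Longrightarrow> mflow L k (\<lambda>j. - s j) (mflow L k s z) = z"
proof (induction k)
  case (Suc k)
  have bd: "norm z + 2 * (C * sz k s) + 2 * (C * norm (s k)) < R"
    using Suc.prems(2) by (simp add: algebra_simps)
  have nn: "0 \<le> C * norm (s k)" "0 \<le> C * sz k s" using C_pos sz_nonneg[of s k] by auto
  have w: "norm (mflow L k s z) \<le> norm z + C * sz k s"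
    by (rule mflow_norm) (use bd nn Suc.prems in auto)
  have IH: "mflow L k (\<lambda>j. - s j) (mflow L k s z) = z"
    by (rule Suc.IH) (use Suc.prems bd nn in auto)
  have "mflow L k (\<lambda>j. - s j) (cflow (L k) (s k) (mflow L k s z)) =
      cflow (L k) (s k) (mflow L k (\<lambda>j. - s j) (mflow L k s z))"
    by (rule mflow_cflow_commute) (use Suc.prems w bd nn in \<open>auto simp: algebra_simps\<close>)
  then show ?case
    using flow_box.cflow_minus[OF fb, of k z "s k"] Suc.prems bd nn IH
    by (simp add: algebra_simps)
qed simp

end

lemma mflow_cong: "(\<And>j. j < k \<Longrightarrow> s j = s' j) \<Longrightarrow> mflow L k s z = mflow L k s' z"
  by (induction k) auto

lemma flowk_cong:
  assumes "\<And>i. i < k \<Longrightarrow> seq i = seq' i" "\<And>i j. i < k \<Longrightarrow> j < m \<Longrightarrow> t i j = t' i j"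
  shows "flowk S m seq k t z = flowk S m seq' k t' z"
  using assms
proof (induction k)
  case (Suc k)
  then have "flowk S m seq k t z = flowk S m seq' k t' z" by auto
  then show ?case
    using Suc.prems by (auto intro!: mflow_cong)
qed simp

lemma flowk_add:
  "flowk S m seq (k + l) t z = flowk S m (\<lambda>i. seq (k + i)) l (\<lambda>i. t (k + i)) (flowk S m seq k t z)"
  by (induction l) auto

lemma flowk_front:
  "flowk S m seq (Suc k) t z =
    flowk S m (\<lambda>i. seq (Suc i)) k (\<lambda>i. t (Suc i)) (mflow (S (seq 0)) m (t 0) z)"
  using flowk_add[of S m seq 1 k t z] by simp

locale flow_system =
  fixes S :: "nat \<Rightarrow> nat \<Rightarrow> complex ^ 'n \<Rightarrow> complex ^ 'n" and a m :: nat and R C :: real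
  assumes R_pos: "0 < R" and C_pos: "0 < C"
    and fb: "\<And>\<alpha> j. \<alpha> < a \<Longrightarrow> j < m \<Longrightarrow> flow_box (S \<alpha> j) R C"
    and comm: "\<And>\<alpha> j l z. \<alpha> < a \<Longrightarrow> j < m \<Longrightarrow> l < m \<Longrightarrow> z \<in> polydisc 1 \<Longrightarrow> commute_at (S \<alpha> j) (S \<alpha> l) z"
begin

lemma commuting: "\<alpha> < a \<Longrightarrow> commuting_flows (S \<alpha>) m R C"
  unfolding commuting_flows_def using C_pos fb comm by blast

definition word :: "(nat \<Rightarrow> nat) \<Rightarrow> nat \<Rightarrow> bool" where
  "word seq k \<longleftrightarrow> (\<forall>i<k. seq i < a)"

lemma wordD: "word seq k \<Longrightarrow> i < k \<Longrightarrow> seq i < a"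
  by (simp add: word_def)

lemma word_mono: "word seq k \<Longrightarrow> l \<le> k \<Longrightarrow> word seq l"
  by (simp add: word_def)

text \<open>A bound for the distance travelled along the word, as no field is faster than C. Domains
  of definition are all controlled by requiring |z| plus this quantity to stay below R.\<close>

definition tz :: "nat \<Rightarrow> (nat \<Rightarrow> nat \<Rightarrow> complex) \<Rightarrow> real" where
  "tz k t = C * (\<Sum>i<k. \<Sum>j<m. norm (t i j))"

lemma tz_Suc: "tz (Suc k) t = tz k t + C * (\<Sum>j<m. norm (t k j))"
  by (simp add: tz_def distrib_left)

lemma tz_0 [simp]: "tz 0 t = 0"
  by (simp add: tz_def)

lemma last_nonneg: "0 \<le> C * (\<Sum>j<m. norm (t k j))"
  using C_pos by (intro mult_nonneg_nonneg sum_nonneg) auto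

lemma tz_nonneg: "0 \<le> tz k t"
  unfolding tz_def using C_pos by (intro mult_nonneg_nonneg sum_nonneg) auto

lemma flowk_dist:
  "word seq k \<Longrightarrow> norm z + tz k t < R \<Longrightarrow> norm (flowk S m seq k t z - z) \<le> tz k t"
proof (induction k)
  case (Suc k)
  interpret L: commuting_flows "S (seq k)" m R C
    by (rule commuting) (use Suc.prems in \<open>simp add: word_def\<close>)
  let ?w = "flowk S m seq k t z"
  have w: "norm (?w - z) \<le> tz k t"
    by (rule Suc.IH) (use Suc.prems last_nonneg[of t k] in \<open>auto simp: word_def tz_Suc\<close>)
  then have "norm ?w + C * (\<Sum>j<m. norm (t k j)) < R"
    using Suc.prems(2) norm_triangle_sub[of ?w z] by (simp add: tz_Suc)
  then have "norm (mflow (S (seq k)) m (t k) ?w - ?w) \<le> C * (\<Sum>j<m. norm (t k j))"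
    by (intro L.mflow_dist) auto
  then show ?case
    using w norm_triangle_ineq[of "mflow (S (seq k)) m (t k) ?w - ?w" "?w - z"] by (simp add: tz_Suc)
qed simp

lemma flowk_norm:
  "word seq k \<Longrightarrow> norm z + tz k t < R \<Longrightarrow> norm (flowk S m seq k t z) \<le> norm z + tz k t"
  using flowk_dist[of seq k z t] norm_triangle_sub[of "flowk S m seq k t z" z] by simp

lemma flowk_cholo:
  assumes Z: "cholo U Z" and P: "\<And>i j. i < k \<Longrightarrow> j < m \<Longrightarrow> cholo U (\<lambda>x. P x i j)"
    and bd: "\<And>x. x \<in> U \<Longrightarrow> norm (Z x) + tz k (P x) < R" and w: "word seq k"
  shows "cholo U (\<lambda>x. flowk S m seq k (P x) (Z x))"
  using P bd w
proof (induction k)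
  case 0
  then show ?case using Z by simp
next
  case (Suc k)
  interpret L: commuting_flows "S (seq k)" m R C
    by (rule commuting) (use Suc.prems in \<open>simp add: word_def\<close>)
  have bd: "norm (Z x) + tz k (P x) + C * (\<Sum>j<m. norm (P x k j)) < R" if "x \<in> U" for x
    using Suc.prems(2)[OF that] by (simp add: tz_Suc)
  then have bd': "norm (Z x) + tz k (P x) < R" if "x \<in> U" for x
    using that last_nonneg[of "P x" k] by (meson add_increasing2 le_less_trans order_refl)
  have wk: "word seq k" using Suc.prems by (simp add: word_def)
  have "cholo U (\<lambda>x. flowk S m seq k (P x) (Z x))"
    by (rule Suc.IH) (use Suc.prems bd' wk in auto)
  moreover have "norm (flowk S m seq k (P x) (Z x)) + C * (\<Sum>j<m. norm (P x k j)) < R" if "x \<in> U" for x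
    using flowk_norm[OF wk bd'[OF that]] bd[OF that] by simp
  ultimately show ?case
    unfolding flowk.simps by (intro L.mflow_cholo) (use Suc.prems in auto)
qed

lemma flowk_zero: "word seq k \<Longrightarrow> norm z < R \<Longrightarrow> (\<And>i j. i < k \<Longrightarrow> j < m \<Longrightarrow> t i j = 0) \<Longrightarrow> flowk S m seq k t z = z"
  by (induction k) (auto simp: word_def intro!: commuting_flows.mflow_zero[OF commuting])

text \<open>The last block of the word is the first block of its reversal, so the two meet in the
  middle and cancel; the rest is the same statement for the shorter word.\<close>

lemma flowk_rev:
  "word seq k \<Longrightarrow> norm z + 2 * tz k t < R \<Longrightarrow>
    flowk S m (rev_seq seq k) k (rev_par t k) (flowk S m seq k t z) = z"
proof (induction k)
  case (Suc k)
  interpret L: commuting_flows "S (seq k)" m R C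
    by (rule commuting) (use Suc.prems in \<open>simp add: word_def\<close>)
  have wk: "word seq k" using Suc.prems by (simp add: word_def)
  let ?w = "flowk S m seq k t z"
  have bd: "norm z + 2 * tz k t + 2 * (C * (\<Sum>j<m. norm (t k j))) < R"
    using Suc.prems(2) by (simp add: tz_Suc)
  have nw: "norm ?w \<le> norm z + tz k t"
    by (rule flowk_norm[OF wk]) (use bd last_nonneg[of t k] tz_nonneg[of k t] in linarith)
  have "flowk S m (rev_seq seq (Suc k)) (Suc k) (rev_par t (Suc k)) (flowk S m seq (Suc k) t z)
      = flowk S m (\<lambda>i. rev_seq seq (Suc k) (Suc i)) k (\<lambda>i. rev_par t (Suc k) (Suc i))
        (mflow (S (seq k)) m (\<lambda>j. - t k j) (mflow (S (seq k)) m (t k) ?w))"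
    by (subst flowk_front) (simp add: rev_seq_def rev_par_def)
  also have "mflow (S (seq k)) m (\<lambda>j. - t k j) (mflow (S (seq k)) m (t k) ?w) = ?w"
    by (rule L.mflow_minus) (use nw bd tz_nonneg[of k t] in auto)
  also have "flowk S m (\<lambda>i. rev_seq seq (Suc k) (Suc i)) k (\<lambda>i. rev_par t (Suc k) (Suc i)) ?w =
      flowk S m (rev_seq seq k) k (rev_par t k) ?w"
    by (rule flowk_cong) (auto simp: rev_seq_def rev_par_def)
  also have "\<dots> = z"
    by (rule Suc.IH[OF wk]) (use bd last_nonneg[of t k] in linarith)
  finally show ?case .
qed simp

end

lemma cpartialI:
  fixes F :: "(nat \<Rightarrow> nat \<Rightarrow> complex) \<Rightarrow> complex ^ 'n"
  assumes "((\<lambda>w. F (pupd t i j w)) has_derivative (\<lambda>h. h *\<^sub>C v)) (at (t i j))"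
  shows "cpartial F t i j = v"
  unfolding cpartial_def
proof (rule the_equality)
  show "((\<lambda>w. F (pupd t i j w)) has_derivative (\<lambda>h. h *s v)) (at (t i j))"
    using assms by (simp add: cscale_eq_vector_scalar_mult)
  fix v' assume "((\<lambda>w. F (pupd t i j w)) has_derivative (\<lambda>h. h *s v')) (at (t i j))"
  from has_derivative_unique[OF this assms] have "1 *s v' = 1 *\<^sub>C v" by (rule fun_cong)
  then show "v' = v" by simp
qed

lemma cpartial_eqI:
  fixes F :: "(nat \<Rightarrow> nat \<Rightarrow> complex) \<Rightarrow> complex ^ 'n"
  assumes G: "cholo U G" "open U" "t i j \<in> U" and eq: "\<And>w. w \<in> U \<Longrightarrow> F (pupd t i j w) = G w"
  shows "cpartial F t i j = FD G (t i j) 1"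
    and "((\<lambda>w. F (pupd t i j w)) has_derivative (\<lambda>h. h *\<^sub>C cpartial F t i j)) (at (t i j))"
proof -
  have eq1: "FD G (t i j) h = h *\<^sub>C FD G (t i j) 1" for h
    using cholo_FD_cscale[OF G(1,3), of h 1] by simp
  have "(G has_derivative (\<lambda>h. h *\<^sub>C FD G (t i j) 1)) (at (t i j))"
    by (rule has_derivative_eq_rhs[OF cholo_has_derivative[OF G(1,3)]], rule ext, rule eq1)
  then have d: "((\<lambda>w. F (pupd t i j w)) has_derivative (\<lambda>h. h *\<^sub>C FD G (t i j) 1)) (at (t i j))"
    by (rule has_derivative_transform_within_open[OF _ G(2,3)]) (simp add: eq)
  then show *: "cpartial F t i j = FD G (t i j) 1" by (rule cpartialI)
  show "((\<lambda>w. F (pupd t i j w)) has_derivative (\<lambda>h. h *\<^sub>C cpartial F t i j)) (at (t i j))"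
    using d by (simp only: *)
qed

section \<open>Rank of holomorphic maps\<close>

lemma clinear_cholo:
  assumes "\<And>x y. f (x + y) = f x + f y" "\<And>c x. f (c *\<^sub>C x) = c *\<^sub>C f x"
  shows "cholo U f" "(f has_derivative f) (at x)"
proof -
  have "linear f"
    by (rule linearI) (auto simp: assms simp flip: cscale_of_real)
  then have bl: "bounded_linear f" by (simp add: linear_conv_bounded_linear)
  show "cholo U f" by (rule cholo_linear[OF bl assms(2)])
  show "(f has_derivative f) (at x)" by (rule bounded_linear_imp_has_derivative[OF bl])
qed

lemma vec_linear_FD:
  fixes F :: "complex ^ 'q \<Rightarrow> complex ^ 'n"
  assumes "cholo U F" "x \<in> U"
  shows "Vector_Spaces.linear (*s) (*s) (FD F x)"
  unfolding Vector_Spaces.linear_iff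
  using cholo_FD_cscale[OF assms] bounded_linear.linear[OF cholo_bounded_linear[OF assms], THEN linear_add]
  by (auto simp: cscale_eq_vector_scalar_mult vec.vector_space_axioms)

text \<open>Linear independence of a family also excludes repeated vectors, which independence of
  its image set cannot see; both are needed to count dimensions.\<close>

lemma independent_family_on:
  fixes f :: "'i \<Rightarrow> complex ^ 'n"
  assumes I: "finite I" and c: "\<And>c. (\<Sum>i\<in>I. c i *s f i) = 0 \<Longrightarrow> \<forall>i\<in>I. c i = 0"
  shows "inj_on f I" "vec.independent (f ` I)"
proof -
  show inj: "inj_on f I"
  proof (rule inj_onI, rule ccontr)
    fix i j assume ij: "i \<in> I" "j \<in> I" "f i = f j" "i \<noteq> j"
    let ?c = "\<lambda>k. (if k = i then 1 else 0) - (if k = j then 1 else 0) :: complex"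
    have "(\<Sum>k\<in>I. ?c k *s f k) = (\<Sum>k\<in>I. (if k = i then f i else 0) - (if k = j then f j else 0))"
      by (rule sum.cong) (auto simp: vector_sub_rdistrib)
    also have "\<dots> = 0" using ij I by (simp add: sum_subtractf)
    finally have "?c i = 0" using c[of ?c] ij(1) by blast
    then show False using ij by simp
  qed
  show "vec.independent (f ` I)"
  proof
    assume "vec.dependent (f ` I)"
    then obtain u v where u: "v \<in> f ` I" "u v \<noteq> 0" "(\<Sum>v\<in>f ` I. u v *s v) = 0"
      using I by (auto simp: vec.dependent_finite)
    have "(\<Sum>i\<in>I. u (f i) *s f i) = 0"
      using u(3) by (simp add: sum.reindex[OF inj])
    then show False using c[of "\<lambda>i. u (f i)"] u by auto
  qed
qed

lemma independent_family_iff: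
  fixes f :: "'i::finite \<Rightarrow> complex ^ 'n"
  shows "(\<forall>c. (\<Sum>i\<in>UNIV. c i *s f i) = 0 \<longrightarrow> (\<forall>i. c i = 0)) \<longleftrightarrow> inj f \<and> vec.independent (range f)"
proof (intro iffI allI impI)
  assume c: "\<forall>c. (\<Sum>i\<in>UNIV. c i *s f i) = 0 \<longrightarrow> (\<forall>i. c i = 0)"
  then show "inj f \<and> vec.independent (range f)"
    by (intro conjI independent_family_on[OF finite_class.finite_UNIV]) auto
next
  fix c i assume f: "inj f \<and> vec.independent (range f)" and c: "(\<Sum>i\<in>UNIV. c i *s f i) = 0"
  have "(\<Sum>v\<in>range f. c (inv f v) *s v) = 0"
    using f c by (simp add: sum.reindex)
  moreover have "\<forall>u. (\<Sum>v\<in>range f. u v *s v) = 0 \<longrightarrow> (\<forall>v\<in>range f. u v = 0)"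
    using f vec.dependent_finite[of "range f"] by auto
  ultimately have "\<forall>v\<in>range f. c (inv f v) = 0" by (elim allE[where x = "\<lambda>v. c (inv f v)"]) simp
  then show "c i = 0" using f by simp
qed

section \<open>Determinants that detect the rank\<close>

definition minor_col :: "'n set \<Rightarrow> ('n \<Rightarrow> 'q) \<Rightarrow> ('n \<Rightarrow> complex ^ 'n) \<Rightarrow> (complex ^ 'q \<Rightarrow> complex ^ 'n)
    \<Rightarrow> complex ^ 'q \<Rightarrow> 'n \<Rightarrow> complex ^ ('n::finite)" where
  "minor_col J \<sigma> b G x i = (if i \<in> J then FD G x (axis (\<sigma> i) 1) else b i)"

text \<open>Instead of selecting rows, the columns outside J are filled with constant vectors b that
  complete the chosen partial derivatives to a basis. The determinant is then square of full size,
  holomorphic in x, and nonzero only where the rank is at least \<open>card J\<close>.\<close>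

definition minor :: "'n set \<Rightarrow> ('n \<Rightarrow> 'q) \<Rightarrow> ('n \<Rightarrow> complex ^ 'n) \<Rightarrow> (complex ^ 'q \<Rightarrow> complex ^ 'n)
    \<Rightarrow> complex ^ 'q \<Rightarrow> complex" where
  "minor J \<sigma> b G x = det (\<chi> r c. minor_col J \<sigma> b G x c $ r)"

lemma minor_nonzero_iff:
  "minor J \<sigma> b G x \<noteq> 0 \<longleftrightarrow>
    inj (minor_col J \<sigma> b G x) \<and> vec.independent (range (minor_col J \<sigma> b G x))"
proof -
  let ?A = "\<chi> r c. minor_col J \<sigma> b G x c $ r"
  have "column i ?A = minor_col J \<sigma> b G x i" for i
    by (simp add: column_def vec_eq_iff)
  then show ?thesis
    unfolding minor_def invertible_det_nz[symmetric] invertible_left_inverse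
      matrix_left_invertible_independent_columns
    by (simp add: independent_family_iff)
qed

lemma minor_rank:
  assumes "minor J \<sigma> b G x \<noteq> 0"
  shows "card J \<le> vec.dim (range (FD G x))"
proof -
  let ?f = "minor_col J \<sigma> b G x"
  have f: "inj ?f" "vec.independent (range ?f)"
    using assms by (auto simp: minor_nonzero_iff)
  have "card J = card (?f ` J)" using f(1) by (simp add: card_image inj_on_subset)
  also have "\<dots> \<le> vec.dim (range (FD G x))"
  proof (rule vec.independent_card_le_dim)
    show "?f ` J \<subseteq> range (FD G x)" by (auto simp: minor_col_def)
    show "vec.independent (?f ` J)" by (rule vec.independent_mono[OF f(2)]) auto
  qed
  finally show ?thesis .
qed

lemma cholo_mult: "cholo U f \<Longrightarrow> cholo U g \<Longrightarrow> cholo U (\<lambda>x. f x * g x :: complex)"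
  using cholo_cscale[of U f g] by simp

lemma cholo_prod: "(\<And>i. i \<in> I \<Longrightarrow> cholo U (F i)) \<Longrightarrow> cholo U (\<lambda>x. \<Prod>i\<in>I. F i x :: complex)"
  by (induction I rule: infinite_finite_induct) (auto intro!: cholo_mult)

lemma cholo_vec_nth: "cholo U F \<Longrightarrow> cholo U (\<lambda>x. F x $ i)"
  by (rule cholo_compose[where V = UNIV, OF _ cholo_nth]) auto

lemma cholo_minor:
  assumes "open W" "cholo W G"
  shows "cholo W (minor J \<sigma> b G)"
proof -
  have "cholo W (\<lambda>x. minor_col J \<sigma> b G x c $ r)" for c r
    unfolding minor_col_def by (cases "c \<in> J") (auto intro!: cholo_vec_nth cholo_FD assms)
  then show ?thesis
    unfolding minor_def[abs_def] det_def
    by (auto intro!: cholo_sum cholo_mult cholo_prod)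
qed

lemma axis_expansion: "(\<Sum>q\<in>UNIV. x $ q *s axis q 1) = (x :: complex ^ 'q)"
  by (simp add: vec_eq_iff axis_def if_distrib cong: if_cong)

lemma range_FD_eq_span:
  fixes G :: "complex ^ 'q \<Rightarrow> complex ^ 'n"
  assumes "cholo W G" "x \<in> W"
  shows "range (FD G x) = vec.span (range (\<lambda>q. FD G x (axis q 1)))"
proof -
  interpret D: Vector_Spaces.linear "(*s)" "(*s)" "FD G x" by (rule vec_linear_FD[OF assms])
  have sp: "vec.span (range (\<lambda>q. axis q 1)) = (UNIV :: (complex ^ 'q) set)"
  proof -
    have "v \<in> vec.span (range (\<lambda>q. axis q 1))" for v :: "complex ^ 'q"
      by (subst axis_expansion[symmetric]) (intro vec.span_sum vec.span_scale vec.span_base rangeI)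
    then show ?thesis by auto
  qed
  have "vec.span (range (\<lambda>q. FD G x (axis q 1))) = vec.span (FD G x ` range (\<lambda>q. axis q 1))"
    by (simp add: image_image)
  also have "\<dots> = FD G x ` UNIV"
    by (simp only: D.span_image sp)
  finally show ?thesis by simp
qed

text \<open>Choose e independent partial derivatives, extend them to a basis of C^n and number the
  basis by the coordinates; J collects the numbers of the chosen partial derivatives, and \<sigma>
  records which parameter each one came from.\<close>

lemma minor_exists:
  fixes G :: "complex ^ 'q \<Rightarrow> complex ^ 'n"
  assumes G: "cholo W G" and x: "x \<in> W" and e: "e \<le> vec.dim (range (FD G x))"
  obtains J \<sigma> b where "card J = e" "inj_on \<sigma> J" "minor J \<sigma> b G x \<noteq> 0"
proof -
  let ?c = "\<lambda>q. FD G x (axis q 1)"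
  obtain B where B: "B \<subseteq> range ?c" "vec.independent B" "range ?c \<subseteq> vec.span B" "card B = vec.dim (range ?c)"
    by (rule vec.basis_exists)
  have "e \<le> card B" using e B(4) by (simp add: range_FD_eq_span[OF G x])
  then obtain B' where B': "B' \<subseteq> B" "card B' = e" "finite B'" by (rule obtain_subset_with_card_n)
  have indB': "vec.independent B'" by (rule vec.independent_mono[OF B(2) B'(1)])
  obtain B'' where B'': "B' \<subseteq> B''" "vec.independent B''" "UNIV \<subseteq> vec.span B''"
    by (rule vec.maximal_independent_subset_extend[OF subset_UNIV indB']) auto
  have fin: "finite B''" using B''(2) by (rule vec.finiteI_independent)
  have "vec.span B'' = vec.span UNIV" using B''(3) by auto
  then have "vec.dim (UNIV :: (complex ^ 'n) set) = card B''"
    by (rule vec.dim_eq_card[OF _ B''(2)])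
  then have "card B'' = CARD('n)" by (simp only: vec_dim_card)
  then obtain f where f: "bij_betw f (UNIV :: 'n set) B''"
    using finite_same_card_bij[OF finite_class.finite_UNIV fin] by metis
  define J where "J = f -` B'"
  have "\<forall>v\<in>B'. \<exists>q. v = ?c q" using B(1) B'(1) by auto
  then obtain \<tau> where \<tau>: "\<And>v. v \<in> B' \<Longrightarrow> v = ?c (\<tau> v)" by metis
  have col: "minor_col J (\<tau> \<circ> f) f G x i = f i" for i
    using \<tau>[of "f i"] by (simp add: minor_col_def J_def)
  have col': "minor_col J (\<tau> \<circ> f) f G x = f" by (rule ext) (rule col)
  have injf: "inj f" and ranf: "range f = B''" using f by (auto simp: bij_betw_def)
  show ?thesis
  proof (rule that[of J "\<tau> \<circ> f" f])
    have "f ` J = B'" using B''(1) ranf unfolding J_def by auto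
    then show "card J = e" using B'(2) card_image[OF inj_on_subset[OF injf subset_UNIV[of J]]] by simp
    show "inj_on (\<tau> \<circ> f) J"
    proof (rule inj_onI)
      fix i j assume "i \<in> J" "j \<in> J" "(\<tau> \<circ> f) i = (\<tau> \<circ> f) j"
      then have "f i = f j" using \<tau>[of "f i"] \<tau>[of "f j"] by (simp add: J_def)
      then show "i = j" using injf by (simp add: inj_eq)
    qed
    show "minor J (\<tau> \<circ> f) f G x \<noteq> 0"
      unfolding minor_nonzero_iff by (simp add: col' injf ranf B''(2))
  qed
qed

text \<open>A minor that is nonzero at x0 is followed along the complex line from x1 (c = 0) to x0
  (c = 1). Convexity of W makes its trace on that line connected, so a zero of the minor at x1 is
  isolated and nonzero values occur arbitrarily near.\<close>

lemma rank_generic: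
  fixes G :: "complex ^ 'q \<Rightarrow> complex ^ 'n"
  assumes W: "open W" "convex W" and G: "cholo W G" and x0: "x0 \<in> W" and e: "e \<le> vec.dim (range (FD G x0))"
    and x1: "x1 \<in> W" and r: "r > 0"
  shows "\<exists>x\<in>W \<inter> ball x1 r. e \<le> vec.dim (range (FD G x))"
proof -
  obtain J \<sigma> b where J: "card J = e" "inj_on \<sigma> J" "minor J \<sigma> b G x0 \<noteq> 0"
    by (rule minor_exists[OF G x0 e])
  let ?l = "\<lambda>c::complex. x1 + c *\<^sub>C (x0 - x1)"
  define V where "V = ?l -` W"
  have l: "cholo V ?l" by (intro cholo_add cholo_cscale cholo_const cholo_ident)
  have contl: "continuous_on UNIV ?l" by (intro continuous_intros)
  have V: "open V" unfolding V_def by (rule open_vimage[OF W(1) contl])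
  have "convex V"
  proof (rule convexI)
    fix c d :: complex and u v :: real
    assume cd: "c \<in> V" "d \<in> V" and uv: "0 \<le> u" "0 \<le> v" "u + v = 1"
    have "?l (u *\<^sub>R c + v *\<^sub>R d) = u *\<^sub>R ?l c + v *\<^sub>R ?l d"
    proof -
      have "u *\<^sub>R ?l c + v *\<^sub>R ?l d = (u + v) *\<^sub>R x1 + (u *\<^sub>R c + v *\<^sub>R d) *\<^sub>C (x0 - x1)"
        by (simp add: scaleR_add_right scaleR_add_left cscale_add_left
            bounded_bilinear.scaleR_left[OF bounded_bilinear_cscale])
      then show ?thesis using uv by simp
    qed
    moreover have "u *\<^sub>R ?l c + v *\<^sub>R ?l d \<in> W"
      using cd uv W(2) by (intro convexD) (auto simp: V_def)
    ultimately show "u *\<^sub>R c + v *\<^sub>R d \<in> V" by (simp add: V_def)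
  qed
  then have "connected V" by (rule convex_connected)
  have hol: "(\<lambda>c. minor J \<sigma> b G (?l c)) holomorphic_on V"
    by (intro cholo_imp_holomorphic_on cholo_compose[OF l cholo_minor[OF W(1) G]]) (simp add: V_def)
  have 01: "0 \<in> V" "1 \<in> V" using x0 x1 by (auto simp: V_def)
  obtain d where d: "d > 0" "\<forall>c. dist c 0 < d \<longrightarrow> dist (?l c) (?l 0) < r"
  proof -
    have "isCont ?l 0" using contl by (simp add: continuous_on_eq_continuous_at)
    then show ?thesis using that r unfolding continuous_at_eps_delta by blast
  qed
  have "\<exists>c\<in>V \<inter> ball 0 d. minor J \<sigma> b G (?l c) \<noteq> 0"
  proof (cases "minor J \<sigma> b G (?l 0) = 0")
    case True
    obtain s where s: "0 < s" "ball 0 s \<subseteq> V" "\<And>z. z \<in> ball 0 s - {0} \<Longrightarrow> minor J \<sigma> b G (?l z) \<noteq> 0"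
      by (rule isolated_zeros[OF hol V \<open>connected V\<close> 01(1) True 01(2)]) (use J in auto)
    let ?c = "of_real (min s d / 2) :: complex"
    have "?c \<in> ball 0 s - {0}" "?c \<in> ball 0 d" using s d by auto
    then show ?thesis using s by blast
  next
    case False
    then show ?thesis using 01 d by (intro bexI[of _ 0]) simp_all
  qed
  then obtain c where c: "c \<in> V" "dist c 0 < d" "minor J \<sigma> b G (?l c) \<noteq> 0" by auto
  have "?l c \<in> W \<inter> ball x1 r" using c d by (auto simp: V_def dist_commute)
  then show ?thesis using minor_rank[OF c(3)] J(1) by blast
qed

lemma rank_lower_open:
  fixes G :: "complex ^ 'q \<Rightarrow> complex ^ 'n"
  assumes W: "open W" and G: "cholo W G" and x0: "x0 \<in> W" and e: "e \<le> vec.dim (range (FD G x0))"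
  shows "\<exists>r>0. ball x0 r \<subseteq> W \<and> (\<forall>x\<in>ball x0 r. e \<le> vec.dim (range (FD G x)))"
proof -
  obtain J \<sigma> b where J: "card J = e" "inj_on \<sigma> J" "minor J \<sigma> b G x0 \<noteq> 0"
    by (rule minor_exists[OF G x0 e])
  have "open (W \<inter> minor J \<sigma> b G -` (- {0}))"
    by (rule continuous_open_preimage[OF cholo_continuous_on[OF cholo_minor[OF W G]] W]) auto
  then obtain r where "r > 0" "ball x0 r \<subseteq> W \<inter> minor J \<sigma> b G -` (- {0})"
    using x0 J(3) open_contains_ball by (metis IntI ComplI singletonD vimageI)
  then show ?thesis using minor_rank[of J \<sigma> b G] J(1)
    by (intro exI[of _ r]) auto
qed

text \<open>The real inverse function theorem suffices: the derivative of the inverse is the inverse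
  of a complex linear bijection, hence complex linear.\<close>

lemma cholo_inverse_function:
  fixes F :: "complex ^ 'n \<Rightarrow> complex ^ 'n"
  assumes U: "open U" and F: "cholo U F" and x0: "x0 \<in> U" and inj: "inj (FD F x0)"
  obtains U' V g where "open U'" "U' \<subseteq> U" "x0 \<in> U'" "open V" "homeomorphism U' V F g" "cholo V g"
proof -
  let ?D = "\<lambda>x. Blinfun (FD F x)"
  have D: "blinfun_apply (?D x) = FD F x" if "x \<in> U" for x
    using that by (simp add: bounded_linear_Blinfun_apply cholo_bounded_linear[OF F])
  have lin: "linear (FD F x0)" by (rule bounded_linear.linear[OF cholo_bounded_linear[OF F x0]])
  obtain g0 where g0: "linear g0" "g0 \<circ> FD F x0 = id"
    using linear_injective_left_inverse[OF lin inj] by blast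
  have "bounded_linear g0" using g0(1) by (simp add: linear_conv_bounded_linear)
  then have inv: "Blinfun g0 o\<^sub>L ?D x0 = id_blinfun"
    using g0(2) D[OF x0]
    by (intro blinfun_eqI) (simp add: bounded_linear_Blinfun_apply fun_eq_iff)
  show ?thesis
  proof (rule inverse_function_theorem[OF U _ continuous_on_Blinfun_FD[OF U F] x0 inv])
    show "(F has_derivative blinfun_apply (?D x)) (at x)" if "x \<in> U" for x
      using cholo_has_derivative[OF F that] D[OF that] by simp
    fix U' V g g'
    assume a: "open U'" "U' \<subseteq> U" "x0 \<in> U'" "open V" "F x0 \<in> V" "homeomorphism U' V F g"
      and dg: "\<And>y. y \<in> V \<Longrightarrow> (g has_derivative g' y) (at y)"
      and g': "\<And>y. y \<in> V \<Longrightarrow> g' y = inv (blinfun_apply (?D (g y)))"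
      and bij: "\<And>y. y \<in> V \<Longrightarrow> bij (blinfun_apply (?D (g y)))"
    have "cholo V g"
    proof (rule choloI[OF dg])
      fix y c v assume y: "y \<in> V"
      have gy: "g y \<in> U" using a y by (auto simp: homeomorphism_def)
      have b: "bij (FD F (g y))" and e: "g' y = inv (FD F (g y))"
        using bij[OF y] g'[OF y] D[OF gy] by auto
      have fi: "FD F (g y) (inv (FD F (g y)) w) = w" for w
        using b by (simp add: bij_is_surj surj_f_inv_f)
      have "FD F (g y) (c *\<^sub>C inv (FD F (g y)) v) = c *\<^sub>C v"
        by (simp add: cholo_FD_cscale[OF F gy] fi)
      then have "FD F (g y) (inv (FD F (g y)) (c *\<^sub>C v)) = FD F (g y) (c *\<^sub>C inv (FD F (g y)) v)"
        by (simp only: fi)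
      then show "g' y (c *\<^sub>C v) = c *\<^sub>C g' y v"
        unfolding e using b by (meson bij_is_inj injD)
    qed
    then show thesis using a by (intro that) auto
  qed
qed

text \<open>The vectors E j have the unit vectors as J-coordinates, so they are a basis of the at
  most \<open>card J\<close>-dimensional R. R is thus a graph over the J-coordinates, and a vector
  of R is zero once these vanish.\<close>

lemma graph_kernel:
  fixes E :: "'n \<Rightarrow> complex ^ 'n"
  assumes E: "\<And>i j. i \<in> J \<Longrightarrow> j \<in> J \<Longrightarrow> E j $ i = (if i = j then 1 else 0)"
    and R: "E ` J \<subseteq> R" "vec.dim R \<le> card J" and w: "w \<in> R" "\<forall>i\<in>J. w $ i = 0"
  shows "w = 0"
proof -
  have inj: "inj_on E J"
    by (rule inj_onI) (metis E zero_neq_one)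
  have comp: "(\<Sum>v\<in>E ` J. u v *s v) $ i = u (E i)" if i: "i \<in> J" for u i
  proof -
    have "(\<Sum>v\<in>E ` J. u v *s v) $ i = (\<Sum>j\<in>J. u (E j) * E j $ i)"
      by (simp add: sum.reindex[OF inj] sum_component)
    also have "\<dots> = (\<Sum>j\<in>J. if j = i then u (E i) else 0)"
      by (rule sum.cong) (auto simp: E i)
    finally show ?thesis using i by simp
  qed
  have ind: "vec.independent (E ` J)"
  proof
    assume "vec.dependent (E ` J)"
    then obtain u v where u: "v \<in> E ` J" "u v \<noteq> 0" "(\<Sum>v\<in>E ` J. u v *s v) = 0"
      by (auto simp: vec.dependent_finite)
    then show False using comp[of _ u] by auto
  qed
  have "vec.dim (insert w (E ` J)) \<le> card J"
    using vec.dim_subset[of "insert w (E ` J)" R] R w by auto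
  moreover have "vec.dim (E ` J) = card J"
    using vec.dim_eq_card_independent[OF ind] card_image[OF inj] by simp
  ultimately have "w \<in> vec.span (E ` J)"
    by (auto simp: vec.dim_insert split: if_splits)
  then obtain u where u: "w = (\<Sum>v\<in>E ` J. u v *s v)"
    by (auto simp: vec.span_finite)
  then have "u (E i) = 0" if "i \<in> J" for i using comp[OF that, of u] w(2) that by simp
  then show ?thesis unfolding u by (intro sum.neutral) auto
qed

definition coord_plane :: "'n set \<Rightarrow> (complex ^ 'n) set" where
  "coord_plane J = {w. \<forall>i. i \<notin> J \<longrightarrow> w $ i = 0}"

text \<open>The slice of \<open>G\<close> along \<open>card J\<close> independent parameter directions is an immersion, straightened by
  \<open>\<phi>\<close>. Taking the \<open>J\<close>-coordinates of \<open>h = \<phi> \<circ> G\<close> as new parameters, the rank bound forces \<open>h\<close> to be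
  independent of the remaining parameters, so \<open>G\<close> has the same image as its slice.\<close>

lemma constant_rank_image:
  fixes G :: "complex ^ 'q \<Rightarrow> complex ^ 'n"
  assumes W: "open W" and G: "cholo W G" and x0: "x0 \<in> W"
    and e: "e \<le> vec.dim (range (FD G x0))"
    and rk: "\<And>x. x \<in> W \<Longrightarrow> vec.dim (range (FD G x)) \<le> e"
  obtains W' where "open W'" "x0 \<in> W'" "W' \<subseteq> W"
    "\<forall>W''. open W'' \<longrightarrow> W'' \<subseteq> W' \<longrightarrow> csubmanifold (G ` W'') e"
proof -
  obtain J \<sigma> b where J: "card J = e" "inj_on \<sigma> J" "minor J \<sigma> b G x0 \<noteq> 0"
    by (rule minor_exists[OF G x0 e])
  define \<iota> where "\<iota> u = (\<chi> q. if q \<in> \<sigma> ` J then u $ inv_into J \<sigma> q else 0)" for u :: "complex ^ 'n"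
  define \<beta> where "\<beta> u = (\<Sum>i\<in>UNIV. (if i \<in> J then 0 else u $ i) *s b i)" for u :: "complex ^ 'n"
  have \<iota>\<sigma>: "\<iota> u $ \<sigma> i = u $ i" if "i \<in> J" for u i
    using that J(2) by (simp add: \<iota>_def)
  have \<iota>0: "\<iota> u $ q = 0" if "q \<notin> \<sigma> ` J" for u q using that by (simp add: \<iota>_def)
  have \<iota>add: "\<iota> (u + v) = \<iota> u + \<iota> v" and \<iota>scale: "\<iota> (c *\<^sub>C u) = c *\<^sub>C \<iota> u" for u v c
    by (simp_all add: \<iota>_def vec_eq_iff)
  have \<beta>add: "\<beta> (u + v) = \<beta> u + \<beta> v" and \<beta>scale: "\<beta> (c *\<^sub>C u) = c *\<^sub>C \<beta> u" for u v c
    unfolding \<beta>_def cscale_eq_vector_scalar_mult vec.scale_sum_right sum.distrib[symmetric]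
    by (rule sum.cong, simp, simp add: vector_sadd_rdistrib)+
  note \<iota>lin = clinear_cholo[where f = \<iota>, OF \<iota>add \<iota>scale]
  note \<beta>lin = clinear_cholo[where f = \<beta>, OF \<beta>add \<beta>scale]
  have \<beta>plane: "\<beta> u = 0" if "u \<in> coord_plane J" for u
    unfolding \<beta>_def by (rule sum.neutral) (use that in \<open>auto simp: coord_plane_def\<close>)
  \<comment> \<open>The slice of G along the parameters \<sigma> i, completed by the constant
    directions b. At 0 its derivative has the columns of the nonzero minor, hence is invertible,
    while on the coordinate plane of J the term \<beta> vanishes and \<Phi> is the slice
    itself.\<close>
  define \<Phi> where "\<Phi> u = G (x0 + \<iota> u) + \<beta> u" for u
  define U0 where "U0 = (\<lambda>u. x0 + \<iota> u) -` W"
  have slice: "cholo A (\<lambda>u. x0 + \<iota> u)" for A by (intro cholo_add cholo_const \<iota>lin)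
  have U0: "open U0" unfolding U0_def by (rule open_vimage[OF W cholo_continuous_on[OF slice]])
  have \<iota>z: "\<iota> 0 = 0" by (simp add: \<iota>_def vec_eq_iff)
  have zero: "0 \<in> U0" using x0 by (simp add: U0_def \<iota>z)
  have \<Phi>: "cholo U0 \<Phi>" unfolding \<Phi>_def
    by (intro cholo_add \<beta>lin cholo_compose[OF slice G]) (simp add: U0_def)
  have x00: "x0 + \<iota> 0 = x0" by (simp add: \<iota>z)
  have slice_der: "((\<lambda>u. x0 + \<iota> u) has_derivative \<iota>) (at u)" for u
    by (rule has_derivative_eq_rhs[OF has_derivative_add[OF has_derivative_const \<iota>lin(2)]]) simp
  have G0: "(G has_derivative FD G x0) (at (x0 + \<iota> 0))"
    using cholo_has_derivative[OF G x0] by (simp only: x00)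
  have FD\<Phi>: "FD \<Phi> 0 u = FD G x0 (\<iota> u) + \<beta> u" for u
    using FD_eq[OF has_derivative_add[OF has_derivative_compose[OF slice_der G0] \<beta>lin(2)]]
    unfolding \<Phi>_def[abs_def] by simp
  interpret DG: Vector_Spaces.linear "(*s)" "(*s)" "FD G x0" by (rule vec_linear_FD[OF G x0])
  have \<iota>sum: "\<iota> u = (\<Sum>i\<in>J. u $ i *s axis (\<sigma> i) 1)" for u
  proof (rule vec_eq_iff[THEN iffD2], rule allI)
    fix q
    show "\<iota> u $ q = (\<Sum>i\<in>J. u $ i *s axis (\<sigma> i) 1) $ q"
    proof (cases "q \<in> \<sigma> ` J")
      case True
      then obtain k where k: "k \<in> J" "q = \<sigma> k" by auto
      have "(\<Sum>i\<in>J. u $ i *s axis (\<sigma> i) 1) $ q = (\<Sum>i\<in>J. if i = k then u $ k else 0)"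
        unfolding sum_component
        by (rule sum.cong) (use k J(2) in \<open>auto simp: axis_def inj_on_eq_iff\<close>)
      then show ?thesis using k by (simp add: \<iota>\<sigma>)
    next
      case False
      then show ?thesis
        unfolding sum_component \<iota>0[OF False] by (intro sum.neutral[symmetric]) (auto simp: axis_def)
    qed
  qed
  have "FD \<Phi> 0 u = (\<Sum>i\<in>UNIV. u $ i *s minor_col J \<sigma> b G x0 i)" for u
  proof -
    have "(\<Sum>i\<in>UNIV. u $ i *s minor_col J \<sigma> b G x0 i) =
        (\<Sum>i\<in>UNIV. (if i \<in> J then u $ i *s FD G x0 (axis (\<sigma> i) 1) else 0) + (if i \<in> J then 0 else u $ i) *s b i)"
      by (rule sum.cong) (auto simp: minor_col_def)
    also have "\<dots> = (\<Sum>i\<in>J. u $ i *s FD G x0 (axis (\<sigma> i) 1)) + \<beta> u"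
      by (simp add: sum.distrib \<beta>_def sum.If_cases)
    finally show ?thesis by (simp add: FD\<Phi> \<iota>sum DG.sum DG.scale)
  qed
  then have inj\<Phi>: "inj (FD \<Phi> 0)"
    using J(3) unfolding minor_nonzero_iff independent_family_iff[symmetric]
    by (subst vec.linear_inj_iff_eq_0[OF vec_linear_FD[OF \<Phi> zero]]) (simp add: vec_eq_iff)
  show thesis
  proof (rule cholo_inverse_function[OF U0 \<Phi> zero inj\<Phi>])
    fix U' V \<phi>
    assume U': "open U'" "U' \<subseteq> U0" "0 \<in> U'" and V: "open V" and hom: "homeomorphism U' V \<Phi> \<phi>" and \<phi>: "cholo V \<phi>"
    have hom1: "\<phi> (\<Phi> u) = u" "\<Phi> u \<in> V" if "u \<in> U'" for u using hom that by (auto simp: homeomorphism_def)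
    have hom2: "\<Phi> (\<phi> z) = z" "\<phi> z \<in> U'" if "z \<in> V" for z using hom that by (auto simp: homeomorphism_def)
    have \<Phi>plane: "\<Phi> u = G (x0 + \<iota> u)" if "u \<in> coord_plane J" for u
      using \<beta>plane[OF that] by (simp add: \<Phi>_def)
    have zplane: "0 \<in> coord_plane J" by (simp add: coord_plane_def)
    have Gx0: "G x0 \<in> V" "\<phi> (G x0) = 0"
      using hom1[OF U'(3)] \<Phi>plane[OF zplane] by (auto simp: \<iota>z)
    define W1 where "W1 = W \<inter> G -` V"
    have W1: "open W1" unfolding W1_def by (rule continuous_open_preimage[OF cholo_continuous_on[OF G] W V])
    have x01: "x0 \<in> W1" using x0 Gx0 by (simp add: W1_def)
    define h where "h x = \<phi> (G x)" for x
    have h: "cholo W1 h" unfolding h_def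
      by (rule cholo_compose[OF cholo_subset[OF G] \<phi>]) (auto simp: W1_def)
    have h0: "h x0 = 0" using Gx0 by (simp add: h_def)
    \<comment> \<open>New parameters centred at x0: in the slots \<sigma> i stand the J-coordinates
      of h, in all other slots the old offsets. Since h inverts the slice, the derivative at x0 has
      trivial kernel.\<close>
    define K where "K x = (\<chi> q. if q \<in> \<sigma> ` J then h x $ inv_into J \<sigma> q else (x - x0) $ q)" for x
    have K\<sigma>: "K x $ \<sigma> i = h x $ i" if "i \<in> J" for x i using that J(2) by (simp add: K_def)
    have K': "K x $ q = (x - x0) $ q" if "q \<notin> \<sigma> ` J" for x q using that by (simp add: K_def)
    have K: "cholo W1 K"
      unfolding K_def[abs_def]
    proof (rule cholo_vec_lambda)
      fix q show "cholo W1 (\<lambda>x. if q \<in> \<sigma> ` J then h x $ inv_into J \<sigma> q else (x - x0) $ q)"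
        by (cases "q \<in> \<sigma> ` J")
          (simp_all only: if_True if_False, intro cholo_vec_nth h, intro cholo_vec_nth cholo_diff cholo_ident cholo_const)
    qed
    have Kx0: "K x0 = 0" by (simp add: K_def h0 vec_eq_iff)
    have hslice: "h (x0 + \<iota> u) = u" "x0 + \<iota> u \<in> W1" if "u \<in> U'" "u \<in> coord_plane J" for u
      using hom1[OF that(1)] \<Phi>plane[OF that(2)] that(1) U'(2) by (auto simp: h_def W1_def U0_def)
    have FDh\<iota>: "FD h x0 (\<iota> u) = u" if u: "u \<in> coord_plane J" for u
    proof -
      have "((\<lambda>c. x0 + c *\<^sub>C \<iota> u) has_derivative (\<lambda>c. c *\<^sub>C \<iota> u)) (at (0::complex))"
        by (rule has_derivative_eq_rhs[OF has_derivative_add[OF has_derivative_const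
            has_derivative_cscale[OF has_derivative_ident has_derivative_const]]]) simp
      moreover have "(h has_derivative FD h x0) (at (x0 + 0 *\<^sub>C \<iota> u))"
        using cholo_has_derivative[OF h x01] by simp
      ultimately have 1: "((\<lambda>c. h (x0 + c *\<^sub>C \<iota> u)) has_derivative (\<lambda>c. FD h x0 (c *\<^sub>C \<iota> u))) (at 0)"
        by (rule has_derivative_compose)
      have o: "open ((\<lambda>c::complex. c *\<^sub>C u) -` U')"
        by (rule open_vimage[OF U'(1)]) (intro continuous_intros)
      have d: "((\<lambda>c. c *\<^sub>C u) has_derivative (\<lambda>c. c *\<^sub>C u)) (at (0::complex))"
        by (rule has_derivative_eq_rhs[OF has_derivative_cscale[OF has_derivative_ident has_derivative_const]]) simp
      have 2: "((\<lambda>c. h (x0 + c *\<^sub>C \<iota> u)) has_derivative (\<lambda>c. c *\<^sub>C u)) (at 0)"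
      proof (rule has_derivative_transform_within_open[OF d o])
        show "0 \<in> (\<lambda>c::complex. c *\<^sub>C u) -` U'" using U'(3) by simp
        fix c assume "c \<in> (\<lambda>c::complex. c *\<^sub>C u) -` U'"
        moreover have "c *\<^sub>C u \<in> coord_plane J" using u by (simp add: coord_plane_def)
        ultimately show "c *\<^sub>C u = h (x0 + c *\<^sub>C \<iota> u)"
          using hslice(1)[of "c *\<^sub>C u"] by (simp add: \<iota>scale)
      qed
      from has_derivative_unique[OF 1 2] have "FD h x0 (1 *\<^sub>C \<iota> u) = 1 *\<^sub>C u" by (rule fun_cong)
      then show ?thesis by simp
    qed
    have FDK: "FD K x v $ q = (if q \<in> \<sigma> ` J then FD h x v $ inv_into J \<sigma> q else v $ q)" if x: "x \<in> W1" for x v q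
    proof -
      have 1: "((\<lambda>x. K x $ q) has_derivative (\<lambda>v. FD K x v $ q)) (at x)"
        by (rule bounded_linear.has_derivative[OF bounded_linear_vec_nth cholo_has_derivative[OF K x]])
      have 2: "((\<lambda>x. if q \<in> \<sigma> ` J then h x $ inv_into J \<sigma> q else (x - x0) $ q) has_derivative
          (\<lambda>v. if q \<in> \<sigma> ` J then FD h x v $ inv_into J \<sigma> q else (v - 0) $ q)) (at x)"
        by (cases "q \<in> \<sigma> ` J")
          (simp_all only: if_True if_False, rule bounded_linear.has_derivative[OF bounded_linear_vec_nth cholo_has_derivative[OF h x]],
            rule bounded_linear.has_derivative[OF bounded_linear_vec_nth has_derivative_diff[OF has_derivative_ident has_derivative_const]])
      have eqf: "(\<lambda>x. K x $ q) = (\<lambda>x. if q \<in> \<sigma> ` J then h x $ inv_into J \<sigma> q else (x - x0) $ q)"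
        by (simp add: K_def)
      have "(\<lambda>v. FD K x v $ q) = (\<lambda>v. if q \<in> \<sigma> ` J then FD h x v $ inv_into J \<sigma> q else (v - 0) $ q)"
        by (rule has_derivative_unique[OF 1[unfolded eqf] 2])
      then show ?thesis by (simp add: fun_eq_iff)
    qed
    have injK: "inj (FD K x0)"
    proof (subst vec.linear_inj_iff_eq_0[OF vec_linear_FD[OF K x01]], intro allI impI)
      fix v assume v: "FD K x0 v = 0"
      define u where "u = (\<chi> i. if i \<in> J then v $ \<sigma> i else 0)"
      have u: "u \<in> coord_plane J" by (simp add: u_def coord_plane_def)
      have off: "v $ q = 0" if "q \<notin> \<sigma> ` J" for q using FDK[OF x01, of v q] v that by simp
      have "v = \<iota> u"
      proof (rule vec_eq_iff[THEN iffD2], rule allI)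
        fix q show "v $ q = \<iota> u $ q"
          using off[of q] \<iota>0[of q u] by (cases "q \<in> \<sigma> ` J") (auto simp: \<iota>\<sigma> u_def)
      qed
      then have "FD h x0 v = u" using FDh\<iota>[OF u] by simp
      then have "u $ i = 0" if "i \<in> J" for i
        using FDK[OF x01, of v "\<sigma> i"] v that J(2) by simp
      then have "u = 0" using u by (auto simp: vec_eq_iff coord_plane_def)
      then show "v = 0" using \<open>v = \<iota> u\<close> \<iota>z by simp
    qed
    show thesis
    proof (rule cholo_inverse_function[OF W1 K x01 injK])
      fix X' Y k
      assume X': "open X'" "X' \<subseteq> W1" "x0 \<in> X'" and Y: "open Y" and homK: "homeomorphism X' Y K k" and k: "cholo Y k"
      have K1: "k (K x) = x" "K x \<in> Y" if "x \<in> X'" for x using homK that by (auto simp: homeomorphism_def)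
      have K2: "K (k y) = y" "k y \<in> X'" if "y \<in> Y" for y using homK that by (auto simp: homeomorphism_def)
      define P where "P y = (\<chi> i. if i \<in> J then y $ \<sigma> i else 0)" for y :: "complex ^ 'q"
      have Pplane: "P y \<in> coord_plane J" for y by (simp add: P_def coord_plane_def)
      have contP: "continuous_on A P" for A
      proof -
        have "continuous_on A (\<lambda>x :: complex ^ 'q. if i \<in> J then x $ \<sigma> i else 0)" for i
          by (cases "i \<in> J") (auto intro!: continuous_intros)
        then show ?thesis unfolding P_def[abs_def] by (intro continuous_on_vec_lambda)
      qed
      have P0: "P 0 = 0" by (simp add: P_def vec_eq_iff)
      have \<iota>P\<sigma>: "\<iota> (P y) $ q = (if q \<in> \<sigma> ` J then y $ q else 0)" for y q
        by (auto simp: \<iota>0 \<iota>\<sigma>) (simp add: P_def)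
      have "open (Y \<inter> P -` (U' \<inter> (\<lambda>u. x0 + \<iota> u) -` X'))"
        by (intro open_Int Y open_vimage U' X' cholo_continuous_on[OF slice] contP)
      moreover have "0 \<in> Y \<inter> P -` (U' \<inter> (\<lambda>u. x0 + \<iota> u) -` X')"
        using K1(2)[OF X'(3)] Kx0 U'(3) X'(3) by (simp add: P0 \<iota>z)
      ultimately obtain r where r: "r > 0" "ball 0 r \<subseteq> Y \<inter> P -` (U' \<inter> (\<lambda>u. x0 + \<iota> u) -` X')"
        using open_contains_ball by blast
      define H where "H y = h (k y)" for y
      have kY: "cholo (ball 0 r) k" using k r(2) by (blast intro: cholo_subset)
      have H: "cholo (ball 0 r) H" unfolding H_def
        by (rule cholo_compose[OF kY h]) (use r(2) K2 X'(2) in blast)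
      have H\<sigma>: "H y $ i = y $ \<sigma> i" if "y \<in> ball 0 r" "i \<in> J" for y i
        using K\<sigma>[OF that(2), of "k y"] K2(1)[of y] that r(2) by (auto simp: H_def)
      have FDH\<sigma>: "FD H y v $ i = v $ \<sigma> i" if y: "y \<in> ball 0 r" and i: "i \<in> J" for y i v
      proof -
        have 1: "((\<lambda>y. H y $ i) has_derivative (\<lambda>v. FD H y v $ i)) (at y)"
          by (rule bounded_linear.has_derivative[OF bounded_linear_vec_nth cholo_has_derivative[OF H y]])
        have "((\<lambda>y :: complex ^ 'q. y $ \<sigma> i) has_derivative (\<lambda>v. v $ \<sigma> i)) (at y)"
          by (rule bounded_linear.has_derivative[OF bounded_linear_vec_nth has_derivative_ident])
        then have 2: "((\<lambda>y. H y $ i) has_derivative (\<lambda>v. v $ \<sigma> i)) (at y)"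
          by (rule has_derivative_transform_within_open[OF _ open_ball y]) (simp add: H\<sigma> i)
        from has_derivative_unique[OF 1 2] show ?thesis by (rule fun_cong)
      qed
      have rkH: "vec.dim (range (FD H y)) \<le> card J" if y: "y \<in> ball 0 r" for y
      proof -
        have ky: "k y \<in> W1" using r(2) K2(2) X'(2) y by blast
        then have kyW: "k y \<in> W" "G (k y) \<in> V" by (auto simp: W1_def)
        have "FD H y v = FD \<phi> (G (k y)) (FD G (k y) (FD k y v))" for v
        proof -
          have "FD H y v = FD h (k y) (FD k y v)"
            unfolding H_def[abs_def] by (rule FD_compose[OF kY h y ky])
          also have "FD h (k y) w = FD \<phi> (G (k y)) (FD G (k y) w)" for w
            unfolding h_def[abs_def] by (rule FD_compose[OF G \<phi> kyW])
          finally show ?thesis .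
        qed
        then have "range (FD H y) \<subseteq> FD \<phi> (G (k y)) ` range (FD G (k y))" by auto
        then have "vec.dim (range (FD H y)) \<le> vec.dim (FD \<phi> (G (k y)) ` range (FD G (k y)))"
          by (rule vec.dim_subset)
        also have "\<dots> \<le> vec.dim (range (FD G (k y)))"
          by (rule vec.dim_image_le[OF vec_linear_FD[OF \<phi> kyW(2)]])
        also have "\<dots> \<le> card J" using rk[OF kyW(1)] J(1) by simp
        finally show ?thesis .
      qed
      \<comment> \<open>In the new parameters the J-coordinates of H are the parameters \<sigma> i
        themselves, so the rank bound leaves no room for further independent columns: the derivative
        vanishes on directions that move only the other parameters.\<close>
      have FDH0: "FD H y w = 0" if y: "y \<in> ball 0 r" and w: "\<And>q. q \<in> \<sigma> ` J \<Longrightarrow> w $ q = 0" for y w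
      proof (rule graph_kernel[where J = J and E = "\<lambda>j. FD H y (axis (\<sigma> j) 1)" and R = "range (FD H y)"])
        fix i j assume ij: "i \<in> J" "j \<in> J"
        then show "FD H y (axis (\<sigma> j) 1) $ i = (if i = j then 1 else 0)"
          using J(2) by (auto simp: FDH\<sigma>[OF y] axis_def inj_on_eq_iff)
      qed (use rkH[OF y] w FDH\<sigma>[OF y] in auto)
      have Hconst: "H y = H (\<iota> (P y))" and \<iota>Pball: "\<iota> (P y) \<in> ball 0 r" if y: "y \<in> ball 0 r" for y
      proof -
        have "norm (\<iota> (P y)) \<le> norm y"
          unfolding norm_vec_def L2_set_def
          by (rule real_sqrt_le_mono, rule sum_mono) (simp add: \<iota>P\<sigma>)
        then show b: "\<iota> (P y) \<in> ball 0 r" using y by simp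
        let ?d = "y - \<iota> (P y)"
        have dq: "?d $ q = 0" if "q \<in> \<sigma> ` J" for q using that by (simp add: \<iota>P\<sigma>)
        have "H (\<iota> (P y) + 0 *\<^sub>R ?d) = H (\<iota> (P y) + 1 *\<^sub>R ?d)"
        proof (rule has_derivative_zero_unique[of "{0..1::real}" "\<lambda>t. H (\<iota> (P y) + t *\<^sub>R ?d)"])
          fix t :: real assume t: "t \<in> {0..1}"
          have "\<iota> (P y) + t *\<^sub>R ?d = (1 - t) *\<^sub>R \<iota> (P y) + t *\<^sub>R y" by (simp add: algebra_simps)
          moreover have "(1 - t) *\<^sub>R \<iota> (P y) + t *\<^sub>R y \<in> ball 0 r"
            using t b y by (intro convexD[OF convex_ball]) auto
          ultimately have tb: "\<iota> (P y) + t *\<^sub>R ?d \<in> ball 0 r" by simp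
          have 1: "((\<lambda>t. \<iota> (P y) + t *\<^sub>R ?d) has_derivative (\<lambda>h. h *\<^sub>R ?d)) (at t within {0..1})"
            by (rule has_derivative_eq_rhs[OF has_derivative_add[OF has_derivative_const
                has_derivative_scaleR_left[OF has_derivative_ident]]]) simp
          have "FD H (\<iota> (P y) + t *\<^sub>R ?d) (h *\<^sub>R ?d) = 0" for h
            by (rule FDH0[OF tb]) (simp only: vector_scaleR_component dq scaleR_zero_right)
          then show "((\<lambda>t. H (\<iota> (P y) + t *\<^sub>R ?d)) has_derivative (\<lambda>h. 0)) (at t within {0..1})"
            using has_derivative_compose[OF 1 cholo_has_derivative[OF H tb]] by simp
        qed auto
        then show "H y = H (\<iota> (P y))" by simp
      qed
      define W' where "W' = X' \<inter> K -` ball 0 r"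
      have KX': "continuous_on X' K" using cholo_continuous_on[OF K] X'(2) by (rule continuous_on_subset)
      have W': "open W'" unfolding W'_def by (rule continuous_open_preimage[OF KX' X'(1) open_ball])
      have x0W': "x0 \<in> W'" using X'(3) r(1) by (simp add: W'_def Kx0)
      have W'W1: "W' \<subseteq> W1" using X'(2) by (auto simp: W'_def)
      \<comment> \<open>H does not change when the other new parameters are set to 0, and on the
        slice h is the identity of the coordinate plane. Thus h just reads off its own
        J-coordinates, and G takes its values in the straightened plane.\<close>
      have hP: "h x = P (K x)" if x: "x \<in> W'" for x
      proof -
        let ?y = "K x" let ?u = "P (K x)"
        have y: "?y \<in> ball 0 r" and kx: "k ?y = x" using x K1(1) by (auto simp: W'_def)
        have u: "?u \<in> U'" "x0 + \<iota> ?u \<in> X'" using r(2) y by blast+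
        have hs: "h (x0 + \<iota> ?u) = ?u" by (rule hslice(1)[OF u(1) Pplane])
        have "K (x0 + \<iota> ?u) = \<iota> ?u"
        proof (rule vec_eq_iff[THEN iffD2], rule allI)
          fix q show "K (x0 + \<iota> ?u) $ q = \<iota> ?u $ q"
            using K'[of q "x0 + \<iota> ?u"] by (cases "q \<in> \<sigma> ` J") (auto simp: K\<sigma> \<iota>\<sigma> hs)
        qed
        then have "k (\<iota> ?u) = x0 + \<iota> ?u" using K1(1)[OF u(2)] by simp
        then have "H (\<iota> ?u) = ?u" using hs by (simp add: H_def)
        then show ?thesis using Hconst[OF y] kx by (simp add: H_def)
      qed
      have G\<Phi>: "G x = \<Phi> (h x)" "G x \<in> V" if "x \<in> W'" for x
        using that W'W1 hom2(1)[of "G x"] by (auto simp: W1_def h_def)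
      show thesis
      proof (rule that[OF W' x0W'])
        show "W' \<subseteq> W" using W'W1 by (auto simp: W1_def)
        \<comment> \<open>Every smaller open set is covered, because in the application the
          neighbourhood has to be a polydisc of parameters.\<close>
        show "\<forall>W''. open W'' \<longrightarrow> W'' \<subseteq> W' \<longrightarrow> csubmanifold (G ` W'') e"
        proof (intro allI impI)
          fix W'' assume W'': "open W''" "W'' \<subseteq> W'"
          have KW: "K ` W'' = Y \<inter> k -` W''"
            using W''(2) K1 K2 by (force simp: W'_def image_iff)
          have oK: "open (K ` W'')"
            unfolding KW by (rule continuous_open_preimage[OF cholo_continuous_on[OF k] Y W''(1)])
          \<comment> \<open>The cylinder over the J-coordinates attained on \<open>W''\<close>.
            Cutting the chart down to it makes every plane point of the chart a value of G on
            \<open>W''\<close>, so the image is the whole plane section.\<close>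
          define T where "T = {u :: complex ^ 'n. \<exists>y\<in>K ` W''. \<forall>i\<in>J. y $ \<sigma> i = u $ i}"
          have oT: "open T"
          proof (subst open_subopen, intro ballI)
            fix u assume "u \<in> T"
            then obtain y where y: "y \<in> K ` W''" "\<forall>i\<in>J. y $ \<sigma> i = u $ i" by (auto simp: T_def)
            let ?S = "(\<lambda>u'. y + \<iota> (u' - u)) -` (K ` W'')"
            have "continuous_on UNIV (\<lambda>u'. y + \<iota> (u' - u))"
              by (intro continuous_intros continuous_on_compose2[OF cholo_continuous_on[OF \<iota>lin(1)[of UNIV]]]) auto
            then have "open ?S" by (rule open_vimage[OF oK])
            moreover have "u \<in> ?S" using y(1) by (simp add: \<iota>z)
            moreover have "?S \<subseteq> T"
            proof
              fix u' assume "u' \<in> ?S"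
              then have "y + \<iota> (u' - u) \<in> K ` W''" by simp
              moreover have "\<forall>i\<in>J. (y + \<iota> (u' - u)) $ \<sigma> i = u' $ i" using y(2) by (simp add: \<iota>\<sigma>)
              ultimately show "u' \<in> T" unfolding T_def by blast
            qed
            ultimately show "\<exists>S. open S \<and> u \<in> S \<and> S \<subseteq> T" by blast
          qed
          have hT: "h x \<in> T" if "x \<in> W''" for x
            using that W''(2) W'W1 K\<sigma>[of _ x] by (auto simp: T_def)
          define A where "A = V \<inter> \<phi> -` T"
          have A: "open A" unfolding A_def by (rule continuous_open_preimage[OF cholo_continuous_on[OF \<phi>] V oT])
          have \<phi>A: "\<phi> ` A = U' \<inter> T"
            using hom1 hom2 by (force simp: A_def image_iff)
          have eqM: "\<phi> ` (G ` W'' \<inter> A) = \<phi> ` A \<inter> coord_plane J"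
          proof (intro equalityI subsetI)
            fix u assume "u \<in> \<phi> ` (G ` W'' \<inter> A)"
            then obtain x where x: "x \<in> W''" "G x \<in> A" "u = h x" by (auto simp: h_def)
            then have "u \<in> \<phi> ` A" by (auto simp: h_def)
            moreover have "u \<in> coord_plane J" using hP[of x] x W''(2) Pplane by auto
            ultimately show "u \<in> \<phi> ` A \<inter> coord_plane J" by simp
          next
            fix u assume u: "u \<in> \<phi> ` A \<inter> coord_plane J"
            then obtain z where z: "z \<in> A" "u = \<phi> z" by auto
            then have "u \<in> T" by (simp add: A_def)
            then obtain x where x: "x \<in> W''" "\<forall>i\<in>J. K x $ \<sigma> i = u $ i" by (auto simp: T_def)
            have "h x = u"
            proof (rule vec_eq_iff[THEN iffD2], rule allI)
              fix i show "h x $ i = u $ i"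
                using x u hP[of x] W''(2) Pplane[of "K x"] K\<sigma>[of i x]
                by (cases "i \<in> J") (auto simp: coord_plane_def)
            qed
            then have "G x = z" using G\<Phi>(1)[of x] x(1) W''(2) z hom2(1)[of z] by (auto simp: A_def)
            then show "u \<in> \<phi> ` (G ` W'' \<inter> A)" using x z by blast
          qed
          show "csubmanifold (G ` W'') e"
            unfolding csubmanifold_def
          proof
            fix p assume "p \<in> G ` W''"
            then obtain x where x: "x \<in> W''" "p = G x" by auto
            show "\<exists>U \<phi> \<psi> J. open U \<and> p \<in> U \<and> open (\<phi> ` U) \<and> holo_on U \<phi> \<and> holo_on (\<phi> ` U) \<psi> \<and>
                (\<forall>z\<in>U. \<psi> (\<phi> z) = z) \<and> card J = e \<and>
                \<phi> ` (G ` W'' \<inter> U) = \<phi> ` U \<inter> {w. \<forall>i. i \<notin> J \<longrightarrow> w $ i = 0}"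
            proof (intro exI conjI)
              show "open A" by fact
              show "p \<in> A" using G\<Phi>(2)[of x] hT[OF x(1)] x W''(2) by (auto simp: A_def h_def)
              show "open (\<phi> ` A)" unfolding \<phi>A using U'(1) oT by (rule open_Int)
              show "holo_on A \<phi>" unfolding holo_on_eq_cholo using \<phi> by (rule cholo_subset) (simp add: A_def)
              show "holo_on (\<phi> ` A) \<Phi>" unfolding holo_on_eq_cholo \<phi>A using \<Phi> by (rule cholo_subset) (use U'(2) in auto)
              show "\<forall>z\<in>A. \<Phi> (\<phi> z) = z" using hom2(1) by (auto simp: A_def)
              show "card J = e" by (rule J(1))
              show "\<phi> ` (G ` W'' \<inter> A) = \<phi> ` A \<inter> {w. \<forall>i. i \<notin> J \<longrightarrow> w $ i = 0}"
                using eqM by (simp add: coord_plane_def)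
            qed
          qed
        qed
      qed
    qed
  qed
qed

section \<open>Complex submanifolds tangent to the system\<close>

text \<open>The left inverse \<psi> makes \<phi> injective on U, which turns the equation between
  images into a pointwise test for membership in M.\<close>

lemma csubmanifold_chart:
  fixes M :: "(complex ^ 'n) set"
  assumes "csubmanifold M e" "p \<in> M"
  obtains U and \<phi> \<psi> :: "complex ^ 'n \<Rightarrow> complex ^ 'n" and J :: "'n set" where "open U" "p \<in> U" "open (\<phi> ` U)" "cholo U \<phi>" "cholo (\<phi> ` U) \<psi>"
    "\<forall>z\<in>U. \<psi> (\<phi> z) = z" "card J = e" "\<forall>z\<in>U. z \<in> M \<longleftrightarrow> \<phi> z \<in> coord_plane J"
proof -
  obtain U and \<phi> \<psi> :: "complex ^ 'n \<Rightarrow> complex ^ 'n" and J :: "'n set"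
    where U: "open U" "p \<in> U" "open (\<phi> ` U)" "holo_on U \<phi>" "holo_on (\<phi> ` U) \<psi>"
    and inv: "\<forall>z\<in>U. \<psi> (\<phi> z) = z" and J: "card J = e"
    and eq: "\<phi> ` (M \<inter> U) = \<phi> ` U \<inter> {w. \<forall>i. i \<notin> J \<longrightarrow> w $ i = 0}"
    using assms(1)[unfolded csubmanifold_def, rule_format, OF assms(2)]
    by (elim exE conjE) (rule that; assumption)
  have "z \<in> M \<longleftrightarrow> \<phi> z \<in> coord_plane J" if z: "z \<in> U" for z
  proof
    assume "z \<in> M"
    then have "\<phi> z \<in> \<phi> ` (M \<inter> U)" using z by blast
    then show "\<phi> z \<in> coord_plane J" unfolding eq coord_plane_def by blast
  next
    assume "\<phi> z \<in> coord_plane J"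
    then have "\<phi> z \<in> \<phi> ` (M \<inter> U)" using z unfolding eq coord_plane_def by blast
    then obtain z' where "z' \<in> M" "z' \<in> U" "\<phi> z = \<phi> z'" by blast
    then show "z \<in> M" using inv z by metis
  qed
  then show ?thesis
    using U inv J unfolding holo_on_eq_cholo by (intro that[of U \<phi> \<psi> J]) auto
qed

definition cproj :: "'n set \<Rightarrow> complex ^ 'n \<Rightarrow> complex ^ ('n::finite)" where
  "cproj J v = (\<chi> i. if i \<in> J then v $ i else 0)"

lemma cproj_nth [simp]: "cproj J v $ i = (if i \<in> J then v $ i else 0)"
  by (simp add: cproj_def)

lemma cproj_in_plane [simp]: "cproj J v \<in> coord_plane J"
  by (simp add: coord_plane_def)

lemma cproj_plane: "v \<in> coord_plane J \<Longrightarrow> cproj J v = v"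
  by (auto simp: coord_plane_def vec_eq_iff)

lemma cproj_plane_iff: "v \<in> coord_plane J \<longleftrightarrow> v - cproj J v = 0"
  using cproj_plane cproj_in_plane by (metis eq_iff_diff_eq_0)

lemma cproj_add: "cproj J (u + v) = cproj J u + cproj J v"
  and cproj_diff: "cproj J (u - v) = cproj J u - cproj J v"
  and cproj_cscale: "cproj J (c *\<^sub>C v) = c *\<^sub>C cproj J v"
  by (simp_all add: vec_eq_iff)

lemmas cproj_lin = clinear_cholo[where f = "cproj J" for J, OF cproj_add cproj_cscale]

lemma norm_cproj_le: "norm (cproj J v) \<le> norm v"
  unfolding norm_vec_def L2_set_def by (rule real_sqrt_le_mono, rule sum_mono) simp

lemma norm_diff_cproj_le: "norm (v - cproj J v) \<le> norm v"
  unfolding norm_vec_def L2_set_def by (rule real_sqrt_le_mono, rule sum_mono) simp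

lemma coord_plane_subspace: "vec.subspace (coord_plane J)"
  by (auto simp: coord_plane_def vec.subspace_def)

lemma dim_coord_plane_le: "vec.dim (coord_plane J) \<le> card (J :: 'n::finite set)"
proof -
  have "coord_plane J \<subseteq> vec.span ((\<lambda>i. axis i 1) ` J)"
  proof
    fix v :: "complex ^ 'n" assume v: "v \<in> coord_plane J"
    have "v = (\<Sum>q\<in>UNIV. v $ q *s axis q 1)" by (simp only: axis_expansion)
    also have "\<dots> = (\<Sum>q\<in>J. v $ q *s axis q 1)"
      by (rule sum.mono_neutral_right) (use v in \<open>auto simp: coord_plane_def\<close>)
    also have "\<dots> \<in> vec.span ((\<lambda>i. axis i 1) ` J)"
      by (intro vec.span_sum vec.span_scale vec.span_base imageI)
    finally show "v \<in> vec.span ((\<lambda>i. axis i 1) ` J)" .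
  qed
  then have "vec.dim (coord_plane J) \<le> card ((\<lambda>i. axis i (1::complex)) ` J)"
    by (rule vec.dim_le_card) simp
  also have "\<dots> \<le> card J" by (simp add: card_image_le)
  finally show ?thesis .
qed

lemma derivative_in_plane:
  assumes F: "(F has_derivative D) (at x)" and N: "open N" "x \<in> N"
    and pl: "\<And>y. y \<in> N \<Longrightarrow> F y \<in> coord_plane J"
  shows "D v \<in> coord_plane J"
  unfolding coord_plane_def
proof (intro CollectI allI impI)
  fix i assume i: "i \<notin> J"
  have 1: "((\<lambda>y. F y $ i) has_derivative (\<lambda>v. D v $ i)) (at x)"
    by (rule bounded_linear.has_derivative[OF bounded_linear_vec_nth F])
  have 2: "((\<lambda>y. F y $ i) has_derivative (\<lambda>v. 0)) (at x)"
    by (rule has_derivative_transform_within_open[OF has_derivative_const[of 0] N])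
      (use pl i in \<open>auto simp: coord_plane_def\<close>)
  from has_derivative_unique[OF 1 2] show "D v $ i = 0" by (rule fun_cong)
qed

text \<open>Holomorphy of the derivative is known for a fixed direction; a varying direction is
  expanded in the standard basis.\<close>

lemma cholo_FD_apply:
  fixes F :: "complex ^ 'q \<Rightarrow> complex ^ 'n"
  assumes U: "open U" and F: "cholo U F" and V: "open V" and g: "cholo V g" and v: "cholo V v"
    and gU: "\<And>w. w \<in> V \<Longrightarrow> g w \<in> U"
  shows "cholo V (\<lambda>w. FD F (g w) (v w))"
proof (rule cholo_cong[OF V])
  show "cholo V (\<lambda>w. \<Sum>i\<in>UNIV. v w $ i *\<^sub>C FD F (g w) (axis i 1))"
    by (intro cholo_sum cholo_cscale cholo_vec_nth v cholo_compose[OF g cholo_FD[OF U F]] gU)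
  fix w assume w: "w \<in> V"
  interpret D: Vector_Spaces.linear "(*s)" "(*s)" "FD F (g w)" by (rule vec_linear_FD[OF F gU[OF w]])
  have "FD F (g w) (\<Sum>i\<in>UNIV. v w $ i *s axis i 1) = (\<Sum>i\<in>UNIV. v w $ i *\<^sub>C FD F (g w) (axis i 1))"
    by (simp add: D.sum D.scale cscale_eq_vector_scalar_mult)
  then show "(\<Sum>i\<in>UNIV. v w $ i *\<^sub>C FD F (g w) (axis i 1)) = FD F (g w) (v w)"
    by (simp only: axis_expansion)
qed

text \<open>In a chart straightening \<open>M\<close>, the transverse part of the flow line solves a linear-type differential
  inequality with zero initial value.\<close>

lemma flow_stays_in_submanifold:
  fixes X :: "complex ^ 'n \<Rightarrow> complex ^ 'n"
  assumes fb: "flow_box X R C" and M: "csubmanifold M e" and q: "q \<in> M" "norm q < R"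
    and tan: "\<And>p. p \<in> M \<Longrightarrow> X p \<in> ctangent M p"
  shows "\<exists>\<rho>>0. \<forall>z\<in>M. \<forall>s. dist z q < \<rho> \<longrightarrow> norm s < \<rho> \<longrightarrow> cflow X s z \<in> M"
proof (rule csubmanifold_chart[OF M q(1)])
  interpret flow_box X R C by fact
  fix U and \<phi> \<psi> :: "complex ^ 'n \<Rightarrow> complex ^ 'n" and J :: "'n set"
  assume U: "open U" "q \<in> U" "open (\<phi> ` U)" "cholo U \<phi>" "cholo (\<phi> ` U) \<psi>"
    and inv: "\<forall>z\<in>U. \<psi> (\<phi> z) = z" and MJ: "\<forall>z\<in>U. z \<in> M \<longleftrightarrow> \<phi> z \<in> coord_plane J"
  define A where "A = \<phi> ` U \<inter> \<psi> -` ball 0 R"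
  have A: "open A" unfolding A_def by (rule continuous_open_preimage[OF cholo_continuous_on[OF U(5)] U(3) open_ball])
  have \<psi>A: "\<psi> w \<in> U" "\<psi> w \<in> polydisc 1" "\<phi> (\<psi> w) = w" if "w \<in> A" for w
    using that inv ball_polydisc by (auto simp: A_def)
  \<comment> \<open>The field X seen in the chart. At points of the coordinate plane it lies in the
    plane, since X there is the velocity of a disc inside M.\<close>
  define Y where "Y w = FD \<phi> (\<psi> w) (X (\<psi> w))" for w
  have cA: "cholo A \<psi>" using U(5) by (rule cholo_subset) (simp add: A_def)
  have Y: "cholo A Y"
    unfolding Y_def by (intro cholo_FD_apply[OF U(1,4) A cA] cholo_compose[OF cA holo] \<psi>A)
  have Ypl: "Y w \<in> coord_plane J" if w: "w \<in> A" "w \<in> coord_plane J" for w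
  proof -
    have "\<psi> w \<in> M" using MJ \<psi>A[OF w(1)] w(2) by simp
    then obtain r \<gamma> where \<gamma>: "r > 0" "\<gamma> 0 = \<psi> w" "\<forall>\<sigma>. norm \<sigma> < r \<longrightarrow> \<gamma> \<sigma> \<in> M"
      "(\<gamma> has_derivative (\<lambda>h. h *s X (\<psi> w))) (at 0)" "\<forall>\<sigma>. norm \<sigma> < r \<longrightarrow> (\<exists>D. (\<gamma> has_derivative (\<lambda>h. h *s D)) (at \<sigma>))"
      using tan[of "\<psi> w"] unfolding ctangent_def by blast
    have cont: "continuous_on (ball 0 r) \<gamma>"
    proof (rule continuous_at_imp_continuous_on, rule ballI)
      fix \<sigma> :: complex assume "\<sigma> \<in> ball 0 r"
      then obtain D where "(\<gamma> has_derivative (\<lambda>h. h *s D)) (at \<sigma>)" using \<gamma>(5) by auto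
      then show "isCont \<gamma> \<sigma>" by (rule has_derivative_continuous)
    qed
    have N: "open (ball 0 r \<inter> \<gamma> -` U)" by (rule continuous_open_preimage[OF cont open_ball U(1)])
    have "(\<phi> has_derivative FD \<phi> (\<psi> w)) (at (\<gamma> 0))"
      unfolding \<gamma>(2) by (rule cholo_has_derivative[OF U(4) \<psi>A(1)[OF w(1)]])
    from has_derivative_compose[OF \<gamma>(4) this]
    have "FD \<phi> (\<psi> w) (1 *s X (\<psi> w)) \<in> coord_plane J"
      by (rule derivative_in_plane[OF _ N]) (use \<gamma> \<psi>A(1)[OF w(1)] MJ in auto)
    then show ?thesis by (simp add: Y_def)
  qed
  have \<phi>q: "\<phi> q \<in> A" "\<phi> q \<in> coord_plane J" using U(2) inv q MJ by (auto simp: A_def)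
  obtain r where r: "r > 0" "cball (\<phi> q) r \<subseteq> A" using A \<phi>q(1) open_contains_cball by blast
  obtain K where K: "K \<ge> 0" "\<forall>x\<in>cball (\<phi> q) r. \<forall>y\<in>cball (\<phi> q) r. norm (Y x - Y y) \<le> K * norm (x - y)"
    by (rule cholo_lipschitz[OF A Y compact_cball r(2) convex_cball])
  define O1 where "O1 = U \<inter> \<phi> -` ball (\<phi> q) r"
  have O1: "open O1" unfolding O1_def by (rule continuous_open_preimage[OF cholo_continuous_on[OF U(4)] U(1) open_ball])
  have "open (fdom \<inter> (\<lambda>p. cflow X (fst p) (snd p)) -` O1)"
    by (rule continuous_open_preimage[OF cholo_continuous_on[OF cholo_Phi] open_fdom O1])
  moreover have "(0, q) \<in> fdom \<inter> (\<lambda>p. cflow X (fst p) (snd p)) -` O1"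
    using q(2) U(2) r(1) by (simp add: fdom_def cflow_0 O1_def)
  ultimately obtain A1 B1 where AB: "open A1" "open B1" "(0, q) \<in> A1 \<times> B1"
    "A1 \<times> B1 \<subseteq> fdom \<inter> (\<lambda>p. cflow X (fst p) (snd p)) -` O1"
    by (rule open_prod_elim)
  obtain r1 where r1: "r1 > 0" "ball 0 r1 \<subseteq> A1" using AB open_contains_ball[of A1] by auto
  obtain r2 where r2: "r2 > 0" "ball q r2 \<subseteq> B1" using AB open_contains_ball[of B1] by auto
  show ?thesis
  proof (intro exI[of _ "min r1 r2"] conjI ballI allI impI)
    show "min r1 r2 > 0" using r1 r2 by simp
    fix z and s :: complex assume z: "z \<in> M" "dist z q < min r1 r2" and s: "norm s < min r1 r2"
    let ?\<rho> = "min r1 r2"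
    let ?c = "\<lambda>\<sigma>. cflow X \<sigma> z"
    have in1: "(\<sigma>, z) \<in> fdom" "?c \<sigma> \<in> U" "\<phi> (?c \<sigma>) \<in> ball (\<phi> q) r" if "norm \<sigma> < ?\<rho>" for \<sigma>
    proof -
      have "(\<sigma>, z) \<in> A1 \<times> B1" using that r1 r2 z by (auto simp: dist_commute)
      then have "(\<sigma>, z) \<in> fdom \<inter> (\<lambda>p. cflow X (fst p) (snd p)) -` O1" using AB(4) by blast
      then show "(\<sigma>, z) \<in> fdom" "?c \<sigma> \<in> U" "\<phi> (?c \<sigma>) \<in> ball (\<phi> q) r" by (auto simp: O1_def)
    qed
    define v where "v \<sigma> = \<phi> (?c \<sigma>)" for \<sigma>
    have vder: "(v has_derivative (\<lambda>h. h *\<^sub>C Y (v \<sigma>))) (at \<sigma>)" if \<sigma>: "norm \<sigma> < ?\<rho>" for \<sigma>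
    proof -
      note i = in1[OF \<sigma>]
      have "(v has_derivative (\<lambda>h. FD \<phi> (?c \<sigma>) (h *\<^sub>C X (?c \<sigma>)))) (at \<sigma>)"
        unfolding v_def by (rule has_derivative_compose[OF cflow_deriv[OF i(1)] cholo_has_derivative[OF U(4) i(2)]])
      then show ?thesis
        using inv i(2) by (simp add: cholo_FD_cscale[OF U(4) i(2)] Y_def v_def)
    qed
    let ?u = "\<lambda>\<sigma>. v \<sigma> - cproj J (v \<sigma>)"
    have v: "cholo (ball 0 ?\<rho>) v"
      by (rule choloI[OF vder]) (auto simp: cscale_cscale)
    have u: "cholo (ball 0 ?\<rho>) ?u"
      by (rule cholo_diff[OF v cholo_compose[OF v cproj_lin(1)[of UNIV J]]]) simp
    have z0: "norm z < R" using in1(1)[of 0] r1 r2 by (simp add: fdom_norm)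
    have "?u s = 0"
    proof (rule linear_ode_zero[OF u, where \<rho> = 1 and K = K])
      have "v 0 \<in> coord_plane J"
        using in1(2)[of 0] z(1) MJ cflow_0[OF z0] r1 r2 by (simp add: v_def)
      then show "?u 0 = 0" by (simp add: cproj_plane)
      show "norm s < ?\<rho>" by (rule s)
      fix \<sigma> :: complex assume \<sigma>: "norm \<sigma> < ?\<rho>"
      have vb: "v \<sigma> \<in> cball (\<phi> q) r" using in1(3)[OF \<sigma>] by (simp add: v_def)
      have "norm (cproj J (v \<sigma>) - \<phi> q) = norm (cproj J (v \<sigma> - \<phi> q))"
        by (simp add: cproj_diff cproj_plane[OF \<phi>q(2)])
      also have "\<dots> \<le> norm (v \<sigma> - \<phi> q)" by (rule norm_cproj_le)
      also have "\<dots> \<le> r" using vb by (simp add: dist_norm norm_minus_commute)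
      finally have pb: "cproj J (v \<sigma>) \<in> cball (\<phi> q) r" by (simp add: dist_norm norm_minus_commute)
      \<comment> \<open>Y at the projected point has no transverse part and can be subtracted for
        free. The transverse velocity is thus controlled by the difference of Y at two points whose
        distance is the transverse part itself, and the Lipschitz bound closes the
        inequality.\<close>
      have Yp: "cproj J (Y (cproj J (v \<sigma>))) = Y (cproj J (v \<sigma>))"
        using Ypl[of "cproj J (v \<sigma>)"] pb r(2) by (intro cproj_plane) auto
      have "(?u has_derivative (\<lambda>h. h *\<^sub>C Y (v \<sigma>) - cproj J (h *\<^sub>C Y (v \<sigma>)))) (at \<sigma>)"
        by (intro has_derivative_diff vder[OF \<sigma>] has_derivative_compose[OF vder[OF \<sigma>] cproj_lin(2)])
      then have "FD ?u \<sigma> 1 = Y (v \<sigma>) - cproj J (Y (v \<sigma>))" by (simp add: FD_eq)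
      also have "\<dots> = (Y (v \<sigma>) - Y (cproj J (v \<sigma>))) - cproj J (Y (v \<sigma>) - Y (cproj J (v \<sigma>)))"
        by (simp add: cproj_diff Yp)
      finally have "norm (FD ?u \<sigma> 1) \<le> norm (Y (v \<sigma>) - Y (cproj J (v \<sigma>)))"
        using norm_diff_cproj_le by metis
      also have "\<dots> \<le> K * norm (?u \<sigma>)" using K(2) vb pb by blast
      finally show "norm (FD ?u \<sigma> 1) \<le> K * norm (?u \<sigma>)" .
    qed simp
    then have "\<phi> (?c s) \<in> coord_plane J" by (simp add: cproj_plane_iff v_def)
    then show "cflow X s z \<in> M" using MJ in1(2)[OF s] by blast
  qed
qed

text \<open>In a chart the derivative of \<phi> \<circ> G takes values in the coordinate plane, so
  the derivative of G factors through a space of dimension at most e.\<close>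

lemma rank_le_of_image_in_submanifold:
  fixes G :: "complex ^ 'q \<Rightarrow> complex ^ 'n"
  assumes M: "csubmanifold M e" and W: "open W" and G: "cholo W G" and GM: "G ` W \<subseteq> M" and x: "x \<in> W"
  shows "vec.dim (range (FD G x)) \<le> e"
proof -
  have "G x \<in> M" using GM x by blast
  then show ?thesis
  proof (rule csubmanifold_chart[OF M])
    fix U and \<phi> \<psi> :: "complex ^ 'n \<Rightarrow> complex ^ 'n" and J :: "'n set"
    assume U: "open U" "G x \<in> U" "open (\<phi> ` U)" "cholo U \<phi>" "cholo (\<phi> ` U) \<psi>"
      and inv: "\<forall>z\<in>U. \<psi> (\<phi> z) = z" and J: "card J = e" and MJ: "\<forall>z\<in>U. z \<in> M \<longleftrightarrow> \<phi> z \<in> coord_plane J"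
    have N: "open (W \<inter> G -` U)" by (rule continuous_open_preimage[OF cholo_continuous_on[OF G] W U(1)])
    have xN: "x \<in> W \<inter> G -` U" using x U(2) by simp
    have h: "((\<lambda>x. \<phi> (G x)) has_derivative (\<lambda>v. FD \<phi> (G x) (FD G x v))) (at x)"
      by (rule has_derivative_compose[OF cholo_has_derivative[OF G x] cholo_has_derivative[OF U(4,2)]])
    have pl: "FD \<phi> (G x) (FD G x v) \<in> coord_plane J" for v
      by (rule derivative_in_plane[OF h N xN]) (use GM MJ in auto)
    have \<phi>x: "\<phi> (G x) \<in> \<phi> ` U" using U(2) by blast
    have "((\<lambda>x. \<psi> (\<phi> (G x))) has_derivative (\<lambda>v. FD \<psi> (\<phi> (G x)) (FD \<phi> (G x) (FD G x v)))) (at x)"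
      by (rule has_derivative_compose[OF h cholo_has_derivative[OF U(5) \<phi>x]])
    then have "(G has_derivative (\<lambda>v. FD \<psi> (\<phi> (G x)) (FD \<phi> (G x) (FD G x v)))) (at x)"
      by (rule has_derivative_transform_within_open[OF _ N xN]) (use inv in auto)
    then have "FD G x = (\<lambda>v. FD \<psi> (\<phi> (G x)) (FD \<phi> (G x) (FD G x v)))" by (rule FD_eq)
    then have "range (FD G x) \<subseteq> FD \<psi> (\<phi> (G x)) ` coord_plane J"
      using pl by (metis (no_types, lifting) image_eqI image_subsetI)
    then have "vec.dim (range (FD G x)) \<le> vec.dim (FD \<psi> (\<phi> (G x)) ` coord_plane J)"
      by (rule vec.dim_subset)
    also have "\<dots> \<le> vec.dim (coord_plane J)" by (rule vec.dim_image_le[OF vec_linear_FD[OF U(5) \<phi>x]])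
    also have "\<dots> \<le> e" using dim_coord_plane_le J by metis
    finally show ?thesis .
  qed
qed

text \<open>Rank e into a manifold of dimension e means that G, seen in the chart, is a submersion
  onto the coordinate plane; openness inside M is deduced from an open mapping theorem in
  C^n.\<close>

lemma submersion_open_in_submanifold:
  fixes G :: "complex ^ 'q \<Rightarrow> complex ^ 'n"
  assumes M: "csubmanifold M e" and W: "open W" and G: "cholo W G" and GM: "G ` W \<subseteq> M" and x0: "x0 \<in> W"
    and e: "e \<le> vec.dim (range (FD G x0))"
  shows "\<exists>V. open V \<and> G x0 \<in> V \<and> M \<inter> V \<subseteq> G ` W"
proof -
  have "G x0 \<in> M" using GM x0 by blast
  then show ?thesis
  proof (rule csubmanifold_chart[OF M])
    fix U and \<phi> \<psi> :: "complex ^ 'n \<Rightarrow> complex ^ 'n" and J :: "'n set"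
    assume U: "open U" "G x0 \<in> U" "open (\<phi> ` U)" "cholo U \<phi>" "cholo (\<phi> ` U) \<psi>"
      and inv: "\<forall>z\<in>U. \<psi> (\<phi> z) = z" and J: "card J = e" and MJ: "\<forall>z\<in>U. z \<in> M \<longleftrightarrow> \<phi> z \<in> coord_plane J"
    define N where "N = W \<inter> G -` U"
    have N: "open N" unfolding N_def by (rule continuous_open_preimage[OF cholo_continuous_on[OF G] W U(1)])
    have xN: "x0 \<in> N" using x0 U(2) by (simp add: N_def)
    define h where "h x = \<phi> (G x)" for x
    have h: "cholo N h" unfolding h_def
      by (rule cholo_compose[OF cholo_subset[OF G] U(4)]) (auto simp: N_def)
    note hd = cholo_has_derivative[OF h xN]
    have hpl: "h x \<in> coord_plane J" if "x \<in> N" for x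
      using that GM MJ unfolding h_def N_def by blast
    have pl: "FD h x0 v \<in> coord_plane J" for v
      by (rule derivative_in_plane[OF hd N xN hpl])
    have \<phi>x: "h x0 \<in> \<phi> ` U" using U(2) by (auto simp: h_def)
    have "((\<lambda>x. \<psi> (h x)) has_derivative (\<lambda>v. FD \<psi> (h x0) (FD h x0 v))) (at x0)"
      by (rule has_derivative_compose[OF hd cholo_has_derivative[OF U(5) \<phi>x]])
    then have "(G has_derivative (\<lambda>v. FD \<psi> (h x0) (FD h x0 v))) (at x0)"
      by (rule has_derivative_transform_within_open[OF _ N xN]) (use inv in \<open>auto simp: h_def N_def\<close>)
    then have "FD G x0 = (\<lambda>v. FD \<psi> (h x0) (FD h x0 v))" by (rule FD_eq)
    then have "range (FD G x0) = FD \<psi> (h x0) ` range (FD h x0)" by (simp add: image_image)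
    then have "e \<le> vec.dim (range (FD h x0))"
      using e vec.dim_image_le[OF vec_linear_FD[OF U(5) \<phi>x], of "range (FD h x0)"] by simp
    then have "vec.dim (coord_plane J) \<le> vec.dim (range (FD h x0))"
      using dim_coord_plane_le[of J] J by simp
    moreover have "vec.subspace (range (FD h x0))"
      unfolding range_FD_eq_span[OF h xN] by (rule vec.subspace_span)
    ultimately have rh: "range (FD h x0) = coord_plane J"
      using pl by (intro vec.subspace_dim_equal coord_plane_subspace) auto
    \<comment> \<open>An auxiliary variable fills the directions transverse to the plane, so that f
      is a submersion onto all of C^n and maps onto a neighbourhood of h x0.\<close>
    define f where "f p = h (fst p) + (snd p - cproj J (snd p))" for p :: "(complex ^ 'q) \<times> (complex ^ 'n)"
    define f' where "f' p = FD h x0 (fst p) + (snd p - cproj J (snd p))" for p :: "(complex ^ 'q) \<times> (complex ^ 'n)"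
    have f: "cholo (N \<times> UNIV) f" unfolding f_def
      by (intro cholo_add cholo_diff cholo_snd cholo_compose[OF cholo_fst h] cholo_compose[OF cholo_snd cproj_lin(1)[of UNIV]]) auto
    have der: "(f has_derivative f') (at (x0, 0))"
    proof -
      have 1: "((\<lambda>p. h (fst p)) has_derivative (\<lambda>p. FD h x0 (fst p))) (at (x0, 0))"
        by (rule has_derivative_compose[OF bounded_linear_imp_has_derivative[OF bounded_linear_fst]]) (simp add: hd)
      have 2: "((\<lambda>p. cproj J (snd p)) has_derivative (\<lambda>p. cproj J (snd p))) (at (x0, 0))"
        by (rule has_derivative_compose[OF bounded_linear_imp_has_derivative[OF bounded_linear_snd] cproj_lin(2)])
      show ?thesis unfolding f_def[abs_def] f'_def[abs_def]
        by (intro has_derivative_add has_derivative_diff 1 2 bounded_linear_imp_has_derivative[OF bounded_linear_snd])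
    qed
    have lin: "linear f'" using has_derivative_linear[OF der] .
    have "surj f'"
    proof (rule surjI)
      fix y :: "complex ^ 'n"
      have "cproj J y \<in> range (FD h x0)" by (simp add: rh)
      then have "\<exists>v. cproj J y = FD h x0 v" by auto
      then show "f' (SOME v. cproj J y = FD h x0 v, y) = y"
        unfolding f'_def by (simp add: someI_ex[of "\<lambda>v. cproj J y = FD h x0 v", symmetric])
    qed
    then obtain g' where g': "linear g'" "f' \<circ> g' = id"
      using linear_surjective_right_inverse[OF lin] by blast
    have opN: "open (N \<times> (UNIV :: (complex ^ 'n) set))" by (intro open_Times N open_UNIV)
    have "f (x0, 0) \<in> interior (f ` (N \<times> UNIV))"
    proof (rule sussmann_open_mapping[OF opN cholo_continuous_on[OF f] _ der _ g'(2)])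
      show "bounded_linear g'" using g'(1) by (simp add: linear_conv_bounded_linear)
      show "(x0, 0) \<in> interior (N \<times> (UNIV :: (complex ^ 'n) set))" using opN xN by (simp add: interior_open)
    qed (use xN in auto)
    moreover have f0: "f (x0, 0) = h x0" by (simp add: f_def cproj_def vec_eq_iff)
    ultimately have I: "h x0 \<in> interior (f ` (N \<times> UNIV))" by simp
    define V where "V = U \<inter> \<phi> -` interior (f ` (N \<times> UNIV))"
    have "open V" unfolding V_def by (rule continuous_open_preimage[OF cholo_continuous_on[OF U(4)] U(1) open_interior])
    moreover have "G x0 \<in> V" using U(2) I by (simp add: V_def h_def)
    moreover have "M \<inter> V \<subseteq> G ` W"
    proof
      fix z assume z: "z \<in> M \<inter> V"
      then have "\<phi> z \<in> f ` (N \<times> UNIV)" using interior_subset by (auto simp: V_def)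
      then obtain x u where xu: "x \<in> N" "\<phi> z = h x + (u - cproj J u)" by (auto simp: f_def)
      have zpl: "\<phi> z \<in> coord_plane J" using z MJ by (auto simp: V_def)
      \<comment> \<open>For a point of M both chart values lie in the plane, so the transverse
        contribution equals its own projection to the plane, which is 0. The point then comes from G
        alone.\<close>
      have "u - cproj J u = \<phi> z - h x" using xu(2) by simp
      also have "\<dots> = cproj J (\<phi> z - h x)" by (simp add: cproj_diff cproj_plane[OF zpl] cproj_plane[OF hpl[OF xu(1)]])
      also have "\<dots> = cproj J (u - cproj J u)" using xu(2) by simp
      also have "\<dots> = 0" by (simp add: vec_eq_iff)
      finally have "\<phi> z = \<phi> (G x)" using xu(2) by (simp add: h_def)
      then have "z = G x" using inv z xu(1) unfolding V_def N_def by (metis IntE vimageE)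
      then show "z \<in> G ` W" using xu(1) by (auto simp: N_def)
    qed
    ultimately show ?thesis by blast
  qed
qed

context flow_system
begin

text \<open>The radius is uniform over all words and all lengths: it is a minimum over the finitely
  many fields, and the intermediate points are held near q by the total distance
  \<open>tz k t\<close>.\<close>

lemma flowk_stays:
  assumes M: "csubmanifold M e" and q: "q \<in> M" "norm q < R" and tan: "system_tangent S a m M"
  shows "\<exists>\<rho>>0. \<forall>seq k t z. word seq k \<longrightarrow> z \<in> M \<longrightarrow> dist z q + tz k t < \<rho> \<longrightarrow> norm z + tz k t < R \<longrightarrow>
    (\<forall>i<k. \<forall>j<m. norm (t i j) < \<rho>) \<longrightarrow> flowk S m seq k t z \<in> M"
proof -
  have "\<exists>\<rho>>0. \<forall>z\<in>M. \<forall>s. dist z q < \<rho> \<longrightarrow> norm s < \<rho> \<longrightarrow> cflow (S \<alpha> j) s z \<in> M" if "\<alpha> < a" "j < m" for \<alpha> j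
    by (rule flow_stays_in_submanifold[OF fb[OF that] M q]) (use tan that in \<open>auto simp: system_tangent_def\<close>)
  then have "\<forall>p\<in>{..<a} \<times> {..<m}. \<exists>\<rho>>0. \<forall>z\<in>M. \<forall>s. dist z q < \<rho> \<longrightarrow> norm s < \<rho> \<longrightarrow> cflow (S (fst p) (snd p)) s z \<in> M"
    by auto
  then obtain \<rho> where \<rho>: "\<And>p. p \<in> {..<a} \<times> {..<m} \<Longrightarrow> \<rho> p > 0"
    "\<And>p z s. p \<in> {..<a} \<times> {..<m} \<Longrightarrow> z \<in> M \<Longrightarrow> dist z q < \<rho> p \<Longrightarrow> norm s < \<rho> p \<Longrightarrow> cflow (S (fst p) (snd p)) s z \<in> M"
    by metis
  \<comment> \<open>The element 1 keeps the minimum defined when there are no fields.\<close>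
  define \<rho>0 where "\<rho>0 = Min (insert 1 (\<rho> ` ({..<a} \<times> {..<m})))"
  have \<rho>0: "\<rho>0 > 0" using \<rho>(1) by (auto simp: \<rho>0_def)
  have le: "\<rho>0 \<le> \<rho> (\<alpha>, j)" if "\<alpha> < a" "j < m" for \<alpha> j
    unfolding \<rho>0_def using that by (intro Min_le) auto
  have step: "cflow (S \<alpha> j) s z \<in> M" if "\<alpha> < a" "j < m" "z \<in> M" "dist z q < \<rho>0" "norm s < \<rho>0" for \<alpha> j s z
    using \<rho>(2)[of "(\<alpha>, j)" z s] le[OF that(1,2)] that by simp
  have mf: "mflow (S \<alpha>) l s z \<in> M"
    if "\<alpha> < a" "l \<le> m" "z \<in> M" "dist z q + C * (\<Sum>j<l. norm (s j)) < \<rho>0" "norm z + C * (\<Sum>j<l. norm (s j)) < R"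
      "\<forall>j<l. norm (s j) < \<rho>0" for \<alpha> l s z
    using that
  proof (induction l)
    case (Suc l)
    interpret L: commuting_flows "S \<alpha>" m R C by (rule commuting) fact
    have nn: "0 \<le> C * norm (s l)" using C_pos by simp
    have b: "dist z q + C * (\<Sum>j<l. norm (s j)) < \<rho>0" "norm z + C * (\<Sum>j<l. norm (s j)) < R"
      using Suc.prems(4,5) nn by (auto simp: distrib_left)
    have "mflow (S \<alpha>) l s z \<in> M" by (rule Suc.IH) (use Suc.prems b in auto)
    moreover have "dist (mflow (S \<alpha>) l s z) q < \<rho>0"
      using L.mflow_dist[OF _ b(2)] Suc.prems(2) b(1) dist_triangle[of "mflow (S \<alpha>) l s z" q z]
      by (simp add: dist_norm)
    ultimately show ?case using Suc.prems by (auto intro!: step)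
  qed simp
  have "flowk S m seq k t z \<in> M"
    if "word seq k" "z \<in> M" "dist z q + tz k t < \<rho>0" "norm z + tz k t < R" "\<forall>i<k. \<forall>j<m. norm (t i j) < \<rho>0" for seq k t z
    using that
  proof (induction k)
    case (Suc k)
    have nn: "0 \<le> C * (\<Sum>j<m. norm (t k j))" by (rule last_nonneg)
    have b: "dist z q + tz k t < \<rho>0" "norm z + tz k t < R" and wk: "word seq k"
      using Suc.prems(1,3,4) nn by (auto simp: tz_Suc word_def)
    let ?w = "flowk S m seq k t z"
    have d: "norm (?w - z) \<le> tz k t" by (rule flowk_dist[OF wk b(2)])
    have "?w \<in> M" by (rule Suc.IH[OF wk]) (use Suc.prems b in auto)
    moreover have "dist ?w q + C * (\<Sum>j<m. norm (t k j)) < \<rho>0"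
      using Suc.prems(3) d dist_triangle[of ?w q z] by (simp add: dist_norm tz_Suc)
    moreover have "norm ?w + C * (\<Sum>j<m. norm (t k j)) < R"
      using Suc.prems(4) d norm_triangle_sub[of ?w z] by (simp add: tz_Suc)
    ultimately show ?case using Suc.prems by (auto intro!: mf simp: word_def)
  qed simp
  then show ?thesis using \<rho>0 by blast
qed

end

section \<open>Partial derivatives of \<open>\<Gamma>\<close>\<close>

lemma pupd_same [simp]: "pupd t i j (t i j) = t"
  by (simp add: pupd_def)

lemma pupd_apply: "pupd t i j w i' j' = (if i' = i \<and> j' = j then w else t i' j')"
  by (simp add: pupd_def)

lemma cpartial_cong:
  assumes "\<And>w. F (pupd t i j w) = F' (pupd t' i j w)" "t i j = t' i j"
  shows "cpartial F t i j = cpartial F' t' i j"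
  unfolding cpartial_def using assms by simp

context flow_system
begin

lemma tz_cong: "(\<And>i j. i < k \<Longrightarrow> j < m \<Longrightarrow> t i j = t' i j) \<Longrightarrow> tz k t = tz k t'"
  by (simp add: tz_def)

lemma continuous_on_tz:
  assumes "\<And>i j. i < k \<Longrightarrow> j < m \<Longrightarrow> continuous_on A (\<lambda>x. P x i j)"
  shows "continuous_on A (\<lambda>x. tz k (P x))"
  unfolding tz_def using assms by (intro continuous_intros) auto

lemma continuous_on_tz_pupd: "continuous_on UNIV (\<lambda>w. tz k (pupd t i j w))"
proof (rule continuous_on_tz)
  fix i' j' show "continuous_on UNIV (\<lambda>w. pupd t i j w i' j')"
    by (cases "i' = i \<and> j' = j") (auto simp: pupd_apply)
qed

lemma Gam_has_derivative:
  assumes w: "word seq k" and t: "tz k t < R"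
  shows "((\<lambda>w. Gam S m seq k (pupd t i j w)) has_derivative
    (\<lambda>h. h *\<^sub>C cpartial (Gam S m seq k) t i j)) (at (t i j))"
proof (rule cpartial_eqI(2))
  let ?U = "{w. tz k (pupd t i j w) < R}"
  show "open ?U" by (intro open_Collect_less continuous_on_tz_pupd continuous_on_const)
  show "cholo ?U (\<lambda>w. Gam S m seq k (pupd t i j w))"
    unfolding Gam_def
  proof (intro flowk_cholo w cholo_const)
    fix i' j' show "cholo ?U (\<lambda>w. pupd t i j w i' j')"
      by (cases "i' = i \<and> j' = j") (auto simp: pupd_apply)
  qed simp
qed (use t in simp_all)

text \<open>All partial derivatives after one more block are images under the derivative of the
  single map F given by that block. For the times of the block itself this is
  \<open>mflow_upd\<close>, hence an effect of commutativity.\<close>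

lemma cpartial_Gam_Suc:
  fixes t seq k
  defines "F \<equiv> mflow (S (seq k)) m (t k)" and "z \<equiv> Gam S m seq k t"
  assumes w: "word seq (Suc k)" and t: "tz (Suc k) t < R"
  shows "norm z + C * (\<Sum>j<m. norm (t k j)) < R"
    and "cholo {z. norm z + C * (\<Sum>j<m. norm (t k j)) < R} F"
    and "\<And>i j. i < k \<Longrightarrow> cpartial (Gam S m seq (Suc k)) t i j = FD F z (cpartial (Gam S m seq k) t i j)"
    and "\<And>j. j < m \<Longrightarrow> cpartial (Gam S m seq (Suc k)) t k j = FD F z (S (seq k) j z)"
proof -
  interpret L: commuting_flows "S (seq k)" m R C
    by (rule commuting) (use w in \<open>simp add: word_def\<close>)
  have wk: "word seq k" using w by (simp add: word_def)
  let ?U = "{z :: complex ^ 'n. norm z + C * (\<Sum>j<m. norm (t k j)) < R}"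
  have tk: "tz k t < R" using t last_nonneg[of t k] by (simp add: tz_Suc)
  have z: "norm z \<le> tz k t"
    using flowk_norm[OF wk, of 0 t] tk by (simp add: z_def Gam_def)
  then show zU: "norm z + C * (\<Sum>j<m. norm (t k j)) < R" using t by (simp add: tz_Suc)
  show F: "cholo ?U F" unfolding F_def by (rule L.mflow_cholo) auto
  have zU': "z \<in> ?U" using zU by simp
  have dF: "(F has_derivative FD F z) (at z)" by (rule cholo_has_derivative[OF F zU'])
  show "cpartial (Gam S m seq (Suc k)) t i j = FD F z (cpartial (Gam S m seq k) t i j)" if i: "i < k" for i j
  proof (rule cpartialI)
    have "(F has_derivative FD F z) (at (Gam S m seq k (pupd t i j (t i j))))"
      using dF by (simp add: z_def)
    from has_derivative_compose[OF Gam_has_derivative[OF wk tk] this]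
    have "((\<lambda>w. F (Gam S m seq k (pupd t i j w))) has_derivative
        (\<lambda>h. h *\<^sub>C FD F z (cpartial (Gam S m seq k) t i j))) (at (t i j))"
      by (simp add: cholo_FD_cscale[OF F zU'])
    moreover have "Gam S m seq (Suc k) (pupd t i j w) = F (Gam S m seq k (pupd t i j w))" for w
      using i by (simp add: Gam_def F_def pupd_def)
    ultimately show "((\<lambda>w. Gam S m seq (Suc k) (pupd t i j w)) has_derivative
        (\<lambda>h. h *\<^sub>C FD F z (cpartial (Gam S m seq k) t i j))) (at (t i j))"
      by simp
  qed
  show "cpartial (Gam S m seq (Suc k)) t k j = FD F z (S (seq k) j z)" if j: "j < m" for j
  proof (rule cpartialI)
    let ?X = "S (seq k) j"
    let ?N = "{w. norm z + C * ((\<Sum>j<m. norm (t k j)) + norm (w - t k j)) < R}"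
    have zR: "norm z < R" using zU mult_nonneg_nonneg[OF less_imp_le[OF C_pos] sum_nonneg[of "{..<m}" "\<lambda>j. norm (t k j)"]] by simp
    have fbj: "flow_box ?X R C" using w j by (intro fb) (auto simp: word_def)
    have c0: "cflow ?X 0 z = z" by (rule flow_box.cflow_0[OF fbj zR])
    have 1: "((\<lambda>w. w - t k j) has_derivative (\<lambda>h. h)) (at (t k j))"
      by (rule has_derivative_eq_rhs[OF has_derivative_diff[OF has_derivative_ident has_derivative_const]]) simp
    have "((\<lambda>\<sigma>. cflow ?X \<sigma> z) has_derivative (\<lambda>h. h *\<^sub>C ?X (cflow ?X 0 z))) (at 0)"
      by (rule flow_box.cflow_deriv[OF fbj]) (simp add: flow_box.fdom_def[OF fbj] zR)
    then have 2: "((\<lambda>\<sigma>. cflow ?X \<sigma> z) has_derivative (\<lambda>h. h *\<^sub>C ?X z)) (at (t k j - t k j))"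
      by (simp add: c0)
    have 3: "(F has_derivative FD F z) (at (cflow ?X (t k j - t k j) z))"
      using dF by (simp add: c0)
    have "((\<lambda>w. F (cflow ?X (w - t k j) z)) has_derivative (\<lambda>h. h *\<^sub>C FD F z (?X z))) (at (t k j))"
      using has_derivative_compose[OF has_derivative_compose[OF 1 2] 3]
      by (simp add: cholo_FD_cscale[OF F zU'])
    then show "((\<lambda>w. Gam S m seq (Suc k) (pupd t k j w)) has_derivative (\<lambda>h. h *\<^sub>C FD F z (?X z))) (at (t k j))"
    proof (rule has_derivative_transform_within_open)
      show "open ?N" by (intro open_Collect_less continuous_intros)
      show "t k j \<in> ?N" using zU by simp
      fix w' assume "w' \<in> ?N"
      then have bd: "norm z + C * ((\<Sum>j<m. norm (t k j)) + norm (w' - t k j)) < R" by simp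
      have "flowk S m seq k (pupd t k j w') 0 = z"
        unfolding z_def Gam_def by (rule flowk_cong) (auto simp: pupd_apply)
      then have "Gam S m seq (Suc k) (pupd t k j w') = mflow (S (seq k)) m ((t k)(j := t k j + (w' - t k j))) z"
        by (simp add: Gam_def pupd_def)
      also have "\<dots> = F (cflow ?X (w' - t k j) z)"
        unfolding F_def by (rule L.mflow_upd[OF j order_refl bd])
      finally show "F (cflow ?X (w' - t k j) z) = Gam S m seq (Suc k) (pupd t k j w')" by simp
    qed
  qed
qed

text \<open>A block with zero times is the identity near z, so appending it keeps the old partial
  derivatives and adds exactly the values of its fields. This is how bounds on the rank of a longer
  word become tangency statements.\<close>

lemma cpartial_Gam_Suc_zero:
  assumes w: "word seq (Suc k)" and t: "tz k t < R" and tk: "\<And>j. j < m \<Longrightarrow> t k j = 0"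
  shows "\<And>i j. i < k \<Longrightarrow> cpartial (Gam S m seq (Suc k)) t i j = cpartial (Gam S m seq k) t i j"
    and "\<And>j. j < m \<Longrightarrow> cpartial (Gam S m seq (Suc k)) t k j = S (seq k) j (Gam S m seq k t)"
proof -
  let ?z = "Gam S m seq k t" and ?F = "mflow (S (seq k)) m (t k)"
  have t': "tz (Suc k) t < R" using t tk by (simp add: tz_Suc)
  have zR: "norm ?z < R" using cpartial_Gam_Suc(1)[OF w t'] tk by simp
  have "(?F has_derivative (\<lambda>v. v)) (at ?z)"
  proof (rule has_derivative_transform_within_open[OF has_derivative_ident open_ball[of 0 R]])
    show "?z \<in> ball 0 R" using zR by simp
    show "x = ?F x" if "x \<in> ball 0 R" for x
      by (rule commuting_flows.mflow_zero[OF commuting, symmetric]) (use w that tk in \<open>auto simp: word_def\<close>)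
  qed
  then have id: "FD ?F ?z = (\<lambda>v. v)" by (rule FD_eq)
  show "cpartial (Gam S m seq (Suc k)) t i j = cpartial (Gam S m seq k) t i j" if "i < k" for i j
    using cpartial_Gam_Suc(3)[OF w t' that] by (simp add: id)
  show "cpartial (Gam S m seq (Suc k)) t k j = S (seq k) j ?z" if "j < m" for j
    using cpartial_Gam_Suc(4)[OF w t' that] by (simp add: id)
qed

text \<open>Commutativity makes the rank of \<open>\<Gamma>\<close> insensitive to the last time block, which is why that block
  may be taken to be zero.\<close>

lemma rank_at_zero_last:
  assumes w: "word seq (Suc k)" and t: "tz (Suc k) t < R"
  shows "rank_at (Suc k) m (Gam S m seq (Suc k)) t \<le> rank_at (Suc k) m (Gam S m seq (Suc k)) (t(k := \<lambda>_. 0))"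
proof -
  let ?t = "t(k := \<lambda>_. 0)" and ?F = "mflow (S (seq k)) m (t k)" and ?z = "Gam S m seq k t"
  have z: "Gam S m seq k ?t = ?z" unfolding Gam_def by (rule flowk_cong) auto
  have c: "cpartial (Gam S m seq k) ?t i j = cpartial (Gam S m seq k) t i j" if "i < k" for i j
    by (rule cpartial_cong) (use that in \<open>auto simp: Gam_def pupd_apply intro!: flowk_cong\<close>)
  have "tz k ?t = tz k t" by (rule tz_cong) auto
  then have "tz k ?t < R" using t last_nonneg[of t k] by (simp add: tz_Suc)
  note zero = cpartial_Gam_Suc_zero[OF w this]
  note F = cpartial_Gam_Suc[OF w t]
  have "cpartial (Gam S m seq (Suc k)) t i j = FD ?F ?z (cpartial (Gam S m seq (Suc k)) ?t i j)"
    if "i < Suc k" "j < m" for i j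
  proof (cases "i = k")
    case True
    then show ?thesis using F(4)[OF that(2)] zero(2)[OF _ that(2)] by (simp add: z)
  next
    case False
    then have "i < k" using that by simp
    then show ?thesis using F(3) zero(1) c by simp
  qed
  then have "{cpartial (Gam S m seq (Suc k)) t i j | i j. i < Suc k \<and> j < m} \<subseteq>
      FD ?F ?z ` {cpartial (Gam S m seq (Suc k)) ?t i j | i j. i < Suc k \<and> j < m}"
    by fastforce
  then have "rank_at (Suc k) m (Gam S m seq (Suc k)) t \<le>
      vec.dim (FD ?F ?z ` {cpartial (Gam S m seq (Suc k)) ?t i j | i j. i < Suc k \<and> j < m})"
    unfolding rank_at_def by (rule vec.dim_subset)
  also have "\<dots> \<le> rank_at (Suc k) m (Gam S m seq (Suc k)) ?t"
    unfolding rank_at_def using F(1) by (intro vec.dim_image_le vec_linear_FD[OF F(2)]) simp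
  finally show ?thesis .
qed

end

section \<open>Time parameters as coordinates of a complex Euclidean space\<close>

definition par :: "(nat \<Rightarrow> nat \<Rightarrow> 'q) \<Rightarrow> complex ^ 'q \<Rightarrow> nat \<Rightarrow> nat \<Rightarrow> complex" where
  "par idx x = (\<lambda>i j. x $ idx i j)"

lemma par_apply [simp]: "par idx x i j = x $ idx i j"
  by (simp add: par_def)

text \<open>A parameter t has entries for all pairs of natural numbers, but a word reads finitely
  many. This property lets t be replaced by any parameter with the same entries below k and m, in
  particular by one that comes from a vector.\<close>

definition depends_on :: "nat \<Rightarrow> nat \<Rightarrow> ((nat \<Rightarrow> nat \<Rightarrow> complex) \<Rightarrow> 'b) \<Rightarrow> bool" where
  "depends_on k m F \<longleftrightarrow> (\<forall>t t'. (\<forall>i<k. \<forall>j<m. t i j = t' i j) \<longrightarrow> F t = F t')"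

lemma depends_onD: "depends_on k m F \<Longrightarrow> (\<And>i j. i < k \<Longrightarrow> j < m \<Longrightarrow> t i j = t' i j) \<Longrightarrow> F t = F t'"
  unfolding depends_on_def by blast

lemma depends_on_Gam: "depends_on k m (Gam S m seq k)"
  unfolding depends_on_def Gam_def by (auto intro!: flowk_cong)

lemma rank_at_cong:
  assumes F: "depends_on k m F" and t: "\<And>i j. i < k \<Longrightarrow> j < m \<Longrightarrow> t i j = t' i j"
  shows "rank_at k m F t = rank_at k m F t'"
proof -
  have "cpartial F t i j = cpartial F t' i j" if "i < k" "j < m" for i j
    by (rule cpartial_cong) (use that t in \<open>auto simp: pupd_apply intro!: depends_onD[OF F]\<close>)
  then have "{cpartial F t i j | i j. i < k \<and> j < m} = {cpartial F t' i j | i j. i < k \<and> j < m}"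
    by force
  then show ?thesis by (simp add: rank_at_def)
qed

text \<open>Coordinates that carry no time are copied from x0, so that a parameter close to the one
  of x0 is lifted to a vector close to x0 in all coordinates.\<close>

lemma ex_par:
  fixes idx :: "nat \<Rightarrow> nat \<Rightarrow> 'q::finite"
  assumes inj: "inj_on (case_prod idx) ({..<k} \<times> {..<m})"
  shows "\<exists>x. (\<forall>i<k. \<forall>j<m. x $ idx i j = t i j) \<and>
    (\<forall>q. q \<notin> case_prod idx ` ({..<k} \<times> {..<m}) \<longrightarrow> x $ q = x0 $ q)"
proof -
  let ?I = "{..<k} \<times> {..<m}"
  let ?x = "\<chi> q. if q \<in> case_prod idx ` ?I then case_prod t (inv_into ?I (case_prod idx) q) else x0 $ q"
  have "?x $ idx i j = t i j" if "i < k" "j < m" for i j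
  proof -
    have "(i, j) \<in> ?I" using that by simp
    then have "idx i j \<in> case_prod idx ` ?I" "inv_into ?I (case_prod idx) (case_prod idx (i, j)) = (i, j)"
      using inj by (force, intro inv_into_f_f)
    then show ?thesis by simp
  qed
  then show ?thesis by (intro exI[of _ ?x]) auto
qed

text \<open>Columns for coordinates in the image of \<open>idx\<close> are the partial derivatives,
  as injectivity ensures that each coordinate moves one time only; all other columns are 0. The rank
  in the sense of \<open>rank_at\<close> is thus the rank of an honest derivative.\<close>

lemma range_FD_par:
  fixes idx :: "nat \<Rightarrow> nat \<Rightarrow> 'q::finite" and F :: "(nat \<Rightarrow> nat \<Rightarrow> complex) \<Rightarrow> complex ^ 'n"
  defines "G \<equiv> (\<lambda>x. F (par idx x))"
  assumes inj: "inj_on (case_prod idx) ({..<k} \<times> {..<m})" and F: "depends_on k m F"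
    and G: "cholo W G" and x: "x \<in> W"
  shows "range (FD G x) = vec.span {cpartial F (par idx x) i j | i j. i < k \<and> j < m}"
proof -
  have line: "((\<lambda>w. G (x + (w - c) *\<^sub>C axis q 1)) has_derivative (\<lambda>h. h *\<^sub>C FD G x (axis q 1))) (at c)" for q and c :: complex
  proof -
    have 1: "((\<lambda>w. x + (w - c) *\<^sub>C axis q 1) has_derivative (\<lambda>h. h *\<^sub>C axis q 1)) (at c)"
      by (rule has_derivative_eq_rhs[OF has_derivative_add[OF has_derivative_const
            has_derivative_cscale[OF has_derivative_diff[OF has_derivative_ident has_derivative_const] has_derivative_const]]]) simp
    have "(G has_derivative FD G x) (at (x + (c - c) *\<^sub>C axis q 1))"
      using cholo_has_derivative[OF G x] by simp
    from has_derivative_compose[OF 1 this] show ?thesis by (simp add: cholo_FD_cscale[OF G x])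
  qed
  have col: "cpartial F (par idx x) i j = FD G x (axis (idx i j) 1)" if ij: "i < k" "j < m" for i j
  proof (rule cpartialI)
    have "F (pupd (par idx x) i j w) = G (x + (w - par idx x i j) *\<^sub>C axis (idx i j) 1)" for w
      unfolding G_def
    proof (rule depends_onD[OF F])
      fix i' j' assume ij': "i' < k" "j' < m"
      have "idx i' j' = idx i j \<longleftrightarrow> i' = i \<and> j' = j"
        using inj_onD[OF inj, of "(i', j')" "(i, j)"] ij ij' by auto
      then show "pupd (par idx x) i j w i' j' = par idx (x + (w - par idx x i j) *\<^sub>C axis (idx i j) 1) i' j'"
        by (auto simp: pupd_apply axis_def)
    qed
    then show "((\<lambda>w. F (pupd (par idx x) i j w)) has_derivative (\<lambda>h. h *\<^sub>C FD G x (axis (idx i j) 1))) (at (par idx x i j))"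
      using line[of "par idx x i j" "idx i j"] by simp
  qed
  have zero: "FD G x (axis q 1) = 0" if q: "q \<notin> case_prod idx ` ({..<k} \<times> {..<m})" for q
  proof -
    have "G (x + (w - 0) *\<^sub>C axis q 1) = G x" for w
      unfolding G_def
    proof (rule depends_onD[OF F])
      fix i j assume "i < k" "j < m"
      then have "idx i j \<noteq> q" using q by force
      then show "par idx (x + (w - 0) *\<^sub>C axis q 1) i j = par idx x i j" by (simp add: axis_def)
    qed
    then have 1: "((\<lambda>w::complex. G x) has_derivative (\<lambda>h. h *\<^sub>C FD G x (axis q 1))) (at 0)"
      using line[of 0 q] by simp
    have "1 *\<^sub>C FD G x (axis q 1) = 0"
      using has_derivative_unique[OF 1 has_derivative_const] by (rule fun_cong)
    then show ?thesis by simp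
  qed
  show ?thesis
    unfolding range_FD_eq_span[OF G x] vec.span_eq
  proof (intro conjI subsetI)
    fix v assume "v \<in> range (\<lambda>q. FD G x (axis q 1))"
    then obtain q where v: "v = FD G x (axis q 1)" by auto
    show "v \<in> vec.span {cpartial F (par idx x) i j | i j. i < k \<and> j < m}"
    proof (cases "q \<in> case_prod idx ` ({..<k} \<times> {..<m})")
      case True
      then obtain i j where "i < k" "j < m" "q = idx i j" by auto
      then have "v = cpartial F (par idx x) i j" using col v by simp
      then show ?thesis using \<open>i < k\<close> \<open>j < m\<close> by (intro vec.span_base) blast
    next
      case False
      then show ?thesis using zero v vec.span_zero by simp
    qed
  next
    fix v assume "v \<in> {cpartial F (par idx x) i j | i j. i < k \<and> j < m}"
    then show "v \<in> vec.span (range (\<lambda>q. FD G x (axis q 1)))"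
      using col by (auto intro!: vec.span_base)
  qed
qed

lemma rank_at_par:
  fixes idx :: "nat \<Rightarrow> nat \<Rightarrow> 'q::finite" and F :: "(nat \<Rightarrow> nat \<Rightarrow> complex) \<Rightarrow> complex ^ 'n"
  assumes "inj_on (case_prod idx) ({..<k} \<times> {..<m})" "depends_on k m F"
    "cholo W (\<lambda>x. F (par idx x))" "x \<in> W"
  shows "rank_at k m F (par idx x) = vec.dim (range (FD (\<lambda>x. F (par idx x)) x))"
  unfolding range_FD_par[OF assms] rank_at_def by (simp add: vec.dim_span)

lemma ctangent_image:
  fixes G :: "complex ^ 'q \<Rightarrow> complex ^ 'n"
  assumes W: "open W" and G: "cholo W G" and x: "x \<in> W" and v: "v \<in> range (FD G x)"
  shows "v \<in> ctangent (G ` W) (G x)"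
proof -
  obtain u where u: "v = FD G x u" using v by auto
  let ?l = "\<lambda>\<sigma>::complex. x + \<sigma> *\<^sub>C u"
  have l: "(?l has_derivative (\<lambda>h. h *\<^sub>C u)) (at \<sigma>)" for \<sigma>
    by (rule has_derivative_eq_rhs[OF has_derivative_add[OF has_derivative_const
          has_derivative_cscale[OF has_derivative_ident has_derivative_const]]]) simp
  have "open (?l -` W)" by (rule open_vimage[OF W]) (intro continuous_intros)
  moreover have "0 \<in> ?l -` W" using x by simp
  ultimately obtain r where r: "r > 0" "ball 0 r \<subseteq> ?l -` W" using open_contains_ball by blast
  have in_W: "?l \<sigma> \<in> W" if "norm \<sigma> < r" for \<sigma>
    using r(2) that by (auto simp: subset_iff)
  have der: "((\<lambda>\<sigma>. G (?l \<sigma>)) has_derivative (\<lambda>h. h *s FD G (?l \<sigma>) u)) (at \<sigma>)" if "norm \<sigma> < r" for \<sigma>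
  proof -
    have "((\<lambda>\<sigma>. G (?l \<sigma>)) has_derivative (\<lambda>h. h *\<^sub>C FD G (?l \<sigma>) u)) (at \<sigma>)"
      using has_derivative_compose[OF l cholo_has_derivative[OF G in_W[OF that]]]
      by (simp add: cholo_FD_cscale[OF G in_W[OF that]])
    then show ?thesis by (simp add: cscale_eq_vector_scalar_mult)
  qed
  show ?thesis
    unfolding ctangent_def
  proof (intro CollectI exI conjI)
    show "r > 0" by fact
    show "G (?l 0) = G x" by simp
    show "\<forall>\<sigma>. norm \<sigma> < r \<longrightarrow> G (?l \<sigma>) \<in> G ` W" using in_W by blast
    show "\<forall>\<sigma>. norm \<sigma> < r \<longrightarrow> (\<exists>D. ((\<lambda>\<sigma>. G (?l \<sigma>)) has_derivative (\<lambda>h. h *s D)) (at \<sigma>))"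
      using der by blast
    show "((\<lambda>\<sigma>. G (?l \<sigma>)) has_derivative (\<lambda>h. h *s v)) (at 0)"
      using der[of 0] r(1) u by simp
  qed
qed

section \<open>The orbit of the origin\<close>

definition cube :: "complex ^ 'q \<Rightarrow> real \<Rightarrow> (complex ^ 'q) set" where
  "cube x r = {y. \<forall>q. norm (y $ q - x $ q) < r}"

lemma open_cube: "open (cube (x :: complex ^ 'q) r)"
proof -
  have "cube x r = (\<Inter>q. (\<lambda>y. norm (y $ q - x $ q)) -` {..<r})" by (auto simp: cube_def)
  moreover have "open ((\<lambda>y :: complex ^ 'q. norm (y $ q - x $ q)) -` {..<r})" for q
    by (intro open_vimage continuous_intros open_lessThan)
  ultimately show ?thesis by (simp only:) (intro open_INT ballI, auto)
qed

lemma cube_subset_open: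
  assumes "open (W :: (complex ^ 'q) set)" "x \<in> W"
  obtains r where "r > 0" "cube x r \<subseteq> W"
proof -
  obtain e where e: "e > 0" "ball x e \<subseteq> W" using assms open_contains_ball by blast
  let ?r = "e / CARD('q)"
  have "cube x ?r \<subseteq> ball x e"
  proof
    fix y assume y: "y \<in> cube x ?r"
    have "norm (y - x) \<le> (\<Sum>q\<in>UNIV. norm ((y - x) $ q))"
      unfolding norm_vec_def by (rule L2_set_le_sum) simp
    also have "\<dots> < (\<Sum>q\<in>(UNIV::'q set). ?r)"
      by (rule sum_strict_mono) (use y in \<open>auto simp: cube_def\<close>)
    finally show "y \<in> ball x e" by (simp add: dist_norm norm_minus_commute)
  qed
  then show ?thesis using e by (intro that[of ?r]) auto
qed

lemma cube_center: "r > 0 \<Longrightarrow> x \<in> cube x r"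
  by (simp add: cube_def)

text \<open>A completed run with p + 1 = a + \<kappa> blocks and final rank e. The index map has
  room for 2(p + 1) blocks: the run, its reversal of p blocks and one appended field. The bound R/4
  on displacements allows going out, back, and forward again inside the ball of radius R.\<close>

locale flow_run = flow_system S a m R C
  for S :: "nat \<Rightarrow> nat \<Rightarrow> complex ^ 'n \<Rightarrow> complex ^ 'n" and a m R C +
  fixes idx :: "nat \<Rightarrow> nat \<Rightarrow> 'q::finite" and \<delta> :: real and seq :: "nat \<Rightarrow> nat" and p e :: nat
  assumes \<delta>_pos: "0 < \<delta>"
    and small: "\<And>k t. k \<le> 3 * CARD('n) \<Longrightarrow> t \<in> ppoly k m \<delta> (\<lambda>_ _. 0) \<Longrightarrow> tz k t \<le> R / 4"
    and length_le: "2 * Suc p \<le> 3 * CARD('n)"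
    and idx: "inj_on (case_prod idx) ({..<2 * Suc p} \<times> {..<m})"
    and run_word: "word seq (Suc p)"
    and rank_max: "\<And>t. t \<in> ppoly (Suc p) m \<delta> (\<lambda>_ _. 0) \<Longrightarrow> rank_at (Suc p) m (Gam S m seq (Suc p)) t \<le> e"
    and rank_attained: "\<exists>t\<in>ppoly (Suc p) m \<delta> (\<lambda>_ _. 0). rank_at (Suc p) m (Gam S m seq (Suc p)) t = e"
    and run_stops: "\<And>\<alpha> t. \<alpha> < a \<Longrightarrow> t \<in> ppoly (Suc (Suc p)) m \<delta> (\<lambda>_ _. 0) \<Longrightarrow>
      rank_at (Suc (Suc p)) m (Gam S m (seq(Suc p := \<alpha>)) (Suc (Suc p))) t \<le> e"
begin

definition pbox :: "nat \<Rightarrow> (complex ^ 'q) set" where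
  "pbox k = {x. par idx x \<in> ppoly k m \<delta> (\<lambda>_ _. 0)}"

lemma pbox_eq: "pbox k = (\<Inter>i\<in>{..<k} \<times> {..<m}. (\<lambda>x. x $ case_prod idx i) -` ball 0 \<delta>)"
  by (auto simp: pbox_def ppoly_def)

lemma open_pbox: "open (pbox k)"
  unfolding pbox_eq by (intro open_INT ballI open_vimage continuous_intros) auto

lemma convex_pbox: "convex (pbox k)"
  unfolding pbox_eq
  by (intro convex_INT convex_linear_vimage convex_ball bounded_linear.linear[OF bounded_linear_vec_nth])

lemma small': "k \<le> 3 * CARD('n) \<Longrightarrow> t \<in> ppoly k m \<delta> (\<lambda>_ _. 0) \<Longrightarrow> tz k t < R"
  using small[of k t] R_pos by linarith

lemma idx_inj: "k \<le> 2 * Suc p \<Longrightarrow> inj_on (case_prod idx) ({..<k} \<times> {..<m})"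
  by (rule inj_on_subset[OF idx]) auto

lemma Gam_par_cholo:
  assumes "word w k" "k \<le> 3 * CARD('n)"
  shows "cholo (pbox k) (\<lambda>x. Gam S m w k (par idx x))"
  unfolding Gam_def
  by (rule flowk_cholo[OF cholo_const _ _ assms(1)])
    (use small'[OF assms(2)] in \<open>auto simp: pbox_def intro!: cholo_nth\<close>)

lemma rank_at_Gam_par:
  assumes "word w k" "k \<le> 2 * Suc p" "x \<in> pbox k"
  shows "rank_at k m (Gam S m w k) (par idx x) = vec.dim (range (FD (\<lambda>x. Gam S m w k (par idx x)) x))"
proof (rule rank_at_par[OF idx_inj depends_on_Gam])
  show "cholo (pbox k) (\<lambda>x. Gam S m w k (par idx x))"
    by (rule Gam_par_cholo) (use assms length_le in auto)
qed (use assms in auto)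

abbreviation (input) G :: "complex ^ 'q \<Rightarrow> complex ^ 'n" where
  "G x \<equiv> Gam S m seq (Suc p) (par idx x)"

lemma G_cholo: "cholo (pbox (Suc p)) G"
  by (rule Gam_par_cholo[OF run_word]) (use length_le in auto)

lemma rank_G: "x \<in> pbox (Suc p) \<Longrightarrow> rank_at (Suc p) m (Gam S m seq (Suc p)) (par idx x) = vec.dim (range (FD G x))"
  by (rule rank_at_Gam_par[OF run_word]) auto

lemma rank_G_le: "x \<in> pbox (Suc p) \<Longrightarrow> vec.dim (range (FD G x)) \<le> e"
  using rank_max[of "par idx x"] by (simp add: rank_G pbox_def)

lemma ex_max_rank_point: "\<exists>x\<in>pbox (Suc p). vec.dim (range (FD G x)) = e"
proof -
  obtain t where t: "t \<in> ppoly (Suc p) m \<delta> (\<lambda>_ _. 0)" "rank_at (Suc p) m (Gam S m seq (Suc p)) t = e"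
    using rank_attained by blast
  obtain x where x: "\<forall>i<Suc p. \<forall>j<m. x $ idx i j = t i j"
    using ex_par[OF idx_inj[of "Suc p"], of t 0] by auto
  have "x \<in> pbox (Suc p)" using t(1) x by (simp add: pbox_def ppoly_def)
  moreover have "rank_at (Suc p) m (Gam S m seq (Suc p)) (par idx x) = e"
    using t(2) rank_at_cong[OF depends_on_Gam, of "Suc p" m "par idx x" t S seq] x by simp
  ultimately show ?thesis using rank_G by auto
qed

text \<open>Where \<open>\<Gamma>\<close> has maximal rank, appending any field of the system does not increase the rank, so the
  field is tangent to the image of \<open>\<Gamma>\<close>.\<close>

lemma tangent_at_max_rank:
  assumes x: "x \<in> pbox (Suc p)" "e \<le> vec.dim (range (FD G x))" and \<alpha>: "\<alpha> < a" "j < m"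
  shows "S \<alpha> j (G x) \<in> range (FD G x)"
proof -
  let ?w = "seq(Suc p := \<alpha>)" and ?t = "(par idx x)(Suc p := \<lambda>_. 0)"
  let ?A = "{cpartial (Gam S m seq (Suc p)) (par idx x) i j | i j. i < Suc p \<and> j < m}"
  let ?B = "{cpartial (Gam S m ?w (Suc (Suc p))) ?t i j | i j. i < Suc (Suc p) \<and> j < m}"
  have w: "word ?w (Suc (Suc p))" using run_word \<alpha> by (auto simp: word_def less_Suc_eq)
  have Gx: "Gam S m ?w (Suc p) ?t = G x"
    unfolding Gam_def by (rule flowk_cong) auto
  have "par idx x \<in> ppoly (Suc p) m \<delta> (\<lambda>_ _. 0)" using x by (simp add: pbox_def)
  then have t: "?t \<in> ppoly (Suc (Suc p)) m \<delta> (\<lambda>_ _. 0)"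
    using \<delta>_pos by (auto simp: ppoly_def less_Suc_eq)
  have "tz (Suc p) ?t = tz (Suc p) (par idx x)" by (rule tz_cong) auto
  also have "\<dots> < R" by (rule small') (use x length_le in \<open>auto simp: pbox_def\<close>)
  finally have tz: "tz (Suc p) ?t < R" .
  note zero = cpartial_Gam_Suc_zero[OF w tz]
  have c: "cpartial (Gam S m ?w (Suc (Suc p))) ?t i j = cpartial (Gam S m seq (Suc p)) (par idx x) i j"
    if "i < Suc p" for i j
  proof -
    have "cpartial (Gam S m ?w (Suc p)) ?t i j = cpartial (Gam S m seq (Suc p)) (par idx x) i j"
    proof (rule cpartial_cong)
      show "Gam S m ?w (Suc p) (pupd ?t i j v) = Gam S m seq (Suc p) (pupd (par idx x) i j v)" for v
        unfolding Gam_def by (rule flowk_cong) (auto simp: pupd_apply)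
    qed (use that in simp)
    then show ?thesis using zero(1)[OF _ that] by simp
  qed
  have sub: "?A \<subseteq> ?B"
  proof
    fix v assume "v \<in> ?A"
    then obtain i j where ij: "i < Suc p" "j < m" "v = cpartial (Gam S m seq (Suc p)) (par idx x) i j" by blast
    then have "v = cpartial (Gam S m ?w (Suc (Suc p))) ?t i j" using c by simp
    then show "v \<in> ?B" using ij by (intro CollectI exI[of _ i] exI[of _ j]) simp
  qed
  have "rank_at (Suc (Suc p)) m (Gam S m ?w (Suc (Suc p))) ?t \<le> e"
    by (rule run_stops[OF \<alpha>(1) t])
  then have "vec.dim ?B \<le> e" by (simp only: rank_at_def)
  moreover have "e \<le> vec.dim ?A" using x rank_G[OF x(1)] by (simp only: rank_at_def)
  \<comment> \<open>The old partial derivatives already span dimension e and the larger family spans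
    no more, so the value of the appended field lies in the old span.\<close>
  ultimately have sp: "vec.span ?A = vec.span ?B"
    by (intro vec.dim_eq_span[OF sub]) linarith
  have "S \<alpha> j (G x) \<in> ?B"
    using zero(2)[of j] \<alpha>(2) Gx by (intro CollectI exI[of _ "Suc p"] exI[of _ j]) simp
  then have "S \<alpha> j (G x) \<in> vec.span ?A" unfolding sp by (rule vec.span_base)
  moreover have "inj_on (case_prod idx) ({..<Suc p} \<times> {..<m})" by (rule idx_inj) simp
  ultimately show ?thesis
    by (simp only: range_FD_par[OF _ depends_on_Gam G_cholo x(1)])
qed

text \<open>Near a point of maximal rank the image of \<open>\<Gamma>\<close> is a manifold tangent to the system, hence flowing
  on along further fields for small times stays inside it; genericity of the rank then bounds the
  rank for all longer words.\<close>

lemma extended_rank_le: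
  assumes w: "word w k" and wseq: "\<And>i. i < Suc p \<Longrightarrow> w i = seq i" and k: "Suc p \<le> k" "k \<le> 2 * Suc p"
    and t: "t \<in> ppoly k m \<delta> (\<lambda>_ _. 0)"
  shows "rank_at k m (Gam S m w k) t \<le> e"
proof (rule ccontr)
  assume neg: "\<not> ?thesis"
  have k3: "k \<le> 3 * CARD('n)" using k length_le by linarith
  obtain y where y: "\<forall>i<k. \<forall>j<m. y $ idx i j = t i j"
    using ex_par[OF idx_inj[OF k(2)], of t 0] by auto
  let ?H = "\<lambda>x. Gam S m w k (par idx x)"
  have yk: "y \<in> pbox k" using t y by (simp add: pbox_def ppoly_def)
  have "rank_at k m (Gam S m w k) (par idx y) = rank_at k m (Gam S m w k) t"
    by (rule rank_at_cong[OF depends_on_Gam]) (use y in simp)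
  then have ry: "Suc e \<le> vec.dim (range (FD ?H y))"
    using neg rank_at_Gam_par[OF w k(2) yk] by linarith
  note H = Gam_par_cholo[OF w k3]
  obtain x1 where x1: "x1 \<in> pbox (Suc p)" "vec.dim (range (FD G x1)) = e"
    using ex_max_rank_point by blast
  \<comment> \<open>Maximal rank in the first p + 1 blocks and zero times afterwards: the additional
    blocks start at rest at the point G x0 of the tangent manifold.\<close>
  obtain x0 where x0: "\<forall>i<k. \<forall>j<m. x0 $ idx i j = (if i < Suc p then x1 $ idx i j else 0)"
    using ex_par[OF idx_inj[OF k(2)], of "\<lambda>i j. if i < Suc p then x1 $ idx i j else 0" 0] by auto
  have x0k: "x0 \<in> pbox k" using x1(1) x0 \<delta>_pos by (auto simp: pbox_def ppoly_def)
  have sub: "pbox k \<subseteq> pbox (Suc p)" using k by (auto simp: pbox_def ppoly_def)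
  have x0p: "x0 \<in> pbox (Suc p)" using x0k sub by blast
  have "rank_at (Suc p) m (Gam S m seq (Suc p)) (par idx x0) = rank_at (Suc p) m (Gam S m seq (Suc p)) (par idx x1)"
    by (rule rank_at_cong[OF depends_on_Gam]) (use x0 k in simp)
  then have rx0: "e \<le> vec.dim (range (FD G x0))" using x1 rank_G[OF x0p] rank_G[OF x1(1)] by simp
  obtain r where r: "r > 0" "ball x0 r \<subseteq> pbox (Suc p)" "\<forall>x\<in>ball x0 r. e \<le> vec.dim (range (FD G x))"
    using rank_lower_open[OF open_pbox G_cholo x0p rx0] by blast
  have Gr: "cholo (ball x0 r) G" using G_cholo r(2) by (rule cholo_subset)
  have "x0 \<in> ball x0 r" using r(1) by simp
  then show False
  proof (rule constant_rank_image[OF open_ball Gr _ rx0])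
    show "vec.dim (range (FD G x)) \<le> e" if "x \<in> ball x0 r" for x using rank_G_le r(2) that by blast
    fix W' assume W': "open W'" "x0 \<in> W'" "W' \<subseteq> ball x0 r"
      and M: "\<forall>W''. open W'' \<longrightarrow> W'' \<subseteq> W' \<longrightarrow> csubmanifold (G ` W'') e"
    let ?M = "G ` W'"
    have GW: "cholo W' G" using Gr W'(3) by (rule cholo_subset)
    have Mm: "csubmanifold ?M e" using M W'(1) by blast
    have tan: "system_tangent S a m ?M"
      unfolding system_tangent_def
    proof (intro allI impI ballI)
      fix \<alpha> j z assume \<alpha>: "\<alpha> < a" "j < m" and "z \<in> ?M"
      then obtain x where x: "x \<in> W'" "z = G x" by auto
      have "S \<alpha> j (G x) \<in> range (FD G x)"
        using W'(3) x r by (intro tangent_at_max_rank \<alpha>) auto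
      then show "S \<alpha> j z \<in> ctangent ?M z" unfolding x(2) by (rule ctangent_image[OF W'(1) GW x(1)])
    qed
    have x0R: "norm (G x0) < R" "G x0 \<in> ?M"
    proof -
      have t0: "tz (Suc p) (par idx x0) < R" by (rule small') (use x0p length_le in \<open>auto simp: pbox_def\<close>)
      then show "norm (G x0) < R" using flowk_norm[OF run_word, of 0 "par idx x0"] by (simp add: Gam_def)
      show "G x0 \<in> ?M" using W'(2) by blast
    qed
    obtain \<rho> where \<rho>: "\<rho> > 0" "\<forall>w l s z. word w l \<longrightarrow> z \<in> ?M \<longrightarrow> dist z (G x0) + tz l s < \<rho> \<longrightarrow> norm z + tz l s < R \<longrightarrow>
        (\<forall>i<l. \<forall>j<m. norm (s i j) < \<rho>) \<longrightarrow> flowk S m w l s z \<in> ?M"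
      using flowk_stays[OF Mm x0R(2,1) tan] by blast
    let ?l = "k - Suc p"
    let ?s = "\<lambda>x i. par idx x (Suc p + i)"
    define O3 where "O3 = (\<Inter>q\<in>{..<?l} \<times> {..<m}. (\<lambda>x :: complex ^ 'q. ?s x (fst q) (snd q)) -` ball 0 \<rho>)"
    have O3_iff: "x \<in> O3 \<longleftrightarrow> (\<forall>i<?l. \<forall>j<m. norm (?s x i j) < \<rho>)" for x
      by (auto simp: O3_def)
    \<comment> \<open>Parameters near x0 whose additional blocks are too short to leave the tangent
      manifold; the conditions are those of \<open>flowk_stays\<close>.\<close>
    let ?O = "{x \<in> W' \<inter> pbox k. dist (G x) (G x0) + tz ?l (?s x) < \<rho> \<and> norm (G x) + tz ?l (?s x) < R} \<inter>
       O3"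
    have WO: "open (W' \<inter> pbox k)" using W'(1) open_pbox by (rule open_Int)
    have contG: "continuous_on (W' \<inter> pbox k) G" by (rule continuous_on_subset[OF cholo_continuous_on[OF GW]]) auto
    have contt: "continuous_on A (\<lambda>x. tz ?l (?s x))" for A
      by (intro continuous_on_tz) (auto intro!: continuous_intros)
    have "open ((W' \<inter> pbox k) \<inter> (\<lambda>x. dist (G x) (G x0) + tz ?l (?s x)) -` {..<\<rho>})"
      by (rule continuous_open_preimage[OF _ WO open_lessThan]) (intro continuous_intros contG contt)
    moreover have "open ((W' \<inter> pbox k) \<inter> (\<lambda>x. norm (G x) + tz ?l (?s x)) -` {..<R})"
      by (rule continuous_open_preimage[OF _ WO open_lessThan]) (intro continuous_intros contG contt)
    moreover have "open O3"
      unfolding O3_def by (intro open_INT ballI open_vimage) (auto intro!: continuous_intros)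
    moreover have "?O = ((W' \<inter> pbox k) \<inter> (\<lambda>x. dist (G x) (G x0) + tz ?l (?s x)) -` {..<\<rho>}) \<inter>
        ((W' \<inter> pbox k) \<inter> (\<lambda>x. norm (G x) + tz ?l (?s x)) -` {..<R}) \<inter>
        O3"
      by blast
    ultimately have O: "open ?O" by (metis (no_types, lifting) open_Int)
    have s0: "?s x0 i j = 0" if "i < ?l" "j < m" for i j using x0 that by simp
    have "tz ?l (?s x0) = 0" unfolding tz_def using s0 by simp
    then have x0O: "x0 \<in> ?O"
      using W'(2) x0k \<rho>(1) x0R(1) s0 by (auto simp: O3_iff)
    have into: "?H ` ?O \<subseteq> ?M"
    proof
      fix z assume "z \<in> ?H ` ?O"
      then obtain x where x: "x \<in> ?O" "z = ?H x" by blast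
      have gx: "flowk S m w (Suc p) (par idx x) 0 = G x"
        unfolding Gam_def by (rule flowk_cong) (simp_all add: wseq)
      have z: "z = flowk S m (\<lambda>i. w (Suc p + i)) ?l (?s x) (G x)"
      proof -
        have "z = flowk S m w (Suc p + ?l) (par idx x) 0" using x(2) k(1) by (simp add: Gam_def del: flowk.simps)
        then show ?thesis by (simp only: flowk_add gx)
      qed
      have w': "word (\<lambda>i. w (Suc p + i)) ?l" using w by (auto simp: word_def)
      have Gx: "G x \<in> ?M" "dist (G x) (G x0) + tz ?l (?s x) < \<rho>" "norm (G x) + tz ?l (?s x) < R"
        using x(1) by blast+
      have sm: "norm (?s x i j) < \<rho>" if "i < ?l" "j < m" for i j
        using IntD2[OF x(1)] that unfolding O3_iff by blast
      show "z \<in> ?M" unfolding z by (rule \<rho>(2)[rule_format, OF w' Gx]) (rule sm)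
    qed
    obtain d where d: "d > 0" "ball x0 d \<subseteq> ?O" using O x0O open_contains_ball by blast
    \<comment> \<open>A rank above e anywhere in the polydisc would also occur inside this small
      neighbourhood, where the image lies in a manifold of dimension e.\<close>
    have "\<exists>x\<in>pbox k \<inter> ball x0 d. Suc e \<le> vec.dim (range (FD ?H x))"
      by (rule rank_generic[OF open_pbox convex_pbox H yk ry x0k d(1)])
    then obtain x where x: "x \<in> ball x0 d" "Suc e \<le> vec.dim (range (FD ?H x))" by blast
    have "vec.dim (range (FD ?H x)) \<le> e"
    proof (rule rank_le_of_image_in_submanifold[OF Mm O _ into])
      show "cholo ?O ?H" using H by (rule cholo_subset) blast
      show "x \<in> ?O" using x(1) d(2) by blast
    qed
    then show False using x(2) by simp
  qed
qed

text \<open>The first argument is the fixed base point, the second one varies. Only p blocks are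
  reversed although \<Gamma> has p + 1: the last block of the base point is 0, and the return leads
  exactly to the origin.\<close>

definition Psi :: "(nat \<Rightarrow> nat \<Rightarrow> complex) \<Rightarrow> (nat \<Rightarrow> nat \<Rightarrow> complex) \<Rightarrow> complex ^ 'n" where
  "Psi ts t = flowk S m (rev_seq seq p) p (rev_par ts p) (Gam S m seq (Suc p) t)"

text \<open>The run followed by its reversal, a word of 2p + 1 blocks. \<Psi> is \<Gamma> of this
  word with the last p blocks frozen, so the rank bound for extended words applies to it.\<close>

definition long_seq :: "nat \<Rightarrow> nat" where
  "long_seq i = (if i < Suc p then seq i else rev_seq seq p (i - Suc p))"

definition long_par :: "(nat \<Rightarrow> nat \<Rightarrow> complex) \<Rightarrow> (nat \<Rightarrow> nat \<Rightarrow> complex) \<Rightarrow> nat \<Rightarrow> nat \<Rightarrow> complex" where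
  "long_par ts t i = (if i < Suc p then t i else rev_par ts p (i - Suc p))"

lemma Psi_eq_Gam: "Psi ts t = Gam S m long_seq (Suc p + p) (long_par ts t)"
proof -
  have 1: "flowk S m long_seq (Suc p) (long_par ts t) 0 = Gam S m seq (Suc p) t"
    unfolding Gam_def by (rule flowk_cong) (auto simp: long_seq_def long_par_def)
  have "flowk S m (\<lambda>i. long_seq (Suc p + i)) p (\<lambda>i. long_par ts t (Suc p + i)) z =
      flowk S m (rev_seq seq p) p (rev_par ts p) z" for z
    by (rule flowk_cong) (auto simp: long_seq_def long_par_def)
  then show ?thesis
    unfolding Psi_def Gam_def[of S m long_seq] flowk_add by (simp only: 1)
qed

lemma word_rev: "word (rev_seq seq p) p"
  using run_word by (auto simp: word_def rev_seq_def)

lemma word_long: "word long_seq (Suc p + p)"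
  using run_word word_rev by (auto simp: word_def long_seq_def)

lemma depends_on_Psi: "depends_on (Suc p) m (Psi ts)"
  unfolding depends_on_def
proof (intro allI impI)
  fix t t' :: "nat \<Rightarrow> nat \<Rightarrow> complex" assume "\<forall>i<Suc p. \<forall>j<m. t i j = t' i j"
  then have "Gam S m seq (Suc p) t = Gam S m seq (Suc p) t'"
    by (intro depends_onD[OF depends_on_Gam]) auto
  then show "Psi ts t = Psi ts t'" by (simp only: Psi_def)
qed

lemma rev_par_ppoly: "ts \<in> ppoly (Suc p) m \<epsilon> (\<lambda>_ _. 0) \<Longrightarrow> rev_par ts p \<in> ppoly p m \<epsilon> (\<lambda>_ _. 0)"
  by (auto simp: ppoly_def rev_par_def)

lemma long_par_ppoly:
  assumes "ts \<in> ppoly (Suc p) m \<epsilon> (\<lambda>_ _. 0)" "t \<in> ppoly (Suc p) m \<epsilon> (\<lambda>_ _. 0)"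
  shows "long_par ts t \<in> ppoly (Suc p + p) m \<epsilon> (\<lambda>_ _. 0)"
proof -
  have "norm (long_par ts t i j) < \<epsilon>" if "i < Suc p + p" "j < m" for i j
    using assms(2) rev_par_ppoly[OF assms(1)] that by (auto simp: long_par_def ppoly_def)
  then show ?thesis by (simp add: ppoly_def)
qed

lemma Psi_cholo:
  assumes ts: "ts \<in> ppoly (Suc p) m \<delta> (\<lambda>_ _. 0)"
  shows "cholo (pbox (Suc p)) (\<lambda>x. Psi ts (par idx x))"
  unfolding Psi_eq_Gam Gam_def
proof (rule flowk_cholo[OF cholo_const _ _ word_long])
  show "cholo (pbox (Suc p)) (\<lambda>x. long_par ts (par idx x) i j)" for i j
    by (cases "i < Suc p") (auto simp: long_par_def intro!: cholo_nth)
  show "norm 0 + tz (Suc p + p) (long_par ts (par idx x)) < R" if "x \<in> pbox (Suc p)" for x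
    using small'[OF _ long_par_ppoly[OF ts]] that length_le by (simp add: pbox_def)
qed

text \<open>The rank of \<open>\<Psi>\<close> is bounded below because \<open>\<Gamma>\<close> is recovered from \<open>\<Psi>\<close> by flowing forward again, and
  above, together with tangency, because \<open>\<Psi>\<close> followed by one more field is part of a longer word.\<close>

lemma Psi_rank:
  assumes ts: "ts \<in> ppoly (Suc p) m \<delta> (\<lambda>_ _. 0)" and x: "x \<in> pbox (Suc p)"
    and e: "e \<le> vec.dim (range (FD G x))"
  shows "e \<le> vec.dim (range (FD (\<lambda>x. Psi ts (par idx x)) x))"
    and "\<alpha> < a \<Longrightarrow> vec.dim (range (FD (\<lambda>x. Psi ts (par idx x)) x)) \<le> e"
    and "\<alpha> < a \<Longrightarrow> j < m \<Longrightarrow> S \<alpha> j (Psi ts (par idx x)) \<in> range (FD (\<lambda>x. Psi ts (par idx x)) x)"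
proof -
  let ?Q = "\<lambda>x. Psi ts (par idx x)"
  note Q = Psi_cholo[OF ts]
  have p3: "Suc p \<le> 3 * CARD('n)" "p \<le> 3 * CARD('n)" using length_le by auto
  have r4: "tz p (rev_par ts p) \<le> R / 4" by (rule small[OF p3(2) rev_par_ppoly[OF ts]])
  have rr4: "tz p (rev_par (rev_par ts p) p) \<le> R / 4"
  proof (rule small[OF p3(2)])
    show "rev_par (rev_par ts p) p \<in> ppoly p m \<delta> (\<lambda>_ _. 0)"
      using ts by (auto simp: ppoly_def rev_par_def)
  qed
  have wrr: "word (rev_seq (rev_seq seq p) p) p"
    unfolding word_def
  proof (intro allI impI)
    fix i assume "i < p"
    then have "rev_seq seq p (p - 1 - i) < a" by (intro wordD[OF word_rev]) simp
    then show "rev_seq (rev_seq seq p) p i < a" by (simp only: rev_seq_def)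
  qed
  \<comment> \<open>Reversing twice gives the forward flow along the first p blocks, which recovers
    G from \<Psi>. Starting points within 3R/4 and a displacement of at most R/4 keep it inside the
    ball of radius R.\<close>
  let ?B = "\<lambda>z. flowk S m (rev_seq (rev_seq seq p) p) p (rev_par (rev_par ts p) p) z"
  let ?U = "ball (0 :: complex ^ 'n) (3 * R / 4)"
  have B: "cholo ?U ?B"
    by (rule flowk_cholo[OF cholo_ident cholo_const _ wrr]) (use rr4 in auto)
  have Gn: "norm (G y) \<le> R / 4" if "y \<in> pbox (Suc p)" for y
  proof -
    have "tz (Suc p) (par idx y) \<le> R / 4" by (rule small[OF p3(1)]) (use that in \<open>simp add: pbox_def\<close>)
    then show ?thesis
      using flowk_norm[OF run_word, of 0 "par idx y"] R_pos by (simp add: Gam_def)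
  qed
  have Qn: "norm (?Q y) \<le> R / 2" if "y \<in> pbox (Suc p)" for y
    using flowk_norm[OF word_rev, of "G y" "rev_par ts p"] Gn[OF that] r4 R_pos by (simp add: Psi_def)
  have BQ: "?B (?Q y) = G y" if "y \<in> pbox (Suc p)" for y
    unfolding Psi_def by (rule flowk_rev[OF word_rev]) (use Gn[OF that] r4 R_pos in simp)
  have QU: "?Q x \<in> ?U" using Qn[OF x] R_pos by simp
  have "((\<lambda>y. ?B (?Q y)) has_derivative (\<lambda>v. FD ?B (?Q x) (FD ?Q x v))) (at x)"
    by (rule has_derivative_compose[OF cholo_has_derivative[OF Q x] cholo_has_derivative[OF B QU]])
  then have "(G has_derivative (\<lambda>v. FD ?B (?Q x) (FD ?Q x v))) (at x)"
    by (rule has_derivative_transform_within_open[OF _ open_pbox x]) (rule BQ)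
  then have "FD G x = (\<lambda>v. FD ?B (?Q x) (FD ?Q x v))" by (rule FD_eq)
  then have "range (FD G x) = FD ?B (?Q x) ` range (FD ?Q x)" by (simp add: image_image)
  then show low: "e \<le> vec.dim (range (FD ?Q x))"
    using e vec.dim_image_le[OF vec_linear_FD[OF B QU], of "range (FD ?Q x)"] by simp
  let ?k = "Suc p + p"
  let ?A = "{cpartial (Psi ts) (par idx x) i j | i j. i < Suc p \<and> j < m}"
  have A: "range (FD ?Q x) = vec.span ?A"
    by (rule range_FD_par[OF idx_inj depends_on_Psi Q x]) simp
  have main: "vec.dim (range (FD ?Q x)) \<le> e \<and> (\<forall>j<m. S \<alpha> j (?Q x) \<in> range (FD ?Q x))" if \<alpha>: "\<alpha> < a" for \<alpha>
  proof -
    \<comment> \<open>One more block with zero times brings the length to 2p + 2, the largest one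
      for which \<open>extended_rank_le\<close> is available.\<close>
    let ?w = "long_seq(?k := \<alpha>)" and ?t = "(long_par ts (par idx x))(?k := \<lambda>_. 0)"
    let ?C = "{cpartial (Gam S m ?w (Suc ?k)) ?t i j | i j. i < Suc ?k \<and> j < m}"
    have w: "word ?w (Suc ?k)" using word_long \<alpha> by (auto simp: word_def less_Suc_eq)
    have lp: "long_par ts (par idx x) \<in> ppoly ?k m \<delta> (\<lambda>_ _. 0)"
      using x by (intro long_par_ppoly ts) (simp add: pbox_def)
    then have t: "?t \<in> ppoly (Suc ?k) m \<delta> (\<lambda>_ _. 0)"
      using \<delta>_pos by (auto simp: ppoly_def less_Suc_eq)
    have "tz ?k ?t = tz ?k (long_par ts (par idx x))" by (rule tz_cong) auto
    also have "\<dots> < R" by (rule small'[OF _ lp]) (use length_le in simp)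
    finally have tz: "tz ?k ?t < R" .
    note zero = cpartial_Gam_Suc_zero[OF w tz]
    have Qx: "Gam S m ?w ?k ?t = ?Q x"
      unfolding Psi_eq_Gam Gam_def by (rule flowk_cong) auto
    have c: "cpartial (Gam S m ?w (Suc ?k)) ?t i j = cpartial (Psi ts) (par idx x) i j" if i: "i < Suc p" for i j
    proof -
      have "cpartial (Gam S m ?w ?k) ?t i j = cpartial (Psi ts) (par idx x) i j"
      proof (rule cpartial_cong)
        show "Gam S m ?w ?k (pupd ?t i j v) = Psi ts (pupd (par idx x) i j v)" for v
          unfolding Psi_eq_Gam Gam_def
          by (rule flowk_cong) (use i in \<open>auto simp: pupd_apply long_par_def\<close>)
      qed (use i in \<open>simp add: long_par_def\<close>)
      then show ?thesis using zero(1)[of i j] i by simp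
    qed
    have sub: "?A \<subseteq> ?C"
    proof
      fix v assume "v \<in> ?A"
      then obtain i j where ij: "i < Suc p" "j < m" "v = cpartial (Psi ts) (par idx x) i j" by blast
      then have "v = cpartial (Gam S m ?w (Suc ?k)) ?t i j" using c by simp
      then show "v \<in> ?C" using ij by (intro CollectI exI[of _ i] exI[of _ j]) simp
    qed
    have "rank_at (Suc ?k) m (Gam S m ?w (Suc ?k)) ?t \<le> e"
      by (rule extended_rank_le[OF w _ _ _ t]) (auto simp: long_seq_def)
    then have C: "vec.dim ?C \<le> e" by (simp only: rank_at_def)
    have Ae: "e \<le> vec.dim ?A" using low unfolding A by (simp only: vec.dim_span)
    have "vec.dim ?A \<le> e" using vec.dim_subset[OF sub] C by linarith
    moreover have sp: "vec.span ?A = vec.span ?C"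
      using Ae C by (intro vec.dim_eq_span[OF sub]) linarith
    moreover have "S \<alpha> j (?Q x) \<in> vec.span ?C" if "j < m" for j
    proof (rule vec.span_base)
      have "S \<alpha> j (?Q x) = cpartial (Gam S m ?w (Suc ?k)) ?t ?k j"
        using zero(2)[of j] that Qx by simp
      then show "S \<alpha> j (?Q x) \<in> ?C" using that by (intro CollectI exI[of _ ?k] exI[of _ j]) simp
    qed
    ultimately show ?thesis unfolding A vec.dim_span by simp
  qed
  show "\<alpha> < a \<Longrightarrow> vec.dim (range (FD ?Q x)) \<le> e" using main by blast
  show "\<alpha> < a \<Longrightarrow> j < m \<Longrightarrow> S \<alpha> j (?Q x) \<in> range (FD ?Q x)" using main by blast
qed

end

section \<open>The germ of the orbit at the origin\<close>

context flow_system
begin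

lemma tz_le:
  assumes t: "t \<in> ppoly k m r (\<lambda>_ _. 0)" and k: "k \<le> N" and r: "r \<ge> 0"
  shows "tz k t \<le> C * N * m * r"
proof -
  have "(\<Sum>i<k. \<Sum>j<m. norm (t i j)) \<le> (\<Sum>i<k. \<Sum>j<m. r)"
    using t by (intro sum_mono) (auto simp: ppoly_def less_imp_le)
  also have "\<dots> = k * (m * r)" by simp
  also have "\<dots> \<le> N * (m * r)" using k r by (intro mult_right_mono) auto
  finally have "tz k t \<le> C * (N * (m * r))"
    unfolding tz_def using C_pos by (intro mult_left_mono) auto
  then show ?thesis by (simp add: mult.assoc)
qed

text \<open>Words in \<open>orbit0\<close> have at most 3n blocks, so the radius of the parameter
  polydisc bounds the displacement uniformly over all of them, and one radius meets the conditions
  of \<open>flowk_stays\<close> at 0.\<close>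

lemma orbit0_subset_invariant:
  assumes M: "csubmanifold M e" "0 \<in> M" "system_tangent S a m M"
  shows "\<exists>d>0. \<forall>d'. 0 < d' \<longrightarrow> d' \<le> d \<longrightarrow> orbit0 S a m d' \<subseteq> M"
proof -
  obtain \<rho> where \<rho>: "\<rho> > 0" "\<forall>seq k t z. word seq k \<longrightarrow> z \<in> M \<longrightarrow> dist z 0 + tz k t < \<rho> \<longrightarrow> norm z + tz k t < R \<longrightarrow>
      (\<forall>i<k. \<forall>j<m. norm (t i j) < \<rho>) \<longrightarrow> flowk S m seq k t z \<in> M"
    using flowk_stays[OF M(1,2) _ M(3)] R_pos by auto
  let ?N = "3 * CARD('n)"
  define c where "c = C * ?N * m"
  \<comment> \<open>The summand 1 has two uses: it makes c * d strictly smaller than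
    \<open>min \<rho> R\<close>, and it keeps each single time below \<rho>, also when c =
    0.\<close>
  define d where "d = min \<rho> R / (c + 1)"
  have c: "c \<ge> 0" unfolding c_def using C_pos by (intro mult_nonneg_nonneg) auto
  have d: "d > 0" using \<rho>(1) R_pos c by (simp add: d_def add_nonneg_pos)
  have d1: "d * (c + 1) = min \<rho> R"
    using c unfolding d_def by simp
  have "d * c + d = min \<rho> R" using d1 by (simp add: distrib_left)
  then have d2: "c * d < min \<rho> R" using d by (simp only: mult.commute[of c])
  have d3: "d \<le> \<rho>"
  proof -
    have "0 \<le> d * c" using c d by simp
    then have "d \<le> d * (c + 1)" by (simp add: distrib_left)
    also have "\<dots> \<le> \<rho>" unfolding d1 by simp
    finally show ?thesis .
  qed
  have "orbit0 S a m d' \<subseteq> M" if d': "0 < d'" "d' \<le> d" for d'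
  proof
    fix z assume "z \<in> orbit0 S a m d'"
    then obtain w k t where z: "z = Gam S m w k t" "k \<le> ?N" "word w k" "t \<in> ppoly k m d' (\<lambda>_ _. 0)"
      by (auto simp: orbit0_def word_def)
    have "tz k t \<le> c * d'" unfolding c_def by (rule tz_le[OF z(4,2)]) (use d' in simp)
    also have "\<dots> \<le> c * d" using c d' by (intro mult_left_mono) auto
    also note d2
    finally have tz: "tz k t < \<rho>" "tz k t < R" by auto
    have "norm (t i j) < \<rho>" if "i < k" "j < m" for i j
      using z(4) that d' d3 by (force simp: ppoly_def)
    then show "z \<in> M" unfolding z(1) Gam_def
      by (intro \<rho>(2)[rule_format] z M) (use tz in auto)
  qed
  then show ?thesis using d by blast
qed

end

context flow_run
begin

lemma a_pos: "0 < a"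
  using wordD[OF run_word, of 0] by simp

lemma open_ppoly: "open {x. par idx x \<in> ppoly k m r c}"
proof -
  have "{x. par idx x \<in> ppoly k m r c} = (\<Inter>q\<in>{..<k} \<times> {..<m}. (\<lambda>x. x $ case_prod idx q) -` ball (case_prod c q) r)"
    by (auto simp: ppoly_def dist_norm norm_minus_commute)
  moreover have "open \<dots>" by (intro open_INT ballI open_vimage continuous_intros) auto
  ultimately show ?thesis by (simp only:)
qed

text \<open>\<open>ppoly\<close> restricts only the entries that a word reads and is not a subset of
  a normed space. Its image agrees with that of an open set of \<open>complex ^ 'q\<close>, to which
  the results on submanifolds apply.\<close>

lemma Psi_image:
  assumes r: "r > 0" and x0: "\<forall>i<Suc p. \<forall>j<m. x0 $ idx i j = ts i j"
  shows "Psi ts ` ppoly (Suc p) m r ts = (\<lambda>x. Psi ts (par idx x)) ` cube x0 r"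
    and "\<And>t. t \<in> ppoly (Suc p) m r ts \<Longrightarrow> \<exists>x\<in>cube x0 r. \<forall>i<Suc p. \<forall>j<m. par idx x i j = t i j"
proof -
  show ex: "\<exists>x\<in>cube x0 r. \<forall>i<Suc p. \<forall>j<m. par idx x i j = t i j" if t: "t \<in> ppoly (Suc p) m r ts" for t
  proof -
    have "inj_on (case_prod idx) ({..<Suc p} \<times> {..<m})" by (rule idx_inj) simp
    from ex_par[OF this, of t x0] obtain x where x: "\<forall>i<Suc p. \<forall>j<m. x $ idx i j = t i j"
      "\<forall>q. q \<notin> case_prod idx ` ({..<Suc p} \<times> {..<m}) \<longrightarrow> x $ q = x0 $ q" by blast
    have "norm (x $ q - x0 $ q) < r" for q
    proof (cases "q \<in> case_prod idx ` ({..<Suc p} \<times> {..<m})")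
      case True
      then obtain i j where "i < Suc p" "j < m" "q = idx i j" by auto
      then show ?thesis using t x(1) x0 by (simp add: ppoly_def)
    next
      case False
      then show ?thesis using x(2) r by simp
    qed
    then show ?thesis using x(1) by (intro bexI[of _ x]) (auto simp: cube_def)
  qed
  show "Psi ts ` ppoly (Suc p) m r ts = (\<lambda>x. Psi ts (par idx x)) ` cube x0 r"
  proof (intro equalityI subsetI)
    fix z assume "z \<in> Psi ts ` ppoly (Suc p) m r ts"
    then obtain t where t: "t \<in> ppoly (Suc p) m r ts" "z = Psi ts t" by blast
    from ex[OF t(1)] obtain x where x: "x \<in> cube x0 r" "\<forall>i<Suc p. \<forall>j<m. par idx x i j = t i j" by blast
    have "Psi ts (par idx x) = Psi ts t" by (rule depends_onD[OF depends_on_Psi]) (use x(2) in blast)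
    then show "z \<in> (\<lambda>x. Psi ts (par idx x)) ` cube x0 r" using x(1) t(2) by (metis image_eqI)
  next
    fix z assume "z \<in> (\<lambda>x. Psi ts (par idx x)) ` cube x0 r"
    then obtain x where x: "x \<in> cube x0 r" "z = Psi ts (par idx x)" by blast
    have "norm (x $ idx i j - x0 $ idx i j) < r" for i j using x(1) by (simp add: cube_def)
    then have "norm (x $ idx i j - ts i j) < r" if "i < Suc p" "j < m" for i j
      using x0 that by metis
    then have "par idx x \<in> ppoly (Suc p) m r ts" by (simp add: ppoly_def)
    then show "z \<in> Psi ts ` ppoly (Suc p) m r ts" using x(2) by blast
  qed
qed

text \<open>All that is achieved at one scale \<epsilon>. The last clause, that the image contains a
  neighbourhood of 0 in every manifold of the same dimension around it, is what allows two scales to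
  be compared.\<close>

definition good :: "real \<Rightarrow> (nat \<Rightarrow> nat \<Rightarrow> complex) \<Rightarrow> real \<Rightarrow> bool" where
  "good \<epsilon> ts r \<longleftrightarrow> ts \<in> ppoly (Suc p) m \<epsilon> (\<lambda>_ _. 0) \<and> (\<forall>j<m. ts p j = 0) \<and> r > 0 \<and>
     ppoly (Suc p) m r ts \<subseteq> ppoly (Suc p) m \<epsilon> (\<lambda>_ _. 0) \<and>
     rank_at (Suc p) m (Gam S m seq (Suc p)) ts = e \<and> Psi ts ts = 0 \<and>
     (\<forall>t\<in>ppoly (Suc p) m r ts. rank_at (Suc p) m (Psi ts) t = e) \<and>
     0 \<in> Psi ts ` ppoly (Suc p) m r ts \<and> csubmanifold (Psi ts ` ppoly (Suc p) m r ts) e \<and>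
     system_tangent S a m (Psi ts ` ppoly (Suc p) m r ts) \<and>
     (\<forall>M. csubmanifold M e \<longrightarrow> Psi ts ` ppoly (Suc p) m r ts \<subseteq> M \<longrightarrow>
       (\<exists>V. open V \<and> 0 \<in> V \<and> M \<inter> V \<subseteq> Psi ts ` ppoly (Suc p) m r ts))"

text \<open>The value e is the maximal rank on the polydisc of radius \<delta>, yet it serves every
  \<epsilon> \<le> \<delta>: by \<open>rank_generic\<close> it is attained within \<epsilon> of 0 as
  well.\<close>

lemma ex_good:
  assumes \<epsilon>: "0 < \<epsilon>" "\<epsilon> \<le> \<delta>"
  shows "\<exists>ts r. good \<epsilon> ts r"
proof -
  obtain x1 where x1: "x1 \<in> pbox (Suc p)" "vec.dim (range (FD G x1)) = e"
    using ex_max_rank_point by blast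
  have 0: "0 \<in> pbox (Suc p)" using \<delta>_pos by (simp add: pbox_def ppoly_def)
  have "\<exists>x\<in>pbox (Suc p) \<inter> ball 0 \<epsilon>. e \<le> vec.dim (range (FD G x))"
    by (rule rank_generic[OF open_pbox convex_pbox G_cholo x1(1) _ 0 \<epsilon>(1)]) (simp add: x1(2))
  then obtain x2 where x2: "x2 \<in> pbox (Suc p)" "norm x2 < \<epsilon>" "e \<le> vec.dim (range (FD G x2))" by auto
  \<comment> \<open>Putting the last block to 0 does not lower the rank, by
    \<open>rank_at_zero_last\<close>, and is what makes the reversal of the first p blocks end at
    0.\<close>
  define ts where "ts = (par idx x2)(p := \<lambda>_. 0)"
  have comp: "norm (x2 $ q) < \<epsilon>" for q
    using Finite_Cartesian_Product.norm_nth_le[of x2 q] x2(2) by simp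
  have ts\<epsilon>: "ts \<in> ppoly (Suc p) m \<epsilon> (\<lambda>_ _. 0)" using comp \<epsilon> by (simp add: ts_def ppoly_def)
  then have ts\<delta>: "ts \<in> ppoly (Suc p) m \<delta> (\<lambda>_ _. 0)" using \<epsilon> by (force simp: ppoly_def)
  have last: "\<forall>j<m. ts p j = 0" by (simp add: ts_def)
  have p3: "Suc p \<le> 3 * CARD('n)" "p \<le> 3 * CARD('n)" using length_le by auto
  have "e \<le> rank_at (Suc p) m (Gam S m seq (Suc p)) (par idx x2)" using x2(3) rank_G[OF x2(1)] by simp
  also have "\<dots> \<le> rank_at (Suc p) m (Gam S m seq (Suc p)) ts"
    unfolding ts_def
    by (rule rank_at_zero_last[OF run_word small'[OF p3(1)]]) (use x2(1) in \<open>simp add: pbox_def\<close>)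
  finally have rk: "rank_at (Suc p) m (Gam S m seq (Suc p)) ts = e" using rank_max[OF ts\<delta>] by simp
  have "inj_on (case_prod idx) ({..<Suc p} \<times> {..<m})" by (rule idx_inj) simp
  from ex_par[OF this, of ts 0] obtain x0 where x0: "\<forall>i<Suc p. \<forall>j<m. x0 $ idx i j = ts i j" by blast
  have x0\<delta>: "x0 \<in> pbox (Suc p)" using ts\<delta> x0 by (simp add: pbox_def ppoly_def)
  have "rank_at (Suc p) m (Gam S m seq (Suc p)) (par idx x0) = rank_at (Suc p) m (Gam S m seq (Suc p)) ts"
    by (rule rank_at_cong[OF depends_on_Gam]) (use x0 in simp)
  then have "e \<le> vec.dim (range (FD G x0))" using rank_G[OF x0\<delta>] rk by simp
  from rank_lower_open[OF open_pbox G_cholo x0\<delta> this] obtain r0 where r0: "r0 > 0" "ball x0 r0 \<subseteq> pbox (Suc p)"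
    "\<forall>x\<in>ball x0 r0. e \<le> vec.dim (range (FD G x))" by blast
  let ?Q = "\<lambda>x. Psi ts (par idx x)"
  let ?W = "ball x0 r0 \<inter> {x. par idx x \<in> ppoly (Suc p) m \<epsilon> (\<lambda>_ _. 0)}"
  have W: "open ?W" by (intro open_Int open_ball open_ppoly)
  have x0W: "x0 \<in> ?W" using r0(1) ts\<epsilon> x0 by (simp add: ppoly_def)
  have Q: "cholo ?W ?Q" by (rule cholo_subset[OF Psi_cholo[OF ts\<delta>]]) (use r0(2) in blast)
  have WP: "x \<in> pbox (Suc p)" "e \<le> vec.dim (range (FD G x))" if "x \<in> ?W" for x using that r0 by auto
  have lo: "e \<le> vec.dim (range (FD ?Q x))" if "x \<in> ?W" for x by (rule Psi_rank(1)[OF ts\<delta> WP[OF that]])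
  have up: "vec.dim (range (FD ?Q x)) \<le> e" if "x \<in> ?W" for x by (rule Psi_rank(2)[OF ts\<delta> WP[OF that] a_pos])
  have tanQ: "S \<alpha> j (?Q x) \<in> range (FD ?Q x)" if "x \<in> ?W" "\<alpha> < a" "j < m" for x \<alpha> j
    by (rule Psi_rank(3)[OF ts\<delta> WP[OF that(1)] that(2,3)])
  have zero: "Psi ts ts = 0"
  proof -
    have wp: "word seq p" using run_word by (rule word_mono) simp
    have tzp: "tz p ts \<le> R / 4" by (rule small[OF p3(2)]) (use ts\<delta> in \<open>simp add: ppoly_def\<close>)
    have n: "norm (Gam S m seq p ts) < R"
      using flowk_norm[OF wp, of 0 ts] tzp R_pos by (simp add: Gam_def)
    have "Gam S m seq (Suc p) ts = Gam S m seq p ts"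
      unfolding Gam_def flowk.simps
      by (rule commuting_flows.mflow_zero[OF commuting])
        (use wordD[OF run_word, of p] n last in \<open>auto simp: Gam_def\<close>)
    then show ?thesis
      using flowk_rev[OF wp, of 0 ts] tzp R_pos by (simp add: Psi_def Gam_def)
  qed
  show ?thesis
  proof (rule constant_rank_image[OF W Q x0W lo[OF x0W] up])
    fix W' assume W': "open W'" "x0 \<in> W'" "W' \<subseteq> ?W"
      and M: "\<forall>W''. open W'' \<longrightarrow> W'' \<subseteq> W' \<longrightarrow> csubmanifold (?Q ` W'') e"
    \<comment> \<open>A cube rather than a ball, since its image under \<Psi> is precisely that of a
      parameter polydisc of the same radius.\<close>
    obtain r where r: "r > 0" "cube x0 r \<subseteq> W'" by (rule cube_subset_open[OF W'(1,2)])
    note img = Psi_image[OF r(1) x0]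
    have cW: "cube x0 r \<subseteq> ?W" using r(2) W'(3) by blast
    have Qc: "cholo (cube x0 r) ?Q" using Q cW by (rule cholo_subset)
    have x0c: "x0 \<in> cube x0 r" using r(1) by (rule cube_center)
    have Qx0: "?Q x0 = 0"
    proof -
      have "?Q x0 = Psi ts ts" by (rule depends_onD[OF depends_on_Psi]) (use x0 in simp)
      then show ?thesis using zero by simp
    qed
    have "good \<epsilon> ts r"
      unfolding good_def
    proof (intro conjI)
      show "ppoly (Suc p) m r ts \<subseteq> ppoly (Suc p) m \<epsilon> (\<lambda>_ _. 0)"
      proof
        fix t assume "t \<in> ppoly (Suc p) m r ts"
        from img(2)[OF this] obtain x where x: "x \<in> cube x0 r" "\<forall>i<Suc p. \<forall>j<m. par idx x i j = t i j" by blast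
        have "par idx x \<in> ppoly (Suc p) m \<epsilon> (\<lambda>_ _. 0)" using x(1) cW by blast
        then show "t \<in> ppoly (Suc p) m \<epsilon> (\<lambda>_ _. 0)" using x(2) by (simp add: ppoly_def)
      qed
      show "\<forall>t\<in>ppoly (Suc p) m r ts. rank_at (Suc p) m (Psi ts) t = e"
      proof
        fix t assume "t \<in> ppoly (Suc p) m r ts"
        from img(2)[OF this] obtain x where x: "x \<in> cube x0 r" "\<forall>i<Suc p. \<forall>j<m. par idx x i j = t i j" by blast
        have xW: "x \<in> ?W" using x(1) cW by blast
        have "rank_at (Suc p) m (Psi ts) t = rank_at (Suc p) m (Psi ts) (par idx x)"
          by (rule rank_at_cong[OF depends_on_Psi]) (use x(2) in simp)
        also have "\<dots> = vec.dim (range (FD ?Q x))"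
          by (rule rank_at_par[OF idx_inj depends_on_Psi Q xW]) simp
        also have "\<dots> = e" using lo[OF xW] up[OF xW] by simp
        finally show "rank_at (Suc p) m (Psi ts) t = e" .
      qed
      show "0 \<in> Psi ts ` ppoly (Suc p) m r ts" unfolding img(1) using x0c Qx0 by (metis image_eqI)
      show "csubmanifold (Psi ts ` ppoly (Suc p) m r ts) e"
        unfolding img(1) using M open_cube r(2) by blast
      show "system_tangent S a m (Psi ts ` ppoly (Suc p) m r ts)"
        unfolding img(1) system_tangent_def
      proof (intro allI impI ballI)
        fix \<alpha> j z assume \<alpha>: "\<alpha> < a" "j < m" and "z \<in> ?Q ` cube x0 r"
        then obtain x where x: "x \<in> cube x0 r" "z = ?Q x" by blast
        have "S \<alpha> j (?Q x) \<in> range (FD ?Q x)" using x(1) cW \<alpha> by (intro tanQ) blast+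
        then show "S \<alpha> j z \<in> ctangent (?Q ` cube x0 r) z"
          unfolding x(2) by (rule ctangent_image[OF open_cube Qc x(1)])
      qed
      show "\<forall>M. csubmanifold M e \<longrightarrow> Psi ts ` ppoly (Suc p) m r ts \<subseteq> M \<longrightarrow>
          (\<exists>V. open V \<and> 0 \<in> V \<and> M \<inter> V \<subseteq> Psi ts ` ppoly (Suc p) m r ts)"
        unfolding img(1)
      proof (intro allI impI)
        fix M :: "(complex ^ 'n) set" assume "csubmanifold M e" "?Q ` cube x0 r \<subseteq> M"
        from submersion_open_in_submanifold[OF this(1) open_cube Qc this(2) x0c lo[OF x0W]]
        show "\<exists>V. open V \<and> 0 \<in> V \<and> M \<inter> V \<subseteq> ?Q ` cube x0 r" by (simp only: Qx0)
      qed
    qed (fact ts\<epsilon> last r(1) rk zero)+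
    then show ?thesis by blast
  qed
qed

lemma good_image_subset_orbit0:
  assumes "good d ts r"
  shows "Psi ts ` ppoly (Suc p) m r ts \<subseteq> orbit0 S a m d"
proof
  fix z assume "z \<in> Psi ts ` ppoly (Suc p) m r ts"
  then obtain t where t: "t \<in> ppoly (Suc p) m r ts" "z = Psi ts t" by blast
  then have "long_par ts t \<in> ppoly (Suc p + p) m d (\<lambda>_ _. 0)"
    using assms by (intro long_par_ppoly) (auto simp: good_def)
  moreover have "\<forall>i<Suc p + p. long_seq i < a" using word_long by (simp only: word_def)
  moreover have "Suc p + p \<le> 3 * CARD('n)" using length_le by simp
  ultimately show "z \<in> orbit0 S a m d" unfolding t(2) Psi_eq_Gam orbit0_def by blast
qed

text \<open>Tangency keeps the orbit with times below d' inside the manifold. Conversely, a second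
  image built at scale d' lies in that orbit, hence in the manifold, and having the same dimension e
  it contains a neighbourhood of 0 there.\<close>

lemma good_represents_orbit:
  assumes g: "good \<epsilon> ts r"
  defines "Orb \<equiv> Psi ts ` ppoly (Suc p) m r ts"
  shows "\<exists>d>0. \<forall>d'. 0 < d' \<longrightarrow> d' \<le> d \<longrightarrow> (\<exists>V. open V \<and> 0 \<in> V \<and> Orb \<inter> V = orbit0 S a m d' \<inter> V)"
proof -
  have Orb: "csubmanifold Orb e" "0 \<in> Orb" "system_tangent S a m Orb"
    using g by (auto simp: good_def Orb_def)
  obtain d where d: "d > 0" "\<forall>d'. 0 < d' \<longrightarrow> d' \<le> d \<longrightarrow> orbit0 S a m d' \<subseteq> Orb"
    using orbit0_subset_invariant[OF Orb] by blast
  have "\<exists>V. open V \<and> 0 \<in> V \<and> Orb \<inter> V = orbit0 S a m d' \<inter> V" if d': "0 < d'" "d' \<le> min d \<delta>" for d'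
  proof -
    have sub: "orbit0 S a m d' \<subseteq> Orb" using d d' by simp
    obtain ts' r' where g': "good d' ts' r'" using ex_good[of d'] d' by auto
    have sub': "Psi ts' ` ppoly (Suc p) m r' ts' \<subseteq> orbit0 S a m d'"
      by (rule good_image_subset_orbit0[OF g'])
    then have "Psi ts' ` ppoly (Suc p) m r' ts' \<subseteq> Orb" using sub by blast
    then obtain V where "open V" "0 \<in> V" "Orb \<inter> V \<subseteq> Psi ts' ` ppoly (Suc p) m r' ts'"
      using g' Orb(1) unfolding good_def by blast
    then show ?thesis using sub sub' by blast
  qed
  then show ?thesis using d(1) \<delta>_pos by (intro exI[of _ "min d \<delta>"]) auto
qed

text \<open>For short times the orbit of 0 cannot leave M, and the image of \<Psi> is the germ of
  that orbit; so the dimension of M does not enter.\<close>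

lemma good_minimal:
  assumes g: "good \<epsilon> ts r" and M: "csubmanifold M e'" "0 \<in> M" "system_tangent S a m M"
  shows "\<exists>V. open V \<and> 0 \<in> V \<and> Psi ts ` ppoly (Suc p) m r ts \<inter> V \<subseteq> M"
proof -
  obtain d1 where d1: "d1 > 0" "\<forall>d'. 0 < d' \<longrightarrow> d' \<le> d1 \<longrightarrow> orbit0 S a m d' \<subseteq> M"
    using orbit0_subset_invariant[OF M] by blast
  obtain d2 where d2: "d2 > 0" "\<forall>d'. 0 < d' \<longrightarrow> d' \<le> d2 \<longrightarrow>
      (\<exists>V. open V \<and> 0 \<in> V \<and> Psi ts ` ppoly (Suc p) m r ts \<inter> V = orbit0 S a m d' \<inter> V)"
    using good_represents_orbit[OF g] by blast
  have "orbit0 S a m (min d1 d2) \<subseteq> M" using d1 d2(1) by simp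
  moreover obtain V where "open V" "0 \<in> V" "Psi ts ` ppoly (Suc p) m r ts \<inter> V = orbit0 S a m (min d1 d2) \<inter> V"
    using d2 d1(1) by (metis min.cobounded2 min_less_iff_conj)
  ultimately show ?thesis by blast
qed

end

section \<open>Generic rank along a run of the construction\<close>

lemma rank_at_le_vars: "rank_at k m (F :: _ \<Rightarrow> complex ^ 'n) t \<le> k * m"
proof -
  have eq: "{cpartial F t i j | i j. i < k \<and> j < m} = (\<lambda>(i, j). cpartial F t i j) ` ({..<k} \<times> {..<m})" by auto
  have "rank_at k m F t \<le> card ((\<lambda>(i, j). cpartial F t i j) ` ({..<k} \<times> {..<m}))"
    unfolding rank_at_def eq by (rule vec.dim_le_card') simp
  also have "\<dots> \<le> card ({..<k} \<times> {..<m})" by (rule card_image_le) simp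
  finally show ?thesis by simp
qed

lemma rank_at_le_dim: "rank_at k m (F :: _ \<Rightarrow> complex ^ 'n) t \<le> CARD('n)"
  unfolding rank_at_def by (rule dim_subset_UNIV_cart_gen)

text \<open>\<open>Max\<close> has its meaning here because ranks are at most n, so there are
  finitely many values, and because the polydisc contains 0.\<close>

lemma gen_rk_properties:
  fixes F :: "_ \<Rightarrow> complex ^ 'n"
  assumes "\<delta> > 0"
  shows "\<And>t. t \<in> ppoly k m \<delta> (\<lambda>_ _. 0) \<Longrightarrow> rank_at k m F t \<le> gen_rk k m \<delta> F"
    and "\<exists>t\<in>ppoly k m \<delta> (\<lambda>_ _. 0). rank_at k m F t = gen_rk k m \<delta> F"
proof -
  let ?A = "(\<lambda>t. rank_at k m F t) ` ppoly k m \<delta> (\<lambda>_ _. 0)"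
  have "?A \<subseteq> {..CARD('n)}" using rank_at_le_dim by auto
  then have fin: "finite ?A" by (rule finite_subset) simp
  have ne: "?A \<noteq> {}" using assms by (auto simp: ppoly_def intro!: exI[of _ "\<lambda>_ _. 0"])
  show "rank_at k m F t \<le> gen_rk k m \<delta> F" if "t \<in> ppoly k m \<delta> (\<lambda>_ _. 0)" for t
    unfolding gen_rk_def using fin that by (intro Max_ge) auto
  have "gen_rk k m \<delta> F \<in> ?A" unfolding gen_rk_def by (rule Max_in[OF fin ne])
  then show "\<exists>t\<in>ppoly k m \<delta> (\<lambda>_ _. 0). rank_at k m F t = gen_rk k m \<delta> F" by force
qed

text \<open>At t = 0 every flow rests at the origin, so the partial derivatives are the values of
  all fields there, which are independent by assumption. The number of parameters bounds the rank
  from above.\<close>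

lemma (in flow_system) gen_rk_first:
  assumes indep: "\<And>c. (\<Sum>\<alpha><a. \<Sum>j<m. c \<alpha> j *s S \<alpha> j 0) = 0 \<Longrightarrow> \<forall>\<alpha><a. \<forall>j<m. c \<alpha> j = 0"
    and seq: "\<And>i. i < a \<Longrightarrow> seq i = i" and \<delta>: "\<delta> > 0"
  shows "gen_rk a m \<delta> (Gam S m seq a) = a * m"
proof -
  let ?z = "\<lambda>_ _. 0 :: complex"
  have partial: "cpartial (Gam S m seq k) ?z i j = S i j 0" if "k \<le> a" "i < k" "j < m" for k i j
    using that
  proof (induction k)
    case (Suc k)
    have w: "word seq (Suc k)" using Suc.prems(1) seq by (simp add: word_def)
    have "tz k ?z < R" using R_pos by (simp add: tz_def)
    note zero = cpartial_Gam_Suc_zero[OF w this]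
    have "Gam S m seq k ?z = 0"
      unfolding Gam_def by (rule flowk_zero[OF word_mono[OF w]]) (use R_pos in auto)
    then show ?case
      using Suc zero seq[of k] by (cases "i = k") auto
  qed simp
  let ?I = "{..<a} \<times> {..<m}" and ?f = "\<lambda>(i, j). S i j 0"
  have "{cpartial (Gam S m seq a) ?z i j | i j. i < a \<and> j < m} = ?f ` ?I"
    using partial by force
  then have r: "rank_at a m (Gam S m seq a) ?z = vec.dim (?f ` ?I)" by (simp only: rank_at_def)
  have c: "\<forall>i\<in>?I. c i = 0" if "(\<Sum>i\<in>?I. c i *s ?f i) = 0" for c
  proof -
    have "(\<Sum>\<alpha><a. \<Sum>j<m. c (\<alpha>, j) *s S \<alpha> j 0) = 0"
      using that by (simp add: sum.cartesian_product case_prod_beta)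
    from indep[of "\<lambda>\<alpha> j. c (\<alpha>, j)", OF this] show ?thesis by auto
  qed
  have fin: "finite ?I" by simp
  have ind: "inj_on ?f ?I" "vec.independent (?f ` ?I)"
    by (rule independent_family_on[OF fin], rule c, assumption)+
  have "vec.dim (?f ` ?I) = a * m"
    using vec.dim_eq_card_independent[OF ind(2)] card_image[OF ind(1)] by simp
  moreover have "?z \<in> ppoly a m \<delta> ?z" using \<delta> by (simp add: ppoly_def)
  ultimately have "a * m \<le> gen_rk a m \<delta> (Gam S m seq a)"
    using gen_rk_properties(1)[OF \<delta>, of ?z a m "Gam S m seq a"] r by simp
  moreover have "gen_rk a m \<delta> (Gam S m seq a) \<le> a * m"
    using gen_rk_properties(2)[OF \<delta>, of a m "Gam S m seq a"] rank_at_le_vars by metis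
  ultimately show ?thesis by simp
qed

text \<open>Strict growth makes the subtraction of natural numbers exact. Since each step gains at
  least 1, the same induction bounds the number of steps, which becomes \<kappa> \<le> n -
  am.\<close>

lemma telescope_strict_increments:
  fixes g :: "nat \<Rightarrow> nat"
  assumes "\<And>j. j < k \<Longrightarrow> g j < g (Suc j)"
  shows "j \<le> k \<Longrightarrow> g 0 + (\<Sum>i<j. g (Suc i) - g i) = g j \<and> g 0 + j \<le> g j"
proof (induction j)
  case (Suc j)
  then have "g 0 + (\<Sum>i<j. g (Suc i) - g i) = g j" "g 0 + j \<le> g j" "g j < g (Suc j)"
    using assms[of j] by auto
  then show ?case by simp
qed simp

lemma valid_run_total:
  assumes run: "valid_run S a m \<delta> seq \<kappa>" and first: "gen_rk a m \<delta> (Gam S m seq a) = a * m"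
  shows "e_total S a m \<delta> seq \<kappa> = gen_rk (a + \<kappa>) m \<delta> (Gam S m seq (a + \<kappa>))"
    and "a * m + \<kappa> \<le> gen_rk (a + \<kappa>) m \<delta> (Gam S m seq (a + \<kappa>))"
proof -
  let ?g = "\<lambda>k. gen_rk k m \<delta> (Gam S m seq k)"
  have "\<forall>k. a \<le> k \<and> k < a + \<kappa> \<longrightarrow> ?g k < ?g (Suc k)"
    using run unfolding valid_run_def by blast
  then have inc: "?g (a + j) < ?g (a + Suc j)" if "j < \<kappa>" for j
    using that by simp
  note tel = telescope_strict_increments[where g = "\<lambda>j. ?g (a + j)", OF inc order_refl]
  then show "e_total S a m \<delta> seq \<kappa> = ?g (a + \<kappa>)" "a * m + \<kappa> \<le> ?g (a + \<kappa>)"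
    by (simp_all add: e_total_def first)
qed

lemma csubmanifold_point: "csubmanifold {0 :: complex ^ 'n} 0"
  unfolding csubmanifold_def
proof
  fix p :: "complex ^ 'n" assume "p \<in> {0}"
  then show "\<exists>U \<phi> \<psi> J. open U \<and> p \<in> U \<and> open (\<phi> ` U) \<and> holo_on U \<phi> \<and> holo_on (\<phi> ` U) \<psi> \<and>
      (\<forall>z\<in>U. \<psi> (\<phi> z) = z) \<and> card J = 0 \<and> \<phi> ` ({0} \<inter> U) = \<phi> ` U \<inter> {w. \<forall>i. i \<notin> J \<longrightarrow> w $ i = 0}"
    by (intro exI[of _ UNIV] exI[of _ "\<lambda>z. z"] exI[of _ "{}"])
      (auto simp: holo_on_eq_cholo vec_eq_iff)
qed

lemma flowk_no_params: "flowk S 0 seq k t z = z"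
  by (induction k) auto

lemma rank_at_no_params: "rank_at k 0 F t = 0"
  by (simp add: rank_at_def)

theorem theorem9p8:
  fixes S :: "nat \<Rightarrow> nat \<Rightarrow> complex^'n \<Rightarrow> complex^'n" and a m :: nat
  assumes a_pos: "a \<ge> 1"
    and holo: "\<forall>\<alpha><a. \<forall>j<m. holo_on (polydisc 1) (S \<alpha> j)"
    and comm: "\<forall>\<alpha><a. \<forall>j<m. \<forall>l<m. \<forall>z\<in>polydisc 1. commute_at (S \<alpha> j) (S \<alpha> l) z"
    and indep: "\<forall>z\<in>polydisc 1. \<forall>c :: nat \<Rightarrow> nat \<Rightarrow> complex.
                  (\<Sum>\<alpha><a. \<Sum>j<m. c \<alpha> j *s S \<alpha> j z) = 0 \<longrightarrow> (\<forall>\<alpha><a. \<forall>j<m. c \<alpha> j = 0)"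
    and d_nonneg: "a * m \<le> CARD('n)"
  shows "\<exists>\<delta>0>0. \<forall>\<delta>. 0 < \<delta> \<and> \<delta> \<le> \<delta>0 \<longrightarrow>
    (\<forall>seq \<kappa>. valid_run S a m \<delta> seq \<kappa> \<longrightarrow>
      (let \<mu> = a + \<kappa>; e = e_total S a m \<delta> seq \<kappa>;
           \<Psi> = (\<lambda>ts t. flowk S m (rev_seq seq (\<mu> - 1)) (\<mu> - 1) (rev_par ts (\<mu> - 1)) (Gam S m seq \<mu> t))
       in \<kappa> \<le> CARD('n) - a * m \<and>
          (\<forall>\<epsilon>>0. \<exists>ts r. ts \<in> ppoly \<mu> m \<epsilon> (\<lambda>_ _. 0) \<and> (\<forall>j<m. ts (\<mu> - 1) j = 0) \<and>
             r > 0 \<and> ppoly \<mu> m r ts \<subseteq> ppoly \<mu> m \<delta> (\<lambda>_ _. 0) \<and>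
             rank_at \<mu> m (Gam S m seq \<mu>) ts = e \<and>
             \<Psi> ts ts = 0 \<and>
             (\<forall>t\<in>ppoly \<mu> m r ts. rank_at \<mu> m (\<Psi> ts) t = e) \<and>
             (let Orb = \<Psi> ts ` ppoly \<mu> m r ts in
                0 \<in> Orb \<and> csubmanifold Orb e \<and> system_tangent S a m Orb \<and>
                (\<forall>M e'. csubmanifold M e' \<and> 0 \<in> M \<and> M \<subseteq> polydisc 1 \<and> system_tangent S a m M
                    \<longrightarrow> (\<exists>V. open V \<and> 0 \<in> V \<and> Orb \<inter> V \<subseteq> M)) \<and>
                (\<exists>\<delta>1>0. \<forall>\<delta>'. 0 < \<delta>' \<and> \<delta>' \<le> \<delta>1 \<longrightarrow>
                    (\<exists>V. open V \<and> 0 \<in> V \<and> Orb \<inter> V = orbit0 S a m \<delta>' \<inter> V))))))"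
proof -
  let "\<exists>\<delta>0>0. \<forall>\<delta>. _ \<delta> \<delta>0 \<longrightarrow> (\<forall>seq \<kappa>. _ \<delta> seq \<kappa> \<longrightarrow> ?C \<delta> seq \<kappa>)" = ?thesis
  show ?thesis
  proof (cases "m = 0")
    \<comment> \<open>Without fields in a block, independence does not bound a, so a + \<kappa>
      \<le> n may fail. Here all flows are the identity, all ranks are 0, and run and orbit are
      trivial.\<close>
    case True
    have gen: "gen_rk k 0 \<delta> F = 0" for k \<delta> and F :: "_ \<Rightarrow> complex ^ 'n"
      by (simp add: gen_rk_def rank_at_no_params ppoly_def)
    have orb: "orbit0 S a 0 d = {0}" for d
    proof -
      have "Gam S 0 (\<lambda>_. 0) 0 (\<lambda>_ _. 0) = (0 :: complex ^ 'n)" by (simp add: Gam_def)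
      then show ?thesis unfolding orbit0_def by (force simp: Gam_def flowk_no_params ppoly_def)
    qed
    have \<kappa>0: "\<kappa> = 0" if "valid_run S a 0 \<delta> seq \<kappa>" for \<delta> seq \<kappa>
      using that unfolding valid_run_def by (cases \<kappa>) (auto simp: gen dest!: spec[of _ a])
    show ?thesis
    proof (intro exI[of _ 1] conjI allI impI)
      fix \<delta> :: real and seq \<kappa> assume \<delta>: "0 < \<delta> \<and> \<delta> \<le> 1" and "valid_run S a m \<delta> seq \<kappa>"
      then have run: "valid_run S a 0 \<delta> seq \<kappa>" by (simp only: True)
      have e: "e_total S a 0 \<delta> seq \<kappa> = 0" using \<kappa>0[OF run] by (simp add: e_total_def)
      have img: "(\<lambda>t. 0 :: complex ^ 'n) ` ppoly k 0 r ts = {0}" for k r ts by (auto simp: ppoly_def)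
      show "?C \<delta> seq \<kappa>"
        unfolding True Let_def e Gam_def flowk_no_params img rank_at_no_params orb
        by (intro conjI allI impI exI[of _ "\<lambda>_ _. 0"] exI[of _ "1::real"])
          (auto simp: \<kappa>0[OF run] ppoly_def csubmanifold_point system_tangent_def intro!: exI[of _ "1::real"] exI[of _ UNIV])
    qed simp
  next
    case False
    then have m: "m \<ge> 1" by simp
    have X: "cholo (polydisc 1) (S \<alpha> j)" if "\<alpha> < a" "j < m" for \<alpha> j
      using holo that by (simp add: holo_on_eq_cholo)
    have "\<exists>C0. \<forall>q\<in>{..<a} \<times> {..<m}. \<forall>C\<ge>C0 q. flow_box (S (fst q) (snd q)) (1/2) C"
      using flow_box_exists[OF X] by (intro bchoice) force
    then obtain C0 where C0: "\<forall>q\<in>{..<a} \<times> {..<m}. \<forall>C\<ge>C0 q. flow_box (S (fst q) (snd q)) (1/2) C" by blast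
    \<comment> \<open>One constant for all the finitely many fields; the element 1 also guarantees
      positivity.\<close>
    define C where "C = Max (insert (1::real) (C0 ` ({..<a} \<times> {..<m})))"
    have C1: "C \<ge> 1" unfolding C_def by (intro Max_ge) auto
    have C2: "C0 q \<le> C" if "q \<in> {..<a} \<times> {..<m}" for q unfolding C_def using that by (intro Max_ge) auto
    have fb: "flow_box (S \<alpha> j) (1/2) C" if "\<alpha> < a" "j < m" for \<alpha> j
      using C0[rule_format, of "(\<alpha>, j)" C] C2[of "(\<alpha>, j)"] that by simp
    have cm: "commute_at (S \<alpha> j) (S \<alpha> l) z" if "\<alpha> < a" "j < m" "l < m" "z \<in> polydisc 1" for \<alpha> j l z
      using comm that by blast
    interpret flow_system S a m "1/2" C
      unfolding flow_system_def by (intro conjI allI impI fb cm) (use C1 in auto)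
    let ?N = "3 * CARD('n)"
    define c where "c = C * ?N * m"
    have c: "c > 0" unfolding c_def using C1 m by simp
    \<comment> \<open>With at most 3n blocks of m times below \<delta>, the displacement is at most
      c * \<delta> \<le> 1/8, which is the required R/4 for R = 1/2.\<close>
    define \<delta>0 where "\<delta>0 = 1 / (8 * c)"
    show ?thesis
    proof (intro exI[of _ \<delta>0] conjI allI impI)
      show "\<delta>0 > 0" using c by (simp add: \<delta>0_def)
      fix \<delta> :: real and seq \<kappa> assume \<delta>: "0 < \<delta> \<and> \<delta> \<le> \<delta>0" and run: "valid_run S a m \<delta> seq \<kappa>"
      have 0: "(0 :: complex ^ 'n) \<in> polydisc 1" by (simp add: polydisc_def)
      have seq_a: "seq i = i" if "i < a" for i using run that by (simp add: valid_run_def)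
      have first: "gen_rk a m \<delta> (Gam S m seq a) = a * m"
        by (rule gen_rk_first) (use indep 0 seq_a \<delta> in blast)+
      define e where "e = gen_rk (a + \<kappa>) m \<delta> (Gam S m seq (a + \<kappa>))"
      have total: "e_total S a m \<delta> seq \<kappa> = e" "a * m + \<kappa> \<le> e"
        using valid_run_total[OF run first] by (simp_all add: e_def)
      have \<delta>_pos: "\<delta> > 0" using \<delta> by simp
      note gen = gen_rk_properties[OF \<delta>_pos]
      have "e \<le> CARD('n)" unfolding e_def using gen(2)[of "a + \<kappa>" m "Gam S m seq (a + \<kappa>)"] rank_at_le_dim by metis
      then have \<kappa>: "a * m + \<kappa> \<le> CARD('n)" using total by simp
      \<comment> \<open>This is where m \<ge> 1 enters: a + \<kappa> \<le> am + \<kappa> \<le> n, so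
        words of 2(p + 1) blocks stay below the limit of 3n.\<close>
      have "a \<le> a * m" "m \<le> a * m" using m a_pos by simp_all
      then have \<mu>n: "a + \<kappa> \<le> CARD('n)" and mn: "m \<le> CARD('n)" using \<kappa> d_nonneg by linarith+
      define p where "p = a + \<kappa> - 1"
      have p: "a + \<kappa> = Suc p" using a_pos by (simp add: p_def)
      \<comment> \<open>A type with 2n * n elements built from the given one has room for the 2(p +
        1)m times, since p + 1 \<le> n and m \<le> n.\<close>
      have "card ({..<2 * Suc p} \<times> {..<m}) \<le> CARD(('n + 'n) \<times> 'n)"
        using mult_le_mono[OF _ mn, of "2 * Suc p" "2 * CARD('n)"] \<mu>n p by (simp add: mult_2)
      then obtain f :: "nat \<times> nat \<Rightarrow> ('n + 'n) \<times> 'n" where f: "inj_on f ({..<2 * Suc p} \<times> {..<m})"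
        using card_le_inj[of "{..<2 * Suc p} \<times> {..<m}" "UNIV :: (('n + 'n) \<times> 'n) set"] by auto
      define idx where "idx i j = f (i, j)" for i j
      interpret flow_run S a m "1/2" C idx \<delta> seq p e
      proof
        show "0 < \<delta>" by (rule \<delta>_pos)
        show "tz k t \<le> (1/2) / 4" if "k \<le> ?N" "t \<in> ppoly k m \<delta> (\<lambda>_ _. 0)" for k t
        proof -
          have "tz k t \<le> c * \<delta>" unfolding c_def by (rule tz_le[OF that(2,1)]) (use \<delta> in simp)
          also have "\<dots> \<le> c * \<delta>0" using \<delta> c by (intro mult_left_mono) auto
          also have "\<dots> = (1/2) / 4" using c by (simp add: \<delta>0_def)
          finally show ?thesis .
        qed
        show "2 * Suc p \<le> ?N" using \<mu>n p by simp
        have "case_prod idx = f" by (auto simp: idx_def)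
        then show "inj_on (case_prod idx) ({..<2 * Suc p} \<times> {..<m})" using f by simp
        show "word seq (Suc p)"
          unfolding word_def
        proof (intro allI impI)
          fix i assume "i < Suc p"
          then show "seq i < a" using run seq_a[of i] p unfolding valid_run_def by (cases "i < a") auto
        qed
        show "rank_at (Suc p) m (Gam S m seq (Suc p)) t \<le> e" if "t \<in> ppoly (Suc p) m \<delta> (\<lambda>_ _. 0)" for t
          unfolding e_def p by (rule gen(1)[OF that])
        show "\<exists>t\<in>ppoly (Suc p) m \<delta> (\<lambda>_ _. 0). rank_at (Suc p) m (Gam S m seq (Suc p)) t = e"
          unfolding e_def p by (rule gen(2))
        fix \<alpha> t assume \<alpha>: "\<alpha> < a" and t: "t \<in> ppoly (Suc (Suc p)) m \<delta> (\<lambda>_ _. 0)"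
        let ?h = "\<lambda>\<alpha>. gen_rk (Suc (Suc p)) m \<delta> (Gam S m (seq(Suc p := \<alpha>)) (Suc (Suc p)))"
        have "rank_at (Suc (Suc p)) m (Gam S m (seq(Suc p := \<alpha>)) (Suc (Suc p))) t \<le> ?h \<alpha>"
          by (rule gen(1)[OF t])
        also have "\<dots> \<le> Max (?h ` {..<a})" using \<alpha> by (intro Max_ge) auto
        also have "\<dots> \<le> e" using run unfolding valid_run_def p e_def by simp
        finally show "rank_at (Suc (Suc p)) m (Gam S m (seq(Suc p := \<alpha>)) (Suc (Suc p))) t \<le> e" .
      qed
      have main: "\<exists>ts r. ts \<in> ppoly (Suc p) m \<epsilon> (\<lambda>_ _. 0) \<and> (\<forall>j<m. ts p j = 0) \<and>
               r > 0 \<and> ppoly (Suc p) m r ts \<subseteq> ppoly (Suc p) m \<delta> (\<lambda>_ _. 0) \<and>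
               rank_at (Suc p) m (Gam S m seq (Suc p)) ts = e \<and>
               Psi ts ts = 0 \<and>
               (\<forall>t\<in>ppoly (Suc p) m r ts. rank_at (Suc p) m (Psi ts) t = e) \<and>
               (let Orb = Psi ts ` ppoly (Suc p) m r ts in
                  0 \<in> Orb \<and> csubmanifold Orb e \<and> system_tangent S a m Orb \<and>
                  (\<forall>M e'. csubmanifold M e' \<and> 0 \<in> M \<and> M \<subseteq> polydisc 1 \<and> system_tangent S a m M
                      \<longrightarrow> (\<exists>V. open V \<and> 0 \<in> V \<and> Orb \<inter> V \<subseteq> M)) \<and>
                  (\<exists>\<delta>1>0. \<forall>\<delta>'. 0 < \<delta>' \<and> \<delta>' \<le> \<delta>1 \<longrightarrow>
                      (\<exists>V. open V \<and> 0 \<in> V \<and> Orb \<inter> V = orbit0 S a m \<delta>' \<inter> V)))"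
        if \<epsilon>: "\<epsilon> > 0" for \<epsilon>
      proof -
        \<comment> \<open>The base point has to lie within \<epsilon> of 0 and the polydisc around
          it inside the one of radius \<delta>, so the smaller of both radii is taken.\<close>
        obtain ts r where g: "good (min \<epsilon> \<delta>) ts r" using ex_good[of "min \<epsilon> \<delta>"] \<epsilon> \<delta>_pos by auto
        have mono: "ppoly (Suc p) m (min \<epsilon> \<delta>) (\<lambda>_ _. 0) \<subseteq> ppoly (Suc p) m \<epsilon> (\<lambda>_ _. 0)"
          "ppoly (Suc p) m (min \<epsilon> \<delta>) (\<lambda>_ _. 0) \<subseteq> ppoly (Suc p) m \<delta> (\<lambda>_ _. 0)"
          by (auto simp: ppoly_def)
        have "ts \<in> ppoly (Suc p) m (min \<epsilon> \<delta>) (\<lambda>_ _. 0)"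
          "ppoly (Suc p) m r ts \<subseteq> ppoly (Suc p) m (min \<epsilon> \<delta>) (\<lambda>_ _. 0)"
          using g unfolding good_def by - (elim conjE, assumption)+
        then have sub: "ts \<in> ppoly (Suc p) m \<epsilon> (\<lambda>_ _. 0)" "ppoly (Suc p) m r ts \<subseteq> ppoly (Suc p) m \<delta> (\<lambda>_ _. 0)"
          using mono by blast+
        have orbit: "\<exists>\<delta>1>0. \<forall>\<delta>'. 0 < \<delta>' \<and> \<delta>' \<le> \<delta>1 \<longrightarrow>
            (\<exists>V. open V \<and> 0 \<in> V \<and> Psi ts ` ppoly (Suc p) m r ts \<inter> V = orbit0 S a m \<delta>' \<inter> V)"
          using good_represents_orbit[OF g] by blast
        have minimal: "\<forall>M e'. csubmanifold M e' \<and> 0 \<in> M \<and> M \<subseteq> polydisc 1 \<and> system_tangent S a m M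
            \<longrightarrow> (\<exists>V. open V \<and> 0 \<in> V \<and> Psi ts ` ppoly (Suc p) m r ts \<inter> V \<subseteq> M)"
          using good_minimal[OF g] by blast
        have gs: "\<forall>j<m. ts p j = 0" "r > 0" "rank_at (Suc p) m (Gam S m seq (Suc p)) ts = e" "Psi ts ts = 0"
          "\<forall>t\<in>ppoly (Suc p) m r ts. rank_at (Suc p) m (Psi ts) t = e" "0 \<in> Psi ts ` ppoly (Suc p) m r ts"
          "csubmanifold (Psi ts ` ppoly (Suc p) m r ts) e" "system_tangent S a m (Psi ts ` ppoly (Suc p) m r ts)"
          using g unfolding good_def by - (elim conjE, assumption)+
        show ?thesis
          unfolding Let_def by (intro exI[of _ ts] exI[of _ r] conjI gs sub minimal orbit)
      qed
      have Psi_eq: "(\<lambda>ts t. flowk S m (rev_seq seq p) p (rev_par ts p) (Gam S m seq (Suc p) t)) = Psi"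
        by (simp add: Psi_def fun_eq_iff)
      have Suc1: "Suc p - 1 = p" by simp
      show "?C \<delta> seq \<kappa>"
        unfolding p total(1) Let_def[of "Suc p"] Let_def[of e] Suc1 Psi_eq Let_def[of Psi]
        by (intro conjI allI impI main) (use \<kappa> in simp)
    qed
  qed
qed

end
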